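(* Let $A,B\subseteq\mathbb{R}^2$ be measurable sets such that $\overline{\delta}_{VC}(A,B)>0$. Let $\Gamma\subseteq\mathbb{R}^2$ be a closed, smooth, centrally symmetric (that is, $-\Gamma=\Gamma$) planar curve of non-vanishing curvature which is the boundary of some compact convex region in the plane with non-empty interior. For $t>0$ let $$\mathcal{T}_t(A,B):=\{(b+t\Gamma)\cap A : b\in B\}.$$ Then there exists $t_0>0$ such that for all $t\geq t_0$ the family $\mathcal{T}_t(A,B)$ has Vapnik--Chervonenkis dimension equal to $3$.
   Context: For measurable $A,B\subseteq\mathbb{R}^2$ and $x,v_1,v_2,v_3,s_1,s_2,s_3\in\mathbb{R}^2$ let $$\begin{aligned}\mathcal{F}_{A,B}(x;v_1,v_2,v_3;s_1,s_2,s_3):={}&\mathbb{1}_B(x)\,\mathbb{1}_A(x+v_1)\mathbb{1}_A(x+v_2)\mathbb{1}_A(x+v_3)\\&\cdot\mathbb{1}_B(x+v_1+v_2)\mathbb{1}_B(x+v_1+v_3)\mathbb{1}_B(x+v_2+v_3)\\&\cdot\mathbb{1}_B(x+v_1+s_1)\mathbb{1}_B(x+v_2+s_2)\mathbb{1}_B(x+v_3+s_3),\end{aligned}$$ where $\mathbb{1}_S$ is the indicator function of $S$, and define $$\overline{\delta}_{VC}(A,B):=\sup_{M\geq1}\ \limsup_{R\to+\infty}\ \sup_{z\in\mathbb{R}^2}\ \inf_{M\leq r\leq2^{-6}R}\ \frac{1}{(2r)^{12}R^2}\int_{z+[0,R]^2}\int_{([-r,r]^2)^6}\mathcal{F}_{A,B}(x;v_1,v_2,v_3;s_1,s_2,s_3)\,dv_1\,dv_2\,dv_3\,ds_1\,ds_2\,ds_3\,dx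 .$$ VC dimension: for a family $\mathcal{T}$ of subsets of a set $X$ (here $X=\mathbb{R}^2$), a finite set $C\subseteq X$ is shattered by $\mathcal{T}$ if for every $D\subseteq C$ there is $T\in\mathcal{T}$ with $T\cap C=D$. The VC dimension of $\mathcal{T}$ is the largest positive integer $n$ for which some $C\subseteq X$ of cardinality $n$ is shattered by $\mathcal{T}$ (it is $0$ if there is no such $n$, and $\infty$ if there are arbitrarily large such $n$). *)

theory Defs
  imports "HOL-Analysis.Analysis"
begin

definition FAB ::
  "(real^2) set \<Rightarrow> (real^2) set \<Rightarrow> real^2 \<Rightarrow> real^2 \<Rightarrow> real^2 \<Rightarrow> real^2
    \<Rightarrow> real^2 \<Rightarrow> real^2 \<Rightarrow> real^2 \<Rightarrow> ennreal" where
  "FAB A B x v1 v2 v3 s1 s2 s3 =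
     indicator B x * indicator A (x + v1) * indicator A (x + v2) * indicator A (x + v3)
     * indicator B (x + v1 + v2) * indicator B (x + v1 + v3) * indicator B (x + v2 + v3)
     * indicator B (x + v1 + s1) * indicator B (x + v2 + s2) * indicator B (x + v3 + s3)"

definition square :: "real^2 \<Rightarrow> real \<Rightarrow> real \<Rightarrow> (real^2) set" where
  "square z a b = {z + p | p. \<forall>i. a \<le> p $ i \<and> p $ i \<le> b}"

text \<open>
  Everything is computed in \<^typ>\<open>ennreal\<close>. For \<open>R < 64 * M\<close> the infimum ranges over the empty
  set and equals \<open>\<infinity>\<close>; this does not affect the limit superior as \<open>R\<close> tends to infinity.
  The inner integral is with respect to Lebesgue measure on the product space
  \<open>(real^2)^6\<close>.
\<close>

definition delta_avg :: "(real^2) set \<Rightarrow> (real^2) set \<Rightarrow> real^2 \<Rightarrow> real \<Rightarrow> real \<Rightarrow> ennreal" where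
  "delta_avg A B z R r =
     (\<integral>\<^sup>+x\<in>square z 0 R.
        (\<integral>\<^sup>+(v1, v2, v3, s1, s2, s3)\<in>
            square 0 (-r) r \<times> square 0 (-r) r \<times> square 0 (-r) r
            \<times> square 0 (-r) r \<times> square 0 (-r) r \<times> square 0 (-r) r.
          FAB A B x v1 v2 v3 s1 s2 s3 \<partial>lebesgue) \<partial>lebesgue)
     / ennreal ((2 * r) ^ 12 * R\<^sup>2)"

definition delta_VC :: "(real^2) set \<Rightarrow> (real^2) set \<Rightarrow> ennreal" where
  "delta_VC A B =
     (SUP M\<in>{1::real..}. Limsup at_top (\<lambda>R::real.
        SUP z. INF r\<in>{M..R / 2 ^ 6}. delta_avg A B z R r))"

definition smooth :: "(real \<Rightarrow> real^2) \<Rightarrow> bool" where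
  "smooth \<gamma> \<longleftrightarrow>
     (\<forall>n. ((\<lambda>f t. vector_derivative f (at t)) ^^ n) \<gamma> differentiable_on UNIV)"

definition signed_curvature :: "(real \<Rightarrow> real^2) \<Rightarrow> real \<Rightarrow> real" where
  "signed_curvature \<gamma> t =
     (let d1 = vector_derivative \<gamma> (at t);
          d2 = vector_derivative (\<lambda>u. vector_derivative \<gamma> (at u)) (at t)
      in (d1 $ 1 * d2 $ 2 - d1 $ 2 * d2 $ 1) / norm d1 ^ 3)"

text \<open>
  A closed smooth curve is the trace of a regular \<open>L\<close>-periodic \<open>C\<^sup>\<infinity>\<close> parametrization that is
  injective on a period. Up to sign, the curvature at a point of the trace does not depend
  on the choice of such a parametrization.
\<close>

definition closed_curve_param :: "real \<Rightarrow> (real \<Rightarrow> real^2) \<Rightarrow> bool" where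
  "closed_curve_param L \<gamma> \<longleftrightarrow>
     L > 0 \<and> smooth \<gamma> \<and> (\<forall>t. \<gamma> (t + L) = \<gamma> t) \<and> inj_on \<gamma> {0..<L}
     \<and> (\<forall>t. vector_derivative \<gamma> (at t) \<noteq> 0)"

definition smooth_closed_curve_nonvanishing_curvature :: "(real^2) set \<Rightarrow> bool" where
  "smooth_closed_curve_nonvanishing_curvature \<Gamma> \<longleftrightarrow>
     (\<exists>L \<gamma>. closed_curve_param L \<gamma> \<and> range \<gamma> = \<Gamma> \<and> (\<forall>t. signed_curvature \<gamma> t \<noteq> 0))"

definition shattered :: "'a set set \<Rightarrow> 'a set \<Rightarrow> bool" where
  "shattered \<T> C \<longleftrightarrow> (\<forall>D\<subseteq>C. \<exists>T\<in>\<T>. T \<inter> C = D)"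

text \<open>In \<^typ>\<open>enat\<close>, the supremum of the empty set is \<open>0\<close>, that of a nonempty finite set its
  maximum, and that of an infinite set \<open>\<infinity>\<close>.\<close>

definition VC_dim :: "'a set \<Rightarrow> 'a set set \<Rightarrow> enat" where
  "VC_dim X \<T> =
     Sup {enat n | n. n > 0 \<and> (\<exists>C\<subseteq>X. finite C \<and> card C = n \<and> shattered \<T> C)}"

definition translates_family ::
  "(real^2) set \<Rightarrow> real \<Rightarrow> (real^2) set \<Rightarrow> (real^2) set \<Rightarrow> (real^2) set set" where
  "translates_family \<Gamma> t A B = {(\<lambda>g. b + t *\<^sub>R g) ` \<Gamma> \<inter> A | b. b \<in> B}"

end

theory Submission
  imports Defs "HOL-Probability.Convolution"
begin

text \<open>
  Two distinct translates of the strictly convex curve \<open>t\<Gamma>\<close> share at most two points, so no four points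
  are shattered. For the same reason, if \<open>x, x + v\<^sub>i + v\<^sub>j, x + v\<^sub>i + s\<^sub>i \<in> B\<close> and \<open>p\<^sub>i = x + v\<^sub>i \<in> A\<close> with generic
  \<open>v\<^sub>i, s\<^sub>i \<in> t\<Gamma>\<close>, then the curves centred at these points of \<open>B\<close> cut out the subsets of \<open>{p\<^sub>1, p\<^sub>2, p\<^sub>3}\<close> of
  size three, two and one. Hence at a scale \<open>t\<close> with dimension less than three the average of \<open>\<F>\<close> over
  \<open>v\<^sub>i, s\<^sub>i\<close> distributed by a measure \<open>\<sigma>\<close> on an arc of \<open>t\<Gamma>\<close> vanishes, while the average over the square
  \<open>[-t,t]\<^sup>2\<close> is bounded below. It suffices that the two averages are close for one member of every long
  lacunary sequence of scales.

  Mollifying \<open>\<sigma>\<close> at scale \<open>\<epsilon>t\<close> costs little: by curvature the law of the difference of two independent points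
  of the arc is absolutely continuous, and the operator norm is estimated by a \<open>TT\<^sup>*\<close> argument and the
  continuity of translations in \<open>L\<^sup>1\<close>. Passing from the mollified measure to the square one \<open>v\<^sub>i\<close> at a time is
  a bilinear problem once the other two are fixed: the error is governed by the drop, between scales much
  smaller and much larger than \<open>t\<close>, of the \<open>L\<^sup>2\<close> norm of the averages of
  \<open>G(y) = 1\<^sub>A(y) 1\<^sub>B(y + v\<^sub>1) 1\<^sub>B(y + v\<^sub>2)\<close>. Averaged over \<open>v\<^sub>1, v\<^sub>2\<close>, this drop is part of the decrement of a
  form over the eight vertices of a cube with three independent scales. The parts of the decrement in the
  other two directions are dominated, by Cauchy--Schwarz, by forms with more coinciding functions; when
  all functions coincide every decrement is nonnegative. So the total drop over any number of scales is bounded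
  by a fixed multiple of the area, and is small at some scale.
\<close>

section \<open>Averages over shifts\<close>

text \<open>For a fixed function the energy drops telescope over the scales, so only boundedly many
  scales can be harmful. Here \<open>G\<close> depends on \<open>v1\<close>, \<open>v2\<close>,
  which are themselves spread at the current scale, so its averaged drop is one term of a sum that
  does not telescope. A separate level for each direction of the cube restores the telescoping, at
  the price of drops in the other two directions that have no sign. The points x + v_i + s_i bring
  in no further direction: integrating out s_i turns them into weights at x + v_i, and a small
  energy drop of \<open>1_B\<close> at that scale allows these weights to be replaced by one slowly
  varying function of x. All errors are proportional to a bound \<open>V\<close> for the areas
  involved, with constants that depend only on the arc and the density. Hence the ratio and the
  number of the scales are fixed before the window is chosen, and the window, of area comparable to
  \<open>R^2\<close>, can be as large as the last scale demands.\<close>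

type_synonym plane = "real^2"

definition bprob :: "plane measure \<Rightarrow> bool" where
  "bprob \<mu> \<longleftrightarrow> prob_space \<mu> \<and> sets \<mu> = sets borel"

definition avg :: "plane measure \<Rightarrow> (plane \<Rightarrow> real) \<Rightarrow> plane \<Rightarrow> real" where
  "avg \<mu> f y = (\<integral>u. f (y + u) \<partial>\<mu>)"

text \<open>Boundedness and integrability together put the function into every L^p and are preserved
  by products, shifts and averages, so all inner products below exist.\<close>

definition nice_fn :: "(plane \<Rightarrow> real) \<Rightarrow> bool" where
  "nice_fn f \<longleftrightarrow> f \<in> borel_measurable borel \<and> (\<exists>C. \<forall>x. \<bar>f x\<bar> \<le> C) \<and> integrable lborel f"

lemma bprobD: assumes "bprob \<mu>" shows "prob_space \<mu>" "sets \<mu> = sets borel" "space \<mu> = UNIV" "finite_measure \<mu>" "sigma_finite_measure \<mu>"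
proof -
  show 1: "prob_space \<mu>" "sets \<mu> = sets borel" using assms by (auto simp: bprob_def)
  show "space \<mu> = UNIV" using sets_eq_imp_space_eq[OF 1(2)] by simp
  interpret prob_space \<mu> by fact
  show "finite_measure \<mu>" "sigma_finite_measure \<mu>" by unfold_locales
qed

lemma bprob_measurable: assumes "bprob \<mu>" "f \<in> borel_measurable borel" shows "f \<in> borel_measurable \<mu>"
  using assms by (simp add: bprob_def cong: measurable_cong_sets)

lemma bprob_integrable:
  fixes f :: "plane \<Rightarrow> real"
  assumes "bprob \<mu>" "f \<in> borel_measurable borel" "\<And>x. \<bar>f x\<bar> \<le> C"
  shows "integrable \<mu> f"
proof -
  interpret prob_space \<mu> using bprobD[OF assms(1)] by simp
  show ?thesis by (rule integrable_const_bound[where B=C]) (use assms bprob_measurable in auto)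
qed

lemma bprob_integral_mono:
  fixes f g :: "plane \<Rightarrow> real"
  assumes "bprob \<mu>" "f \<in> borel_measurable borel" "\<And>x. \<bar>f x\<bar> \<le> C"
    "g \<in> borel_measurable borel" "\<And>x. \<bar>g x\<bar> \<le> D" "\<And>x. f x \<le> g x"
  shows "(\<integral>x. f x \<partial>\<mu>) \<le> (\<integral>x. g x \<partial>\<mu>)"
  by (intro integral_mono bprob_integrable[OF assms(1,2,3)] bprob_integrable[OF assms(1,4,5)] assms(6))

lemma bprob_const: "bprob \<mu> \<Longrightarrow> (\<integral>x. (c::real) \<partial>\<mu>) = c"
  using prob_space.prob_space bprobD(1) by fastforce

lemma bprob_integral_le:
  fixes f :: "plane \<Rightarrow> real"
  assumes "bprob \<mu>" "f \<in> borel_measurable borel" "\<And>x. l \<le> f x" "\<And>x. f x \<le> c"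
  shows "l \<le> (\<integral>x. f x \<partial>\<mu>)" "(\<integral>x. f x \<partial>\<mu>) \<le> c"
proof -
  have b: "\<bar>f x\<bar> \<le> \<bar>l\<bar> + \<bar>c\<bar>" for x using assms(3,4)[of x] by linarith
  show "(\<integral>x. f x \<partial>\<mu>) \<le> c"
    using bprob_integral_mono[OF assms(1,2) b _ _ assms(4), of "\<bar>c\<bar>"] unfolding bprob_const[OF assms(1)] by simp
  show "l \<le> (\<integral>x. f x \<partial>\<mu>)"
    using bprob_integral_mono[OF assms(1) _ _ assms(2) b assms(3), of "\<bar>l\<bar>"] unfolding bprob_const[OF assms(1)] by simp
qed

lemma bprob_integral_bound:
  fixes f :: "plane \<Rightarrow> real"
  assumes "bprob \<mu>" "f \<in> borel_measurable borel" "\<And>x. \<bar>f x\<bar> \<le> C"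
  shows "\<bar>\<integral>x. f x \<partial>\<mu>\<bar> \<le> C"
proof -
  have "- C \<le> f x" "f x \<le> C" for x using assms(3)[of x] by linarith+
  from bprob_integral_le[OF assms(1,2) this] show ?thesis by linarith
qed

lemma bprob_integral_measurable:
  assumes "bprob \<mu>" "case_prod f \<in> borel_measurable (M \<Otimes>\<^sub>M borel)"
  shows "(\<lambda>x. (\<integral>u. f x u \<partial>\<mu>) :: real) \<in> borel_measurable M"
proof -
  note [measurable_cong] = bprobD(2)[OF assms(1)]
  interpret sigma_finite_measure \<mu> using bprobD[OF assms(1)] by simp
  have [measurable]: "case_prod f \<in> borel_measurable (M \<Otimes>\<^sub>M \<mu>)"
    using assms(2) by measurable
  show ?thesis by (rule borel_measurable_lebesgue_integral) measurable
qed

lemma bprob_swap: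
  fixes f :: "plane \<Rightarrow> plane \<Rightarrow> real"
  assumes "bprob \<mu>" "bprob \<nu>" "case_prod f \<in> borel_measurable (borel \<Otimes>\<^sub>M borel)" "\<And>x y. \<bar>f x y\<bar> \<le> C"
  shows "(\<integral>x. \<integral>y. f x y \<partial>\<nu> \<partial>\<mu>) = (\<integral>y. \<integral>x. f x y \<partial>\<mu> \<partial>\<nu>)"
proof -
  note [measurable_cong] = bprobD(2)[OF assms(1)] bprobD(2)[OF assms(2)]
  interpret M: prob_space \<mu> using bprobD[OF assms(1)] by simp
  interpret N: prob_space \<nu> using bprobD[OF assms(2)] by simp
  interpret pair_prob_space \<mu> \<nu> ..
  have [measurable]: "case_prod f \<in> borel_measurable (\<mu> \<Otimes>\<^sub>M \<nu>)"
    using assms(3) by measurable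
  have "integrable (\<mu> \<Otimes>\<^sub>M \<nu>) (case_prod f)"
    by (rule P.integrable_const_bound[where B=C]) (use assms in \<open>auto split: prod.splits\<close>)
  from Fubini_integral[OF this] show ?thesis by simp
qed

text \<open>The bound is uniform in the shift \<open>u\<close> only, as \<open>f y u = g (y + u)\<close> has no integrable majorant in \<open>y\<close>.\<close>
lemma lborel_bprob_swap:
  fixes f :: "plane \<Rightarrow> plane \<Rightarrow> real"
  assumes "bprob \<mu>" "case_prod f \<in> borel_measurable (borel \<Otimes>\<^sub>M borel)"
    "\<And>u. integrable lborel (\<lambda>y. f y u)" "\<And>u. (LBINT y. \<bar>f y u\<bar>) \<le> C"
  shows "(LBINT y. \<integral>u. f y u \<partial>\<mu>) = (\<integral>u. \<integral>y. f y u \<partial>lborel \<partial>\<mu>)"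
    "integrable lborel (\<lambda>y. \<integral>u. f y u \<partial>\<mu>)"
    "(LBINT y. \<bar>\<integral>u. f y u \<partial>\<mu>\<bar>) \<le> C"
proof -
  note [measurable_cong] = bprobD(2)[OF assms(1)]
  interpret M: prob_space \<mu> using bprobD[OF assms(1)] by simp
  interpret pair_sigma_finite \<mu> "lborel :: plane measure" ..
  interpret Q: pair_sigma_finite "lborel :: plane measure" \<mu> ..
  have [measurable]: "case_prod f \<in> borel_measurable (lborel \<Otimes>\<^sub>M \<mu>)"
    using assms(2) by measurable
  have m: "(\<lambda>u. LBINT y. \<bar>f y u\<bar>) \<in> borel_measurable \<mu>"
    by measurable
  have C0: "0 \<le> C" by (rule order_trans[OF _ assms(4)[of 0]]) simp
  have i1: "integrable \<mu> (\<lambda>u. LBINT y. \<bar>f y u\<bar>)"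
    by (rule M.integrable_const_bound[where B=C, OF _ m]) (use assms(4) in auto)
  have int: "integrable (\<mu> \<Otimes>\<^sub>M lborel) (\<lambda>(u,y). f y u)"
    by (rule Fubini_integrable) (use i1 assms(3) in auto)
  show a: "(LBINT y. \<integral>u. f y u \<partial>\<mu>) = (\<integral>u. \<integral>y. f y u \<partial>lborel \<partial>\<mu>)"
    by (rule Fubini_integral[OF int])
  show b: "integrable lborel (\<lambda>y. \<integral>u. f y u \<partial>\<mu>)"
    by (rule integrable_snd[OF int])
  have int': "integrable (\<mu> \<Otimes>\<^sub>M lborel) (\<lambda>(u,y). \<bar>f y u\<bar>)"
    using integrable_abs[OF int] by (simp add: case_prod_beta')
  have "(LBINT y. \<bar>\<integral>u. f y u \<partial>\<mu>\<bar>) \<le> (LBINT y. \<integral>u. \<bar>f y u\<bar> \<partial>\<mu>)"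
    by (rule integral_mono[OF integrable_abs[OF b] integrable_snd[OF int']]) (rule integral_abs_bound)
  also have "\<dots> = (\<integral>u. \<integral>y. \<bar>f y u\<bar> \<partial>lborel \<partial>\<mu>)"
    by (rule Fubini_integral[OF int'])
  also have "\<dots> \<le> (\<integral>u. C \<partial>\<mu>)"
    by (rule integral_mono[OF i1]) (use assms(4) in auto)
  finally show "(LBINT y. \<bar>\<integral>u. f y u \<partial>\<mu>\<bar>) \<le> C" unfolding bprob_const[OF assms(1)] .
qed

lemma lborel_shift:
  fixes f :: "plane \<Rightarrow> real"
  assumes [measurable]: "f \<in> borel_measurable borel"
  shows "(LBINT y. f (y + u)) = (LBINT y. f y)" 
    "integrable lborel (\<lambda>y. f (y + u)) \<longleftrightarrow> integrable lborel f"
proof -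
  have "(LBINT y. f y) = (\<integral>y. f y \<partial>distr lborel borel ((+) u))"
    by (simp add: lborel_distr_plus)
  also have "\<dots> = (LBINT y. f (y + u))"
    by (subst integral_distr) (auto simp: add.commute)
  finally show "(LBINT y. f (y + u)) = (LBINT y. f y)" ..
  have "integrable lborel f \<longleftrightarrow> integrable (distr lborel borel ((+) u)) f"
    by (simp add: lborel_distr_plus)
  also have "\<dots> \<longleftrightarrow> integrable lborel (\<lambda>y. f (y + u))"
    by (subst integrable_distr_eq) (auto simp: add.commute)
  finally show "integrable lborel (\<lambda>y. f (y + u)) \<longleftrightarrow> integrable lborel f" ..
qed

lemma nice_fnD: assumes "nice_fn f" shows "f \<in> borel_measurable borel" "integrable lborel f"
  using assms by (auto simp: nice_fn_def)

lemma nice_fn_bdE: assumes "nice_fn f" obtains C where "\<And>x. \<bar>f x\<bar> \<le> C"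
  using assms by (auto simp: nice_fn_def)

lemma nice_fn_mult_bd:
  assumes "nice_fn f" "g \<in> borel_measurable borel" "\<And>x. \<bar>g x\<bar> \<le> C"
  shows "nice_fn (\<lambda>x. f x * g x)"
proof -
  from assms(1) obtain D where D: "\<And>x. \<bar>f x\<bar> \<le> D" by (rule nice_fn_bdE) blast
  note [measurable] = nice_fnD(1)[OF assms(1)] assms(2)
  have C: "0 \<le> C" using assms(3)[of 0] by linarith
  have "\<bar>f x * g x\<bar> \<le> D * C" for x
    unfolding abs_mult by (intro mult_mono D assms(3)) (use D[of x] in auto)
  moreover have "integrable lborel (\<lambda>x. f x * g x)"
    by (rule Bochner_Integration.integrable_bound[OF integrable_mult_right[OF integrable_abs[OF nice_fnD(2)[OF assms(1)]], of C]])
      (use assms(3) C in \<open>auto simp: abs_mult mult.commute[of C] intro!: mult_left_mono\<close>)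
  ultimately show ?thesis unfolding nice_fn_def by auto
qed

lemma nice_fn_mult: assumes "nice_fn f" "nice_fn g" shows "nice_fn (\<lambda>x. f x * g x)"
proof -
  from assms(2) obtain C where "\<And>x. \<bar>g x\<bar> \<le> C" by (rule nice_fn_bdE) blast
  from nice_fn_mult_bd[OF assms(1) nice_fnD(1)[OF assms(2)] this] show ?thesis .
qed

lemma nice_fn_add: assumes "nice_fn f" "nice_fn g" shows "nice_fn (\<lambda>x. f x + g x)"
proof -
  from assms obtain C D where CD: "\<And>x. \<bar>f x\<bar> \<le> C" "\<And>x. \<bar>g x\<bar> \<le> D" by (meson nice_fn_bdE)
  have "\<bar>f x + g x\<bar> \<le> C + D" for x using CD[of x] by linarith
  then show ?thesis using assms by (auto simp: nice_fn_def)
qed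

lemma nice_fn_cmult: assumes "nice_fn f" shows "nice_fn (\<lambda>x. c * f x)"
proof -
  have "nice_fn (\<lambda>x. f x * c)" by (rule nice_fn_mult_bd[OF assms, of _ "\<bar>c\<bar>"]) auto
  then show ?thesis by (simp add: mult.commute)
qed

lemma nice_fn_diff: assumes "nice_fn f" "nice_fn g" shows "nice_fn (\<lambda>x. f x - g x)"
  using nice_fn_add[OF assms(1) nice_fn_cmult[OF assms(2), of "-1"]] by simp

lemma nice_fn_shift: assumes "nice_fn f" shows "nice_fn (\<lambda>x. f (x + u))"
  using assms lborel_shift(2)[OF nice_fnD(1)[OF assms]] by (auto simp: nice_fn_def)

lemma nice_fn_sq: "nice_fn f \<Longrightarrow> nice_fn (\<lambda>x. (f x)\<^sup>2)"
  using nice_fn_mult[of f f] by (simp add: power2_eq_square)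

lemma nice_fn_abs: "nice_fn f \<Longrightarrow> nice_fn (\<lambda>x. \<bar>f x\<bar>)"
  by (auto simp: nice_fn_def)

lemma avg_measurable:
  assumes "bprob \<mu>" "f \<in> borel_measurable borel" shows "avg \<mu> f \<in> borel_measurable borel"
proof -
  note [measurable] = assms(2)
  show ?thesis unfolding avg_def[abs_def] by (rule bprob_integral_measurable[OF assms(1)]) measurable
qed

lemma avg_bound:
  assumes "bprob \<mu>" "f \<in> borel_measurable borel" "\<And>x. \<bar>f x\<bar> \<le> C" shows "\<bar>avg \<mu> f y\<bar> \<le> C"
  unfolding avg_def by (rule bprob_integral_bound[OF assms(1)]) (use assms in auto)

lemma avg_le:
  assumes "bprob \<mu>" "f \<in> borel_measurable borel" "\<And>x. l \<le> f x" "\<And>x. f x \<le> c"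
  shows "l \<le> avg \<mu> f y" "avg \<mu> f y \<le> c"
  unfolding avg_def by (rule bprob_integral_le[OF assms(1)]; use assms in auto)+

lemma avg_integral:
  assumes "bprob \<mu>" "nice_fn f"
  shows "(LBINT y. avg \<mu> f y) = (LBINT y. f y)"
    "integrable lborel (avg \<mu> f)" "(LBINT y. \<bar>avg \<mu> f y\<bar>) \<le> (LBINT y. \<bar>f y\<bar>)"
proof -
  note [measurable] = nice_fnD(1)[OF assms(2)]
  have 1: "(\<lambda>(y,u). f (y+u)) \<in> borel_measurable (borel \<Otimes>\<^sub>M borel)" by measurable
  have 2: "integrable lborel (\<lambda>y. f (y + u))" for u using nice_fnD(2)[OF nice_fn_shift[OF assms(2)]] .
  have 3: "(LBINT y. \<bar>f (y + u)\<bar>) \<le> (LBINT y. \<bar>f y\<bar>)" for u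
    using lborel_shift(1)[of "\<lambda>y. \<bar>f y\<bar>" u] by simp
  note r = lborel_bprob_swap[OF assms(1) 1 2 3, folded avg_def]
  show "integrable lborel (avg \<mu> f)" "(LBINT y. \<bar>avg \<mu> f y\<bar>) \<le> (LBINT y. \<bar>f y\<bar>)"
    using r(2,3) by (simp_all add: avg_def[abs_def])
  show "(LBINT y. avg \<mu> f y) = (LBINT y. f y)"
    using r(1) lborel_shift(1)[of f] bprob_const[OF assms(1)] by simp
qed

lemma nice_fn_avg: assumes "bprob \<mu>" "nice_fn f" shows "nice_fn (avg \<mu> f)"
proof -
  from assms(2) obtain C where "\<And>x. \<bar>f x\<bar> \<le> C" by (rule nice_fn_bdE) blast
  from avg_bound[OF assms(1) nice_fnD(1)[OF assms(2)] this] avg_integral(2)[OF assms] avg_measurable[OF assms(1) nice_fnD(1)[OF assms(2)]]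
  show ?thesis unfolding nice_fn_def by auto
qed

lemma avg_inner:
  assumes "bprob \<mu>" "nice_fn f" "nice_fn g"
  shows "(LBINT y. f y * avg \<mu> g y) = (\<integral>u. \<integral>y. f y * g (y + u) \<partial>lborel \<partial>\<mu>)"
proof -
  note [measurable] = nice_fnD(1)[OF assms(2)] nice_fnD(1)[OF assms(3)]
  from assms(3) obtain C where C: "\<And>x. \<bar>g x\<bar> \<le> C" by (rule nice_fn_bdE) blast
  have C0: "0 \<le> C" using C[of 0] by linarith
  have 1: "(\<lambda>(y,u). f y * g (y+u)) \<in> borel_measurable (borel \<Otimes>\<^sub>M borel)" by measurable
  have 2: "integrable lborel (\<lambda>y. f y * g (y + u))" for u by (rule nice_fnD[OF nice_fn_mult[OF assms(2) nice_fn_shift[OF assms(3)]]])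
  have 3: "(LBINT y. \<bar>f y * g (y + u)\<bar>) \<le> (LBINT y. \<bar>f y\<bar> * C)" for u
    by (rule integral_mono[OF integrable_abs[OF 2]])
      (use nice_fnD(2)[OF assms(2)] C C0 in \<open>auto simp: abs_mult intro!: mult_left_mono\<close>)
  show ?thesis unfolding avg_def using lborel_bprob_swap(1)[OF assms(1) 1 2 3] by simp
qed

text \<open>The variance of \<open>f (y + u)\<close> over \<open>u\<close> is nonnegative, so the
  squared mean is at most the mean of the square, and averaging preserves the integral of the
  latter. Every decrease of energy below rests on this contraction.\<close>

lemma avg_sq_le:
  assumes "bprob \<mu>" "nice_fn f"
  shows "(LBINT y. (avg \<mu> f y)\<^sup>2) \<le> (LBINT y. (f y)\<^sup>2)"
proof -
  from assms(2) obtain C where C: "\<And>x. \<bar>f x\<bar> \<le> C" by (rule nice_fn_bdE) blast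
  interpret prob_space \<mu> using bprobD[OF assms(1)] by simp
  note [measurable] = nice_fnD(1)[OF assms(2)]
  have pt: "(avg \<mu> f y)\<^sup>2 \<le> avg \<mu> (\<lambda>x. (f x)\<^sup>2) y" for y
  proof -
    have i: "integrable \<mu> (\<lambda>u. f (y + u))"
      by (rule bprob_integrable[OF assms(1), of _ C]) (use C in auto)
    have j: "integrable \<mu> (\<lambda>u. (f (y + u))\<^sup>2)"
      by (rule bprob_integrable[OF assms(1), of _ "C\<^sup>2"]) (use C power_mono[OF C abs_ge_zero, of _ 2] in simp_all)
    have "0 \<le> (\<integral>u. (f (y + u) - avg \<mu> f y)\<^sup>2 \<partial>\<mu>)" by simp
    also have "\<dots> = (\<integral>u. (f (y + u))\<^sup>2 - 2 * avg \<mu> f y * f (y + u) + (avg \<mu> f y)\<^sup>2 \<partial>\<mu>)"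
      by (simp add: power2_diff algebra_simps)
    also have "\<dots> = avg \<mu> (\<lambda>x. (f x)\<^sup>2) y - 2 * avg \<mu> f y * avg \<mu> f y + (avg \<mu> f y)\<^sup>2"
      using i j bprob_const[OF assms(1)] by (simp add: avg_def prob_space)
    finally show ?thesis by (simp add: power2_eq_square)
  qed
  have "(LBINT y. (avg \<mu> f y)\<^sup>2) \<le> (LBINT y. avg \<mu> (\<lambda>x. (f x)\<^sup>2) y)"
    by (rule integral_mono[OF nice_fnD(2)[OF nice_fn_sq[OF nice_fn_avg[OF assms]]] nice_fnD(2)[OF nice_fn_avg[OF assms(1) nice_fn_sq[OF assms(2)]]]])
      (rule pt)
  also have "\<dots> = (LBINT y. (f y)\<^sup>2)" by (rule avg_integral(1)[OF assms(1) nice_fn_sq[OF assms(2)]])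
  finally show ?thesis .
qed

lemma avg_commute:
  assumes "bprob \<mu>" "bprob \<nu>" "f \<in> borel_measurable borel" "\<And>x. \<bar>f x\<bar> \<le> C"
  shows "avg \<mu> (avg \<nu> f) = avg \<nu> (avg \<mu> f)"
proof
  fix y
  note [measurable] = assms(3)
  have "(\<integral>u. \<integral>v. f (y + u + v) \<partial>\<nu> \<partial>\<mu>) = (\<integral>v. \<integral>u. f (y + u + v) \<partial>\<mu> \<partial>\<nu>)"
  proof (rule bprob_swap[OF assms(1,2)])
    show "(\<lambda>(u, v). f (y + u + v)) \<in> borel_measurable (borel \<Otimes>\<^sub>M borel)" by measurable
  qed (rule assms(4))
  also have "\<dots> = avg \<nu> (avg \<mu> f) y"
    unfolding avg_def by (intro Bochner_Integration.integral_cong refl arg_cong[where f=f]) simp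
  finally show "avg \<mu> (avg \<nu> f) y = avg \<nu> (avg \<mu> f) y" by (simp add: avg_def)
qed

section \<open>Symmetric measures, convolutions and correlations of functions\<close>

definition symm_measure :: "plane measure \<Rightarrow> bool" where
  "symm_measure \<mu> \<longleftrightarrow> (\<forall>f C. f \<in> borel_measurable borel \<longrightarrow> (\<forall>x. \<bar>f x\<bar> \<le> C) \<longrightarrow> (\<integral>u. f (- u) \<partial>\<mu>) = (\<integral>u. (f u :: real) \<partial>\<mu>))"

text \<open>Integrated against a measure this is the bilinear form of the averaging operator
  (\<open>avg_inner_corr\<close>), so statements about operators become statements about integrals
  of one function of the shift.\<close>

definition corr :: "(plane \<Rightarrow> real) \<Rightarrow> (plane \<Rightarrow> real) \<Rightarrow> plane \<Rightarrow> real" where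
  "corr f g u = (LBINT y. f y * g (y + u))"

lemma bprob_conv: assumes "bprob \<mu>" "bprob \<nu>" shows "bprob (\<mu> \<star> \<nu>)"
proof -
  note [measurable_cong] = bprobD(2)[OF assms(1)] bprobD(2)[OF assms(2)]
  interpret M: prob_space \<mu> using bprobD[OF assms(1)] by simp
  interpret N: prob_space \<nu> using bprobD[OF assms(2)] by simp
  interpret pair_prob_space \<mu> \<nu> ..
  have "prob_space (distr (\<mu> \<Otimes>\<^sub>M \<nu>) borel (\<lambda>(x, y). x + y))"
    by (rule P.prob_space_distr) measurable
  then show ?thesis by (simp add: bprob_def convolution_def)
qed

lemma integral_conv:
  fixes f :: "plane \<Rightarrow> real"
  assumes "bprob \<mu>" "bprob \<nu>" "f \<in> borel_measurable borel" "\<And>x. \<bar>f x\<bar> \<le> C"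
  shows "(\<integral>x. f x \<partial>(\<mu> \<star> \<nu>)) = (\<integral>u. \<integral>v. f (u + v) \<partial>\<nu> \<partial>\<mu>)"
proof -
  note [measurable_cong] = bprobD(2)[OF assms(1)] bprobD(2)[OF assms(2)]
  note [measurable] = assms(3)
  interpret M: prob_space \<mu> using bprobD[OF assms(1)] by simp
  interpret N: prob_space \<nu> using bprobD[OF assms(2)] by simp
  interpret pair_prob_space \<mu> \<nu> ..
  have "integrable (\<mu> \<Otimes>\<^sub>M \<nu>) (\<lambda>(u,v). f (u + v))"
    by (rule P.integrable_const_bound[where B=C]) (use assms in \<open>auto split: prod.splits\<close>)
  from integral_fst[OF this] show ?thesis
    unfolding convolution_def by (subst integral_distr) (auto simp: case_prod_beta')
qed

lemma avg_conv:
  assumes "bprob \<mu>" "bprob \<nu>" "f \<in> borel_measurable borel" "\<And>x. \<bar>f x\<bar> \<le> C"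
  shows "avg (\<mu> \<star> \<nu>) f = avg \<mu> (avg \<nu> f)"
proof
  fix y
  note [measurable] = assms(3)
  have "(\<integral>x. f (y + x) \<partial>(\<mu> \<star> \<nu>)) = (\<integral>u. \<integral>v. f (y + (u + v)) \<partial>\<nu> \<partial>\<mu>)"
    by (rule integral_conv[OF assms(1,2)]) (measurable, rule assms(4))
  then show "avg (\<mu> \<star> \<nu>) f y = avg \<mu> (avg \<nu> f) y" by (simp add: avg_def add.assoc)
qed

lemma symm_measureD: "symm_measure \<mu> \<Longrightarrow> f \<in> borel_measurable borel \<Longrightarrow> (\<And>x. \<bar>f x\<bar> \<le> C) \<Longrightarrow> (\<integral>u. f (- u) \<partial>\<mu>) = (\<integral>u. (f u :: real) \<partial>\<mu>)"
  unfolding symm_measure_def by blast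

lemma symm_measure_conv: assumes "bprob \<mu>" "bprob \<nu>" "symm_measure \<mu>" "symm_measure \<nu>" shows "symm_measure (\<mu> \<star> \<nu>)"
  unfolding symm_measure_def
proof (intro allI impI)
  fix f :: "plane \<Rightarrow> real" and C assume [measurable]: "f \<in> borel_measurable borel" and C: "\<forall>x. \<bar>f x\<bar> \<le> C"
  have "(\<integral>u. f (- u) \<partial>(\<mu> \<star> \<nu>)) = (\<integral>u. \<integral>v. f (- (u + v)) \<partial>\<nu> \<partial>\<mu>)"
    by (rule integral_conv[OF assms(1,2), where C=C]) (use C in auto)
  also have "\<dots> = (\<integral>u. \<integral>v. f (- u + (- v)) \<partial>\<nu> \<partial>\<mu>)" by simp
  also have "\<dots> = (\<integral>u. \<integral>v. f (- u + v) \<partial>\<nu> \<partial>\<mu>)"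
    by (intro Bochner_Integration.integral_cong refl symm_measureD[OF assms(4), where C=C]) (use C in auto)
  also have "\<dots> = (\<integral>u. \<integral>v. f (u + v) \<partial>\<nu> \<partial>\<mu>)"
  proof (rule symm_measureD[OF assms(3), where C=C])
    show "(\<lambda>u. \<integral>v. f (u + v) \<partial>\<nu>) \<in> borel_measurable borel"
      by (rule bprob_integral_measurable[OF assms(2)]) measurable
    show "\<bar>\<integral>v. f (u + v) \<partial>\<nu>\<bar> \<le> C" for u by (rule bprob_integral_bound[OF assms(2)]) (use C in auto)
  qed
  also have "\<dots> = (\<integral>u. f u \<partial>(\<mu> \<star> \<nu>))"
    by (rule integral_conv[OF assms(1,2), where C=C, symmetric]) (use C in auto)
  finally show "(\<integral>u. f (- u) \<partial>(\<mu> \<star> \<nu>)) = (\<integral>u. f u \<partial>(\<mu> \<star> \<nu>))" .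
qed

lemma corr_measurable: "nice_fn f \<Longrightarrow> nice_fn g \<Longrightarrow> corr f g \<in> borel_measurable borel"
proof -
  assume "nice_fn f" "nice_fn g"
  note [measurable] = this[THEN nice_fnD(1)]
  show ?thesis unfolding corr_def[abs_def] by measurable
qed

lemma corr_bound: assumes "nice_fn f" "nice_fn g" shows "\<exists>C. \<forall>u. \<bar>corr f g u\<bar> \<le> C"
proof -
  from assms(2) obtain C where C: "\<And>x. \<bar>g x\<bar> \<le> C" by (rule nice_fn_bdE) blast
  have "\<bar>corr f g u\<bar> \<le> (LBINT y. \<bar>f y\<bar> * C)" for u
  proof -
    have "\<bar>corr f g u\<bar> \<le> (LBINT y. \<bar>f y * g (y + u)\<bar>)" unfolding corr_def by (rule integral_abs_bound)
    also have "\<dots> \<le> (LBINT y. \<bar>f y\<bar> * C)"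
      by (rule integral_mono[OF integrable_abs[OF nice_fnD(2)[OF nice_fn_mult[OF assms(1) nice_fn_shift[OF assms(2)]]]]])
       (use nice_fnD(2)[OF assms(1)] C in \<open>auto simp: abs_mult intro!: mult_left_mono\<close>)
    finally show ?thesis .
  qed
  then show ?thesis by blast
qed

lemma avg_inner_corr: "bprob \<mu> \<Longrightarrow> nice_fn f \<Longrightarrow> nice_fn g \<Longrightarrow> (LBINT y. f y * avg \<mu> g y) = (\<integral>u. corr f g u \<partial>\<mu>)"
  unfolding corr_def by (rule avg_inner)

lemma corr_swap: assumes "nice_fn f" "nice_fn g" shows "corr g f u = corr f g (- u)"
proof -
  note [measurable] = nice_fnD(1)[OF assms(1)] nice_fnD(1)[OF assms(2)]
  have "(LBINT y. (\<lambda>y. g (y - u) * f y) (y + u)) = (LBINT y. g (y - u) * f y)"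
    by (rule lborel_shift(1)) measurable
  then show ?thesis by (simp add: corr_def mult.commute)
qed

text \<open>Exchanging \<open>f\<close> and \<open>g\<close> reflects the correlation, and a
  symmetric measure does not see the reflection.\<close>

lemma avg_adjoint:
  assumes "bprob \<mu>" "symm_measure \<mu>" "nice_fn f" "nice_fn g"
  shows "(LBINT y. f y * avg \<mu> g y) = (LBINT y. avg \<mu> f y * g y)"
proof -
  obtain C where C: "\<And>u. \<bar>corr f g u\<bar> \<le> C" using corr_bound[OF assms(3,4)] by blast
  have "(LBINT y. f y * avg \<mu> g y) = (\<integral>u. corr f g u \<partial>\<mu>)" by (rule avg_inner_corr[OF assms(1,3,4)])
  also have "\<dots> = (\<integral>u. corr f g (- u) \<partial>\<mu>)"
    by (rule symm_measureD[OF assms(2), symmetric]) (use C corr_measurable assms in auto)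
  also have "\<dots> = (\<integral>u. corr g f u \<partial>\<mu>)" using corr_swap[OF assms(3,4)] by simp
  also have "\<dots> = (LBINT y. g y * avg \<mu> f y)" by (rule avg_inner_corr[OF assms(1,4,3), symmetric])
  finally show ?thesis by (simp add: mult.commute)
qed

section \<open>Energies along a chain of symmetric convolutions\<close>

text \<open>The index counts factors: \<open>pconv b k\<close> convolves \<open>b 0\<close> up to
  \<open>b (k - 1)\<close>. With rapidly increasing scales, \<open>b k\<close> is therefore much
  coarser than all of \<open>pconv b k\<close>; level 0 is no averaging at all.\<close>

primrec pconv :: "(nat \<Rightarrow> plane measure) \<Rightarrow> nat \<Rightarrow> plane measure" where
  "pconv b 0 = return borel 0"
| "pconv b (Suc k) = (pconv b k \<star> b k)"

text \<open>The doubled convolution makes the quadratic form of the averaging operator the square of the norm of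
  an average, so that adding further factors can only decrease it.\<close>
definition dconv :: "(nat \<Rightarrow> plane measure) \<Rightarrow> nat \<Rightarrow> plane measure" where
  "dconv b k = (pconv b k \<star> pconv b k)"

lemma bprob_pconv: assumes "\<And>k. bprob (b k)" shows "bprob (pconv b k)"
proof (induction k)
  case 0 show ?case by (simp add: bprob_def prob_space_return)
next
  case (Suc k) then show ?case by (simp add: bprob_conv assms)
qed

lemma symm_measure_pconv: assumes "\<And>k. bprob (b k)" "\<And>k. symm_measure (b k)" shows "symm_measure (pconv b k)"
proof (induction k)
  case 0 then show ?case by (auto simp: symm_measure_def integral_return)
next
  case (Suc k) then show ?case by (auto intro!: symm_measure_conv bprob_pconv assms)
qed

lemma bprob_dconv: assumes "\<And>k. bprob (b k)" shows "bprob (dconv b k)"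
  unfolding dconv_def by (intro bprob_conv bprob_pconv assms)

lemma dconv_inner:
  assumes "\<And>k. bprob (b k)" "\<And>k. symm_measure (b k)" "nice_fn f" "nice_fn g"
  shows "(\<integral>u. corr f g u \<partial>dconv b k) = (LBINT y. avg (pconv b k) f y * avg (pconv b k) g y)"
proof -
  note p = bprob_pconv[of b k, OF assms(1)]
  from assms(4) obtain C where C: "\<And>x. \<bar>g x\<bar> \<le> C" by (rule nice_fn_bdE) blast
  have "(\<integral>u. corr f g u \<partial>dconv b k) = (LBINT y. f y * avg (dconv b k) g y)"
    by (rule avg_inner_corr[OF bprob_dconv[OF assms(1)] assms(3,4), symmetric])
  also have "avg (dconv b k) g = avg (pconv b k) (avg (pconv b k) g)"
    unfolding dconv_def by (rule avg_conv[OF p p nice_fnD(1)[OF assms(4)] C])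
  also have "(LBINT y. f y * avg (pconv b k) (avg (pconv b k) g) y) = (LBINT y. avg (pconv b k) f y * avg (pconv b k) g y)"
    by (rule avg_adjoint[OF p symm_measure_pconv[OF assms(1,2)] assms(3) nice_fn_avg[OF p assms(4)]])
  finally show ?thesis .
qed

lemma avg_pconv_Suc:
  assumes "\<And>k. bprob (b k)" "nice_fn f"
  shows "avg (pconv b (Suc k)) f = avg (b k) (avg (pconv b k) f)"
proof -
  from assms(2) obtain C where C: "\<And>x. \<bar>f x\<bar> \<le> C" by (rule nice_fn_bdE) blast
  show ?thesis
    using avg_conv[OF bprob_pconv assms(1) nice_fnD(1)[OF assms(2)] C, of b k k] avg_commute[OF bprob_pconv assms(1) nice_fnD(1)[OF assms(2)] C, of b k k] assms(1)
    by simp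
qed

text \<open>Each further factor acts as one more averaging operator on the previous average and
  contracts L2.\<close>

lemma energy_mono:
  assumes "\<And>k. bprob (b k)" "nice_fn f" "k \<le> l"
  shows "(LBINT y. (avg (pconv b l) f y)\<^sup>2) \<le> (LBINT y. (avg (pconv b k) f y)\<^sup>2)"
  using assms(3)
proof (induction rule: dec_induct)
  case (step n)
  have "(LBINT y. (avg (pconv b (Suc n)) f y)\<^sup>2) \<le> (LBINT y. (avg (pconv b n) f y)\<^sup>2)"
    unfolding avg_pconv_Suc[OF assms(1,2)] by (rule avg_sq_le[OF assms(1) nice_fn_avg[OF bprob_pconv[OF assms(1)] assms(2)]])
  with step show ?case by linarith
qed simp

lemma dconv_energy_mono:
  assumes "\<And>k. bprob (b k)" "\<And>k. symm_measure (b k)" "nice_fn f" "k \<le> l"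
  shows "(\<integral>u. corr f f u \<partial>dconv b l) \<le> (\<integral>u. corr f f u \<partial>dconv b k)"
  using energy_mono[OF assms(1,3,4)] dconv_inner[OF assms(1,2,3,3)] by (simp add: power2_eq_square)

lemma avg_add:
  assumes "bprob \<mu>" "nice_fn f" "nice_fn g"
  shows "avg \<mu> (\<lambda>x. f x + c * g x) y = avg \<mu> f y + c * avg \<mu> g y"
proof -
  from assms(2) obtain C where C: "\<And>x. \<bar>f x\<bar> \<le> C" by (rule nice_fn_bdE) blast
  from assms(3) obtain D where D: "\<And>x. \<bar>g x\<bar> \<le> D" by (rule nice_fn_bdE) blast
  note [measurable] = nice_fnD(1)[OF assms(2)] nice_fnD(1)[OF assms(3)]
  have "integrable \<mu> (\<lambda>u. f (y + u))" by (rule bprob_integrable[OF assms(1) _ C]) measurable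
  moreover have "integrable \<mu> (\<lambda>u. g (y + u))" by (rule bprob_integrable[OF assms(1) _ D]) measurable
  ultimately show ?thesis by (simp add: avg_def)
qed

text \<open>The decrement \<open>Q\<close> is positive semidefinite because energies decrease;
  nonnegativity at \<open>f + g\<close> and at \<open>f - g\<close> gives the bound. The arithmetic
  mean is kept rather than the geometric one: it is linear in the decrements and can be integrated
  and summed over scales.\<close>

lemma dconv_cauchy_schwarz:
  assumes "\<And>k. bprob (b k)" "\<And>k. symm_measure (b k)" "nice_fn f" "nice_fn g" "k \<le> l"
  defines "Q \<equiv> \<lambda>f g. (\<integral>u. corr f g u \<partial>dconv b k) - (\<integral>u. corr f g u \<partial>dconv b l)"
  shows "\<bar>Q f g\<bar> \<le> (Q f f + Q g g) / 2"
proof -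
  have pol: "(\<integral>u. corr (\<lambda>x. f x + c * g x) (\<lambda>x. f x + c * g x) u \<partial>dconv b j)
    = (\<integral>u. corr f f u \<partial>dconv b j) + 2 * c * (\<integral>u. corr f g u \<partial>dconv b j) + c\<^sup>2 * (\<integral>u. corr g g u \<partial>dconv b j)" for c j
  proof -
    note p = bprob_pconv[of b j, OF assms(1)]
    let ?F = "avg (pconv b j) f" and ?G = "avg (pconv b j) g"
    have n: "nice_fn ?F" "nice_fn ?G" using assms p by (auto intro: nice_fn_avg)
    have i: "integrable lborel (\<lambda>y. ?F y * ?F y)" "integrable lborel (\<lambda>y. ?F y * ?G y)" "integrable lborel (\<lambda>y. ?G y * ?G y)"
      using n by (auto intro!: nice_fnD(2)[OF nice_fn_mult])
    have "(\<integral>u. corr (\<lambda>x. f x + c * g x) (\<lambda>x. f x + c * g x) u \<partial>dconv b j) = (LBINT y. (?F y + c * ?G y) * (?F y + c * ?G y))"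
      by (subst dconv_inner) (use assms nice_fn_add nice_fn_cmult avg_add[OF p] in auto)
    also have "\<dots> = (LBINT y. ?F y * ?F y + 2 * c * (?F y * ?G y) + c\<^sup>2 * (?G y * ?G y))"
      by (simp add: algebra_simps power2_eq_square)
    also have "\<dots> = (LBINT y. ?F y * ?F y) + 2 * c * (LBINT y. ?F y * ?G y) + c\<^sup>2 * (LBINT y. ?G y * ?G y)"
      using i by simp
    finally show ?thesis using dconv_inner[OF assms(1,2)] assms(3,4) by simp
  qed
  have "0 \<le> Q (\<lambda>x. f x + c * g x) (\<lambda>x. f x + c * g x)" for c
    unfolding Q_def using dconv_energy_mono[OF assms(1,2) nice_fn_add[OF assms(3) nice_fn_cmult[OF assms(4)]] assms(5)] by simp
  from this[of 1] this[of "-1"] show ?thesis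
    unfolding Q_def pol abs_le_iff by (simp add: field_simps)
qed

section \<open>The cube form\<close>

definition kernel3 :: "real \<Rightarrow> (plane \<Rightarrow> plane \<Rightarrow> plane \<Rightarrow> real) \<Rightarrow> bool" where
  "kernel3 C K \<longleftrightarrow> (\<lambda>(u, v, w). K u v w) \<in> borel_measurable (borel \<Otimes>\<^sub>M borel \<Otimes>\<^sub>M borel) \<and> (\<forall>u v w. \<bar>K u v w\<bar> \<le> C)"

definition integral3 :: "plane measure \<Rightarrow> plane measure \<Rightarrow> plane measure \<Rightarrow> (plane \<Rightarrow> plane \<Rightarrow> plane \<Rightarrow> real) \<Rightarrow> real" where
  "integral3 \<mu>1 \<mu>2 \<mu>3 K = (\<integral>u. \<integral>v. \<integral>w. K u v w \<partial>\<mu>3 \<partial>\<mu>2 \<partial>\<mu>1)"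

lemma kernel3D: assumes "kernel3 C K" shows "(\<lambda>(u, v, w). K u v w) \<in> borel_measurable (borel \<Otimes>\<^sub>M borel \<Otimes>\<^sub>M borel)" "\<bar>K u v w\<bar> \<le> C"
  using assms by (auto simp: kernel3_def)

lemma kernel3_perm: assumes "kernel3 C K" shows "kernel3 C (\<lambda>u v w. K v u w)" "kernel3 C (\<lambda>u v w. K u w v)"
proof -
  note [measurable] = kernel3D(1)[OF assms]
  have 1: "(\<lambda>(u, v, w). (\<lambda>(u,v,w). K u v w) (v, u, w)) \<in> borel_measurable (borel \<Otimes>\<^sub>M borel \<Otimes>\<^sub>M borel)" by measurable
  have 2: "(\<lambda>(u, v, w). (\<lambda>(u,v,w). K u v w) (u, w, v)) \<in> borel_measurable (borel \<Otimes>\<^sub>M borel \<Otimes>\<^sub>M borel)" by measurable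
  show "kernel3 C (\<lambda>u v w. K v u w)" "kernel3 C (\<lambda>u v w. K u w v)" using 1 2 kernel3D(2)[OF assms] by (auto simp: kernel3_def)
qed

lemma kernel3_slice:
  assumes "kernel3 C K"
  shows "(\<lambda>w. K u v w) \<in> borel_measurable borel" "(\<lambda>(v,w). K u v w) \<in> borel_measurable (borel \<Otimes>\<^sub>M borel)"
    "(\<lambda>(v,u). K u v w) \<in> borel_measurable (borel \<Otimes>\<^sub>M borel)"
    "(\<lambda>(u,v). K u v w) \<in> borel_measurable (borel \<Otimes>\<^sub>M borel)"
proof -
  note [measurable] = kernel3D(1)[OF assms]
  have "(\<lambda>w. (\<lambda>(u,v,w). K u v w) (u, v, w)) \<in> borel_measurable borel" by measurable
  then show "(\<lambda>w. K u v w) \<in> borel_measurable borel" by simp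
  have "(\<lambda>(v,w). (\<lambda>(u,v,w). K u v w) (u, v, w)) \<in> borel_measurable (borel \<Otimes>\<^sub>M borel)" by measurable
  then show "(\<lambda>(v,w). K u v w) \<in> borel_measurable (borel \<Otimes>\<^sub>M borel)" by simp
  have "(\<lambda>(v,u). (\<lambda>(u,v,w). K u v w) (u, v, w)) \<in> borel_measurable (borel \<Otimes>\<^sub>M borel)" by measurable
  then show "(\<lambda>(v,u). K u v w) \<in> borel_measurable (borel \<Otimes>\<^sub>M borel)" by simp
  have "(\<lambda>(u,v). (\<lambda>(u,v,w). K u v w) (u, v, w)) \<in> borel_measurable (borel \<Otimes>\<^sub>M borel)" by measurable
  then show "(\<lambda>(u,v). K u v w) \<in> borel_measurable (borel \<Otimes>\<^sub>M borel)" by simp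
qed

lemma kernel3_inner:
  assumes "bprob \<mu>" "kernel3 C K"
  shows "(\<lambda>(u, v). \<integral>w. K u v w \<partial>\<mu>) \<in> borel_measurable (borel \<Otimes>\<^sub>M borel)" "\<bar>\<integral>w. K u v w \<partial>\<mu>\<bar> \<le> C"
proof -
  note [measurable] = kernel3D(1)[OF assms(2)]
  have "(\<lambda>x. \<integral>w. (\<lambda>(u,v,w). K u v w) (fst x, snd x, w) \<partial>\<mu>) \<in> borel_measurable (borel \<Otimes>\<^sub>M borel)"
    by (rule bprob_integral_measurable[OF assms(1)]) measurable
  then show "(\<lambda>(u, v). \<integral>w. K u v w \<partial>\<mu>) \<in> borel_measurable (borel \<Otimes>\<^sub>M borel)" by (simp add: case_prod_beta')
  show "\<bar>\<integral>w. K u v w \<partial>\<mu>\<bar> \<le> C" by (rule bprob_integral_bound[OF assms(1) kernel3_slice(1)[OF assms(2)] kernel3D(2)[OF assms(2)]])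
qed

lemma kernel3_inner2:
  assumes "bprob \<mu>" "bprob \<nu>" "kernel3 C K"
  shows "(\<lambda>u. \<integral>v. \<integral>w. K u v w \<partial>\<nu> \<partial>\<mu>) \<in> borel_measurable borel" "\<bar>\<integral>v. \<integral>w. K u v w \<partial>\<nu> \<partial>\<mu>\<bar> \<le> C"
    "(\<lambda>v. \<integral>w. K u v w \<partial>\<nu>) \<in> borel_measurable borel"
proof -
  note m [measurable] = kernel3_inner(1)[OF assms(2,3)]
  show "(\<lambda>u. \<integral>v. \<integral>w. K u v w \<partial>\<nu> \<partial>\<mu>) \<in> borel_measurable borel"
    by (rule bprob_integral_measurable[OF assms(1) m])
  have "(\<lambda>v. (\<lambda>(u,v). \<integral>w. K u v w \<partial>\<nu>) (u, v)) \<in> borel_measurable borel" by measurable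
  then show 1: "(\<lambda>v. \<integral>w. K u v w \<partial>\<nu>) \<in> borel_measurable borel" by simp
  show "\<bar>\<integral>v. \<integral>w. K u v w \<partial>\<nu> \<partial>\<mu>\<bar> \<le> C"
    by (rule bprob_integral_bound[OF assms(1) 1 kernel3_inner(2)[OF assms(2,3)]])
qed

lemma integral3_bound: "bprob \<mu>1 \<Longrightarrow> bprob \<mu>2 \<Longrightarrow> bprob \<mu>3 \<Longrightarrow> kernel3 C K \<Longrightarrow> \<bar>integral3 \<mu>1 \<mu>2 \<mu>3 K\<bar> \<le> C"
  unfolding integral3_def by (rule bprob_integral_bound[OF _ kernel3_inner2(1,2)])

lemma integral3_swap23:
  assumes "bprob \<mu>2" "bprob \<mu>3" "kernel3 C K"
  shows "integral3 \<mu>1 \<mu>2 \<mu>3 K = integral3 \<mu>1 \<mu>3 \<mu>2 (\<lambda>u w v. K u v w)"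
  unfolding integral3_def by (intro Bochner_Integration.integral_cong refl bprob_swap[OF assms(1,2) kernel3_slice(2)[OF assms(3)] kernel3D(2)[OF assms(3)]])

lemma integral3_swap12:
  assumes "bprob \<mu>1" "bprob \<mu>2" "bprob \<mu>3" "kernel3 C K"
  shows "integral3 \<mu>1 \<mu>2 \<mu>3 K = integral3 \<mu>2 \<mu>1 \<mu>3 (\<lambda>v u w. K u v w)"
  unfolding integral3_def by (rule bprob_swap[OF assms(1,2) kernel3_inner[OF assms(3,4)]])

text \<open>Only the innermost measure changes, so a bound for each \<open>u\<close>,
  \<open>v\<close> by the same change of another kernel can be integrated over both. The
  Cauchy--Schwarz step supplies such an \<open>L\<close> as half the sum of two kernels.\<close>

lemma integral3_diff_le:
  assumes "bprob \<mu>1" "bprob \<mu>2" "bprob \<mu>3" "bprob \<mu>3'" "kernel3 C K" "kernel3 D L"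
    "\<And>u v. \<bar>(\<integral>w. K u v w \<partial>\<mu>3) - (\<integral>w. K u v w \<partial>\<mu>3')\<bar> \<le> (\<integral>w. L u v w \<partial>\<mu>3) - (\<integral>w. L u v w \<partial>\<mu>3')"
  shows "\<bar>integral3 \<mu>1 \<mu>2 \<mu>3 K - integral3 \<mu>1 \<mu>2 \<mu>3' K\<bar> \<le> integral3 \<mu>1 \<mu>2 \<mu>3 L - integral3 \<mu>1 \<mu>2 \<mu>3' L"
proof -
  define P :: "plane measure \<Rightarrow> (plane \<Rightarrow> plane \<Rightarrow> plane \<Rightarrow> real) \<Rightarrow> plane \<Rightarrow> plane \<Rightarrow> real" where "P = (\<lambda>\<mu> K u v. \<integral>w. K u v w \<partial>\<mu> :: real)"
  have I: "integrable \<mu>2 (P \<mu> K' u)" "integrable \<mu>1 (\<lambda>u. \<integral>v. P \<mu> K' u v \<partial>\<mu>2)" if "bprob \<mu>" "kernel3 E K'" for \<mu> K' E u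
    unfolding P_def using that assms
    by (auto intro!: bprob_integrable[OF assms(1) kernel3_inner2(1,2)[OF assms(2) that]] bprob_integrable[OF assms(2) kernel3_inner2(3)[OF assms(2) that]  kernel3_inner(2)[OF that]])
  note i = I[OF assms(3,5)] I[OF assms(4,5)] I[OF assms(3,6)] I[OF assms(4,6)]
  have e: "integral3 \<mu>1 \<mu>2 \<mu> K' = (\<integral>u. \<integral>v. P \<mu> K' u v \<partial>\<mu>2 \<partial>\<mu>1)" for \<mu> K' by (simp add: integral3_def P_def)
  have d: "integral3 \<mu>1 \<mu>2 \<mu>3 K' - integral3 \<mu>1 \<mu>2 \<mu>3' K' = (\<integral>u. \<integral>v. P \<mu>3 K' u v - P \<mu>3' K' u v \<partial>\<mu>2 \<partial>\<mu>1)" if "kernel3 E K'" for E K'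
    unfolding e using I[OF assms(3) that] I[OF assms(4) that] by simp
  have "\<bar>\<integral>u. \<integral>v. P \<mu>3 K u v - P \<mu>3' K u v \<partial>\<mu>2 \<partial>\<mu>1\<bar> \<le> (\<integral>u. \<bar>\<integral>v. P \<mu>3 K u v - P \<mu>3' K u v \<partial>\<mu>2\<bar> \<partial>\<mu>1)"
    by (rule integral_abs_bound)
  also have "\<dots> \<le> (\<integral>u. \<integral>v. P \<mu>3 L u v - P \<mu>3' L u v \<partial>\<mu>2 \<partial>\<mu>1)"
  proof (rule integral_mono)
    show "integrable \<mu>1 (\<lambda>u. \<bar>\<integral>v. P \<mu>3 K u v - P \<mu>3' K u v \<partial>\<mu>2\<bar>)"
      using i by (subst Bochner_Integration.integral_diff) auto
    show "integrable \<mu>1 (\<lambda>u. \<integral>v. P \<mu>3 L u v - P \<mu>3' L u v \<partial>\<mu>2)"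
      using i by (subst Bochner_Integration.integral_diff) auto
    fix u
    have "\<bar>\<integral>v. P \<mu>3 K u v - P \<mu>3' K u v \<partial>\<mu>2\<bar> \<le> (\<integral>v. \<bar>P \<mu>3 K u v - P \<mu>3' K u v\<bar> \<partial>\<mu>2)"
      by (rule integral_abs_bound)
    also have "\<dots> \<le> (\<integral>v. P \<mu>3 L u v - P \<mu>3' L u v \<partial>\<mu>2)"
      by (rule integral_mono) (use i assms(7) in \<open>auto simp: P_def\<close>)
    finally show "\<bar>\<integral>v. P \<mu>3 K u v - P \<mu>3' K u v \<partial>\<mu>2\<bar> \<le> (\<integral>v. P \<mu>3 L u v - P \<mu>3' L u v \<partial>\<mu>2)" .
  qed
  finally show ?thesis unfolding d[OF assms(5)] d[OF assms(6)] .
qed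

text \<open>With \<open>L = K\<close> the pointwise hypothesis of \<open>integral3_diff_le\<close>
  says exactly that the change is nonnegative.\<close>

lemma integral3_mono:
  assumes "bprob \<mu>1" "bprob \<mu>2" "bprob \<mu>3" "bprob \<mu>3'" "kernel3 C K"
    "\<And>u v. (\<integral>w. K u v w \<partial>\<mu>3') \<le> (\<integral>w. K u v w \<partial>\<mu>3)"
  shows "integral3 \<mu>1 \<mu>2 \<mu>3' K \<le> integral3 \<mu>1 \<mu>2 \<mu>3 K"
proof -
  have "\<bar>integral3 \<mu>1 \<mu>2 \<mu>3 K - integral3 \<mu>1 \<mu>2 \<mu>3' K\<bar> \<le> integral3 \<mu>1 \<mu>2 \<mu>3 K - integral3 \<mu>1 \<mu>2 \<mu>3' K"
    by (rule integral3_diff_le[OF assms(1-5,5)]) (use assms(6) in simp)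
  then show ?thesis by linarith
qed

lemma integral3_cmult_add:
  assumes "bprob \<mu>1" "bprob \<mu>2" "bprob \<mu>3" "kernel3 C K" "kernel3 D L"
  shows "integral3 \<mu>1 \<mu>2 \<mu>3 (\<lambda>u v w. c * K u v w + d * L u v w) = c * integral3 \<mu>1 \<mu>2 \<mu>3 K + d * integral3 \<mu>1 \<mu>2 \<mu>3 L"
    "kernel3 (\<bar>c\<bar> * C + \<bar>d\<bar> * D) (\<lambda>u v w. c * K u v w + d * L u v w)"
proof -
  have i: "integrable \<mu>3 (\<lambda>w. K' u v w)" "integrable \<mu>2 (\<lambda>v. \<integral>w. K' u v w \<partial>\<mu>3)" "integrable \<mu>1 (\<lambda>u. \<integral>v. \<integral>w. K' u v w \<partial>\<mu>3 \<partial>\<mu>2)"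
    if "kernel3 E K'" for u v E K'
    by (rule bprob_integrable[OF assms(3) kernel3_slice(1)[OF that] kernel3D(2)[OF that]] 
      bprob_integrable[OF assms(2) kernel3_inner2(3)[OF assms(2,3) that] kernel3_inner(2)[OF assms(3) that]]
      bprob_integrable[OF assms(1) kernel3_inner2(1)[OF assms(2,3) that] kernel3_inner2(2)[OF assms(2,3) that]])+
  show "integral3 \<mu>1 \<mu>2 \<mu>3 (\<lambda>u v w. c * K u v w + d * L u v w) = c * integral3 \<mu>1 \<mu>2 \<mu>3 K + d * integral3 \<mu>1 \<mu>2 \<mu>3 L"
    unfolding integral3_def using i[OF assms(4)] i[OF assms(5)] by simp
  note [measurable] = kernel3D(1)[OF assms(4)] kernel3D(1)[OF assms(5)]
  have "(\<lambda>x. c * (\<lambda>(u,v,w). K u v w) x + d * (\<lambda>(u,v,w). L u v w) x) \<in> borel_measurable (borel \<Otimes>\<^sub>M borel \<Otimes>\<^sub>M borel)" by measurable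
  moreover have "\<bar>c * K u v w + d * L u v w\<bar> \<le> \<bar>c\<bar> * C + \<bar>d\<bar> * D" for u v w
    by (rule order_trans[OF abs_triangle_ineq]) (auto simp: abs_mult intro!: add_mono mult_left_mono kernel3D(2)[OF assms(4)] kernel3D(2)[OF assms(5)])
  ultimately show "kernel3 (\<bar>c\<bar> * C + \<bar>d\<bar> * D) (\<lambda>u v w. c * K u v w + d * L u v w)"
    by (simp add: kernel3_def case_prod_beta')
qed

section \<open>Weights with values in [0, 1] and the correlation over the vertices of a cube\<close>

definition unit_fn :: "real \<Rightarrow> (plane \<Rightarrow> real) \<Rightarrow> bool" where
  "unit_fn V f \<longleftrightarrow> f \<in> borel_measurable borel \<and> (\<forall>x. 0 \<le> f x \<and> f x \<le> 1) \<and> integrable lborel f \<and> (LBINT x. f x) \<le> V"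

lemma unit_fnD: assumes "unit_fn V f" shows "f \<in> borel_measurable borel" "0 \<le> f x" "f x \<le> 1" "\<bar>f x\<bar> \<le> 1" "integrable lborel f" "(LBINT x. f x) \<le> V" "nice_fn f"
  using assms unfolding unit_fn_def nice_fn_def by (auto intro!: exI[of _ 1])

text \<open>A further factor at most one can only decrease the integral, so the bound
  \<open>V\<close> survives products of any length. This keeps all error terms proportional to a
  single area.\<close>

lemma unit_fn_mult_bd:
  assumes "unit_fn V f" "g \<in> borel_measurable borel" "\<And>x. 0 \<le> g x" "\<And>x. g x \<le> 1"
  shows "unit_fn V (\<lambda>x. f x * g x)"
proof -
  have n: "nice_fn (\<lambda>x. f x * g x)" by (rule nice_fn_mult_bd[OF unit_fnD(7)[OF assms(1)] assms(2), of 1]) (use assms in auto)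
  have le: "f x * g x \<le> f x" for x using mult_left_mono[OF assms(4) unit_fnD(2)[OF assms(1)]] by simp
  have "(LBINT x. f x * g x) \<le> (LBINT x. f x)"
    by (rule integral_mono[OF nice_fnD(2)[OF n] unit_fnD(5)[OF assms(1)] le])
  with n le show ?thesis using unit_fnD[OF assms(1)] assms(3) 
    unfolding unit_fn_def by (auto simp: nice_fnD intro: order_trans[OF le])
qed

lemma unit_fn_mult: "unit_fn V f \<Longrightarrow> unit_fn W g \<Longrightarrow> unit_fn V (\<lambda>x. f x * g x)"
  by (rule unit_fn_mult_bd) (auto dest: unit_fnD)

lemma unit_fn_shift: assumes "unit_fn V f" shows "unit_fn V (\<lambda>x. f (x + u))"
  using assms lborel_shift[OF unit_fnD(1)[OF assms], of u] by (auto simp: unit_fn_def)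

text \<open>The vertices of the cube are \<open>y + k\<^sub>1u + k\<^sub>2v + k\<^sub>3w\<close>; the function at a vertex depends on \<open>k\<^sub>2, k\<^sub>3\<close> only.\<close>
definition cube_corr where
  "cube_corr f00 f10 f01 f11 u v w = (\<integral>y. f00 y * f10 (y+v) * f01 (y+w) * f11 (y+v+w)
     * (f00 (y+u) * f10 (y+u+v) * f01 (y+u+w) * (f11 (y+u+v+w) :: real)) \<partial>(lborel :: plane measure))"

lemma cube_corr_kernel3:
  assumes "unit_fn V f00" "unit_fn V f10" "unit_fn V f01" "unit_fn V f11"
  shows "kernel3 V (cube_corr f00 f10 f01 f11)" "0 \<le> cube_corr f00 f10 f01 f11 u v w"
proof -
  note [measurable] = assms[THEN unit_fnD(1)]
  have "(\<lambda>(u, v, w). cube_corr f00 f10 f01 f11 u v w) \<in> borel_measurable (borel \<Otimes>\<^sub>M borel \<Otimes>\<^sub>M borel)"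
    unfolding cube_corr_def by measurable
  moreover have K: "0 \<le> cube_corr f00 f10 f01 f11 u v w \<and> cube_corr f00 f10 f01 f11 u v w \<le> V" for u v w
  proof -
    have "unit_fn V (\<lambda>y. f00 y * f10 (y+v) * f01 (y+w) * f11 (y+v+w) * (f00 (y+u) * f10 (y+u+v) * f01 (y+u+w) * f11 (y+u+v+w)))"
      unfolding add.assoc by (intro unit_fn_mult[where W=V] unit_fn_shift assms)
    from unit_fnD[OF this] show ?thesis unfolding cube_corr_def by (intro conjI Bochner_Integration.integral_nonneg) auto
  qed
  ultimately show "kernel3 V (cube_corr f00 f10 f01 f11)" by (auto simp: kernel3_def abs_le_iff intro: order_trans[of _ 0])
  show "0 \<le> cube_corr f00 f10 f01 f11 u v w" using K by auto
qed

text \<open>The two faces across the \<open>u\<close> direction carry the same product, so the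
  kernel is an autocorrelation in \<open>u\<close>. This is the source of the sign of the drops in
  \<open>u\<close>.\<close>

lemma cube_corr_corr_u:
  "cube_corr f00 f10 f01 f11 u v w = corr (\<lambda>y. f00 y * f10 (y+v) * f01 (y+w) * f11 (y+v+w)) (\<lambda>y. f00 y * f10 (y+v) * f01 (y+w) * f11 (y+v+w)) u"
  by (simp add: cube_corr_def corr_def)

text \<open>Across the \<open>v\<close> direction the faces carry different products,
  \<open>f00\<close> and \<open>f01\<close> on one, \<open>f10\<close> and \<open>f11\<close> on the
  other, so this is a mixed correlation that can only be bounded by Cauchy--Schwarz.\<close>

lemma cube_corr_corr_v:
  "cube_corr f00 f10 f01 f11 u v w = corr (\<lambda>y. f00 y * f00 (y+u) * f01 (y+w) * f01 (y+u+w)) (\<lambda>y. f10 y * f10 (y+u) * f11 (y+w) * f11 (y+u+w)) v"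
  by (simp add: cube_corr_def corr_def ac_simps)

lemma cube_corr_swap_vw: "cube_corr f00 f10 f01 f11 u v w = cube_corr f00 f01 f10 f11 u w v"
  by (simp add: cube_corr_def ac_simps)

text \<open>Here the function at a vertex depends on the coordinate of \<open>w\<close> alone, so
  \<open>u\<close> and \<open>v\<close> play the same part.\<close>

lemma cube_corr_swap_uv: "cube_corr f f h h u v w = cube_corr f f h h v u w"
  by (simp add: cube_corr_def ac_simps)

section \<open>Decrements of the cube form along the levels of a chain\<close>

locale chain =
  fixes b :: "nat \<Rightarrow> plane measure" and V :: real
  assumes bprob_b: "\<And>k. bprob (b k)" and symm_b: "\<And>k. symm_measure (b k)"
begin

text \<open>The levels \<open>i\<close>, \<open>j\<close>, \<open>k\<close> belong to
  \<open>u\<close>, \<open>v\<close>, \<open>w\<close>. The integral over \<open>u\<close> is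
  innermost so that a change of \<open>i\<close> is a change of the innermost measure;
  \<open>cube_form_alt\<close> provides the order suited to \<open>j\<close>.\<close>

definition cube_form where "cube_form i j k f00 f10 f01 f11 = integral3 (dconv b j) (dconv b k) (dconv b i) (\<lambda>v w u. cube_corr f00 f10 f01 f11 u v w)"

lemmas bprob_nu = bprob_dconv[of b, OF bprob_b]

context
  fixes f00 f10 f01 f11 assumes c: "unit_fn V f00" "unit_fn V f10" "unit_fn V f01" "unit_fn V f11"
begin

lemma cube_corr_kernels: "kernel3 V (\<lambda>v w u. cube_corr f00 f10 f01 f11 u v w)" "kernel3 V (\<lambda>u w v. cube_corr f00 f10 f01 f11 u v w)"
  using kernel3_perm[OF kernel3_perm(2)[OF kernel3_perm(1)[OF cube_corr_kernel3(1)[OF c]]]] kernel3_perm(2)[OF kernel3_perm(1)[OF cube_corr_kernel3(1)[OF c]]] kernel3_perm(2)[OF cube_corr_kernel3(1)[OF c]] by auto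

lemma cube_form_alt: "cube_form i j k f00 f10 f01 f11 = integral3 (dconv b i) (dconv b k) (dconv b j) (\<lambda>u w v. cube_corr f00 f10 f01 f11 u v w)"
proof -
  have "cube_form i j k f00 f10 f01 f11 = integral3 (dconv b k) (dconv b j) (dconv b i) (\<lambda>w v u. cube_corr f00 f10 f01 f11 u v w)"
    unfolding cube_form_def by (rule integral3_swap12[OF bprob_nu bprob_nu bprob_nu cube_corr_kernels(1)])
  also have "\<dots> = integral3 (dconv b k) (dconv b i) (dconv b j) (\<lambda>w u v. cube_corr f00 f10 f01 f11 u v w)"
    by (rule integral3_swap23[OF bprob_nu bprob_nu]) (rule kernel3_perm(1)[OF cube_corr_kernels(1)])
  also have "\<dots> = integral3 (dconv b i) (dconv b k) (dconv b j) (\<lambda>u w v. cube_corr f00 f10 f01 f11 u v w)"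
    by (rule integral3_swap12[OF bprob_nu bprob_nu bprob_nu]) (rule kernel3_perm(1)[OF cube_corr_kernels(2)])
  finally show ?thesis .
qed

lemma cube_form_nonneg: "0 \<le> cube_form i j k f00 f10 f01 f11"
  unfolding cube_form_def integral3_def by (intro Bochner_Integration.integral_nonneg cube_corr_kernel3(2)[OF c])

lemma cube_form_le: "cube_form i j k f00 f10 f01 f11 \<le> V"
  using integral3_bound[OF bprob_nu bprob_nu bprob_nu cube_corr_kernels(1)] unfolding cube_form_def by (simp add: abs_le_iff)

text \<open>For fixed \<open>v\<close>, \<open>w\<close> the integral over \<open>u\<close> is an
  energy of the product over one face, which decreases along the chain.\<close>

lemma cube_form_mono: "i \<le> i' \<Longrightarrow> cube_form i' j k f00 f10 f01 f11 \<le> cube_form i j k f00 f10 f01 f11"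
  unfolding cube_form_def
  by (rule integral3_mono[OF bprob_nu bprob_nu bprob_nu bprob_nu cube_corr_kernels(1)], unfold cube_corr_corr_u, rule dconv_energy_mono[OF bprob_b symm_b])
    (auto simp: add.assoc intro!: unit_fnD(7)[where V=V] unit_fn_mult[where W=V] unit_fn_shift c)

lemma cube_form_swap_vw: "cube_form i j k f00 f10 f01 f11 = cube_form i k j f00 f01 f10 f11"
proof -
  have "cube_form i j k f00 f10 f01 f11 = integral3 (dconv b k) (dconv b j) (dconv b i) (\<lambda>w v u. cube_corr f00 f10 f01 f11 u v w)"
    unfolding cube_form_def by (rule integral3_swap12[OF bprob_nu bprob_nu bprob_nu cube_corr_kernels(1)])
  then show ?thesis unfolding cube_form_def by (subst cube_corr_swap_vw)
qed

end

lemma cube_form_swap_uv: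
  assumes c: "unit_fn V f" "unit_fn V h"
  shows "cube_form i j k f f h h = cube_form j i k f f h h"
proof -
  have "cube_form i j k f f h h = integral3 (dconv b i) (dconv b k) (dconv b j) (\<lambda>u w v. cube_corr f f h h u v w)"
    by (rule cube_form_alt[OF c(1,1,2,2)])
  also have "\<dots> = cube_form j i k f f h h" unfolding cube_form_def by (subst cube_corr_swap_uv) simp
  finally show ?thesis .
qed

text \<open>With \<open>u\<close> and \<open>w\<close> fixed, \<open>dconv_cauchy_schwarz\<close> is
  applied to the two faces across \<open>v\<close>. Each majorant repeats one face, so its functions
  no longer depend on the coordinate of \<open>v\<close>, and its own decrements in \<open>v\<close>
  have a sign.\<close>

lemma cube_form_cs_v:
  assumes c: "unit_fn V f00" "unit_fn V f10" "unit_fn V f01" "unit_fn V f11" and "j \<le> j'"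
  shows "\<bar>cube_form i j k f00 f10 f01 f11 - cube_form i j' k f00 f10 f01 f11\<bar>
    \<le> ((cube_form i j k f00 f00 f01 f01 - cube_form i j' k f00 f00 f01 f01) + (cube_form i j k f10 f10 f11 f11 - cube_form i j' k f10 f10 f11 f11)) / 2"
proof -
  let ?L = "\<lambda>u w v. (1/2) * cube_corr f00 f00 f01 f01 u v w + (1/2) * cube_corr f10 f10 f11 f11 u v w"
  note t1 = cube_corr_kernels(2)[OF c(1,1,3,3)] and t2 = cube_corr_kernels(2)[OF c(2,2,4,4)]
  have t: "kernel3 (\<bar>1/2\<bar> * V + \<bar>1/2\<bar> * V) ?L" by (rule integral3_cmult_add(2)[OF bprob_nu bprob_nu bprob_nu t1 t2])
  have "\<bar>integral3 (dconv b i) (dconv b k) (dconv b j) (\<lambda>u w v. cube_corr f00 f10 f01 f11 u v w) - integral3 (dconv b i) (dconv b k) (dconv b j') (\<lambda>u w v. cube_corr f00 f10 f01 f11 u v w)\<bar>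
     \<le> integral3 (dconv b i) (dconv b k) (dconv b j) ?L - integral3 (dconv b i) (dconv b k) (dconv b j') ?L"
  proof (rule integral3_diff_le[OF bprob_nu bprob_nu bprob_nu bprob_nu cube_corr_kernels(2)[OF c] t])
    fix u w
    let ?X = "\<lambda>y. f00 y * f00 (y+u) * f01 (y+w) * f01 (y+u+w)"
    let ?Y = "\<lambda>y. f10 y * f10 (y+u) * f11 (y+w) * f11 (y+u+w)"
    have n: "nice_fn ?X" "nice_fn ?Y" by (auto simp: add.assoc intro!: unit_fnD(7)[where V=V] unit_fn_mult[where W=V] unit_fn_shift c)
    have ii: "integrable (dconv b l) (\<lambda>v. cube_corr f00 f00 f01 f01 u v w)" "integrable (dconv b l) (\<lambda>v. cube_corr f10 f10 f11 f11 u v w)" for l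
      by (rule bprob_integrable[OF bprob_nu kernel3_slice(1)[OF t1] kernel3D(2)[OF t1]] bprob_integrable[OF bprob_nu kernel3_slice(1)[OF t2] kernel3D(2)[OF t2]])+
    have "\<bar>(\<integral>v. corr ?X ?Y v \<partial>dconv b j) - (\<integral>v. corr ?X ?Y v \<partial>dconv b j')\<bar> \<le>
       (((\<integral>v. corr ?X ?X v \<partial>dconv b j) - (\<integral>v. corr ?X ?X v \<partial>dconv b j')) + ((\<integral>v. corr ?Y ?Y v \<partial>dconv b j) - (\<integral>v. corr ?Y ?Y v \<partial>dconv b j'))) / 2"
      by (rule dconv_cauchy_schwarz[OF bprob_b symm_b n assms(5)])
    then show "\<bar>(\<integral>v. cube_corr f00 f10 f01 f11 u v w \<partial>dconv b j) - (\<integral>v. cube_corr f00 f10 f01 f11 u v w \<partial>dconv b j')\<bar>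
      \<le> (\<integral>v. ?L u w v \<partial>dconv b j) - (\<integral>v. ?L u w v \<partial>dconv b j')"
      unfolding cube_corr_corr_v[symmetric] using ii by (simp add: field_simps)
  qed
  then show ?thesis
    unfolding cube_form_alt[OF c] cube_form_alt[OF c(1,1,3,3)] cube_form_alt[OF c(2,2,4,4)]
      integral3_cmult_add(1)[OF bprob_nu bprob_nu bprob_nu t1 t2] by (simp add: field_simps)
qed

lemma cube_form_cs_w:
  assumes c: "unit_fn V f00" "unit_fn V f10" "unit_fn V f01" "unit_fn V f11" and "k \<le> k'"
  shows "\<bar>cube_form i j k f00 f10 f01 f11 - cube_form i j k' f00 f10 f01 f11\<bar>
    \<le> ((cube_form i j k f00 f10 f00 f10 - cube_form i j k' f00 f10 f00 f10) + (cube_form i j k f01 f11 f01 f11 - cube_form i j k' f01 f11 f01 f11)) / 2"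
  unfolding cube_form_swap_vw[OF c] cube_form_swap_vw[OF c(1,2,1,2)] cube_form_swap_vw[OF c(3,4,3,4)]
  by (rule cube_form_cs_v[OF c(1,3,2,4) assms(5)])

text \<open>The levels move from \<open>2n\<close> to \<open>2n + 2\<close> along a monotone path on which \<open>u\<close> changes while \<open>v\<close> and
  \<open>w\<close> are at level \<open>2n + 1\<close>, the scale of the configurations.\<close>
definition cube_drop_u where "cube_drop_u n f00 f10 f01 f11 = cube_form (2*n) (2*n+1) (2*n+1) f00 f10 f01 f11 - cube_form (2*n+2) (2*n+1) (2*n+1) f00 f10 f01 f11"
definition cube_drop_v where "cube_drop_v n f00 f10 f01 f11 = (cube_form (2*n) (2*n) (2*n) f00 f10 f01 f11 - cube_form (2*n) (2*n+1) (2*n) f00 f10 f01 f11)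
   + (cube_form (2*n+2) (2*n+1) (2*n+1) f00 f10 f01 f11 - cube_form (2*n+2) (2*n+2) (2*n+1) f00 f10 f01 f11)"
definition cube_drop_w where "cube_drop_w n f00 f10 f01 f11 = (cube_form (2*n) (2*n+1) (2*n) f00 f10 f01 f11 - cube_form (2*n) (2*n+1) (2*n+1) f00 f10 f01 f11)
   + (cube_form (2*n+2) (2*n+2) (2*n+1) f00 f10 f01 f11 - cube_form (2*n+2) (2*n+2) (2*n+2) f00 f10 f01 f11)"

lemma telescope: "(\<Sum>n<J. cube_drop_u n f00 f10 f01 f11 + cube_drop_v n f00 f10 f01 f11 + cube_drop_w n f00 f10 f01 f11) = cube_form 0 0 0 f00 f10 f01 f11 - cube_form (2*J) (2*J) (2*J) f00 f10 f01 f11"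
  by (induction J) (auto simp: cube_drop_u_def cube_drop_v_def cube_drop_w_def)

text \<open>After cancellation there remains a value at the start, at most \<open>V\<close>, minus a
  value at the end, which is nonnegative.\<close>

lemma telescope_le:
  assumes c: "unit_fn V f00" "unit_fn V f10" "unit_fn V f01" "unit_fn V f11"
  shows "(\<Sum>n<J. cube_drop_u n f00 f10 f01 f11) + (\<Sum>n<J. cube_drop_v n f00 f10 f01 f11) + (\<Sum>n<J. cube_drop_w n f00 f10 f01 f11) \<le> V"
  using telescope[of f00 f10 f01 f11 J] cube_form_le[OF c, of 0 0 0] cube_form_nonneg[OF c, of "2*J" "2*J" "2*J"] by (simp add: sum.distrib)

lemma cube_drop_u_nonneg: "unit_fn V f00 \<Longrightarrow> unit_fn V f10 \<Longrightarrow> unit_fn V f01 \<Longrightarrow> unit_fn V f11 \<Longrightarrow> 0 \<le> cube_drop_u n f00 f10 f01 f11"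
  unfolding cube_drop_u_def by (simp add: cube_form_mono)

lemma cube_form_mono_v: "unit_fn V f \<Longrightarrow> unit_fn V h \<Longrightarrow> j \<le> j' \<Longrightarrow> cube_form i j' k f f h h \<le> cube_form i j k f f h h"
  using cube_form_mono[of f f h h j j' i k] cube_form_swap_uv[of f h i j k] cube_form_swap_uv[of f h i j' k] by simp

lemma cube_form_mono_w: "unit_fn V f \<Longrightarrow> unit_fn V h \<Longrightarrow> k \<le> k' \<Longrightarrow> cube_form i j k' f h f h \<le> cube_form i j k f h f h"
  using cube_form_mono_v[of f h k k' i j] cube_form_swap_vw[of f h f h] by simp

lemma cube_drop_v_nonneg: "unit_fn V f \<Longrightarrow> unit_fn V h \<Longrightarrow> 0 \<le> cube_drop_v n f f h h"
  unfolding cube_drop_v_def by (intro add_nonneg_nonneg) (simp_all add: cube_form_mono_v)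

lemma cube_drop_w_nonneg: "unit_fn V f \<Longrightarrow> unit_fn V h \<Longrightarrow> 0 \<le> cube_drop_w n f h f h"
  unfolding cube_drop_w_def by (intro add_nonneg_nonneg) (simp_all add: cube_form_mono_w)

lemma cube_drop_v_cs:
  assumes c: "unit_fn V f00" "unit_fn V f10" "unit_fn V f01" "unit_fn V f11"
  shows "- cube_drop_v n f00 f10 f01 f11 \<le> (cube_drop_v n f00 f00 f01 f01 + cube_drop_v n f10 f10 f11 f11) / 2"
  using cube_form_cs_v[OF c, of "2*n" "2*n+1" "2*n" "2*n"] cube_form_cs_v[OF c, of "2*n+1" "2*n+2" "2*n+2" "2*n+1"]
  unfolding cube_drop_v_def abs_le_iff by (simp add: field_simps)

lemma cube_drop_w_cs:
  assumes c: "unit_fn V f00" "unit_fn V f10" "unit_fn V f01" "unit_fn V f11"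
  shows "- cube_drop_w n f00 f10 f01 f11 \<le> (cube_drop_w n f00 f10 f00 f10 + cube_drop_w n f01 f11 f01 f11) / 2"
  using cube_form_cs_w[OF c, of "2*n" "2*n+1" "2*n" "2*n+1"] cube_form_cs_w[OF c, of "2*n+1" "2*n+2" "2*n+2" "2*n+2"]
  unfolding cube_drop_w_def abs_le_iff by (simp add: field_simps)

text \<open>For a single function all three sums are nonnegative, so each is at most their
  total.\<close>

lemma sum_cube_drop_v_le1: assumes "unit_fn V f" shows "(\<Sum>n<J. cube_drop_v n f f f f) \<le> V" "(\<Sum>n<J. cube_drop_w n f f f f) \<le> V"
proof -
  note c = assms assms assms assms
  have "0 \<le> (\<Sum>n<J. cube_drop_u n f f f f)" "0 \<le> (\<Sum>n<J. cube_drop_v n f f f f)" "0 \<le> (\<Sum>n<J. cube_drop_w n f f f f)"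
    by (intro sum_nonneg cube_drop_u_nonneg cube_drop_v_nonneg cube_drop_w_nonneg assms)+
  with telescope_le[OF c, of J] show "(\<Sum>n<J. cube_drop_v n f f f f) \<le> V" "(\<Sum>n<J. cube_drop_w n f f f f) \<le> V" by linarith+
qed

text \<open>The drops in \<open>u\<close> are nonnegative and the total is at most \<open>V\<close>.
  The loss in the \<open>w\<close> direction is at most half the sum of two quantities bounded by
  \<open>V\<close> in \<open>sum_cube_drop_v_le1\<close>, whence \<open>2 * V\<close>.\<close>

lemma sum_cube_drop_v_le2: assumes "unit_fn V f" "unit_fn V h" shows "(\<Sum>n<J. cube_drop_v n f f h h) \<le> 2 * V"
proof -
  have "0 \<le> (\<Sum>n<J. cube_drop_u n f f h h)" by (intro sum_nonneg cube_drop_u_nonneg assms)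
  moreover have "(\<Sum>n<J. - cube_drop_w n f f h h) \<le> (\<Sum>n<J. (cube_drop_w n f f f f + cube_drop_w n h h h h) / 2)"
    by (intro sum_mono cube_drop_w_cs assms)
  then have "- (\<Sum>n<J. cube_drop_w n f f h h) \<le> ((\<Sum>n<J. cube_drop_w n f f f f) + (\<Sum>n<J. cube_drop_w n h h h h)) / 2"
    by (simp add: sum_negf sum.distrib sum_divide_distrib[symmetric])
  ultimately show ?thesis
    using telescope_le[of f f h h J] sum_cube_drop_v_le1(2)[of f J] sum_cube_drop_v_le1(2)[of h J] assms by simp
qed

lemma sum_cube_drop_w_le2: assumes "unit_fn V f" "unit_fn V h" shows "(\<Sum>n<J. cube_drop_w n f h f h) \<le> 2 * V"
proof -
  have "0 \<le> (\<Sum>n<J. cube_drop_u n f h f h)" by (intro sum_nonneg cube_drop_u_nonneg assms)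
  moreover have "(\<Sum>n<J. - cube_drop_v n f h f h) \<le> (\<Sum>n<J. (cube_drop_v n f f f f + cube_drop_v n h h h h) / 2)"
    by (intro sum_mono cube_drop_v_cs assms)
  then have "- (\<Sum>n<J. cube_drop_v n f h f h) \<le> ((\<Sum>n<J. cube_drop_v n f f f f) + (\<Sum>n<J. cube_drop_v n h h h h)) / 2"
    by (simp add: sum_negf sum.distrib sum_divide_distrib[symmetric])
  ultimately show ?thesis
    using telescope_le[of f h f h J] sum_cube_drop_v_le1(1)[of f J] sum_cube_drop_v_le1(1)[of h J] assms by simp
qed

text \<open>The same argument once more, with majorants that now contain two functions: the total
  contributes \<open>V\<close> and each of the two other directions at most
  \<open>2 * V\<close>.\<close>

lemma sum_cube_drop_u_le:
  assumes c: "unit_fn V f00" "unit_fn V f10" "unit_fn V f01" "unit_fn V f11"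
  shows "(\<Sum>n<J. cube_drop_u n f00 f10 f01 f11) \<le> 5 * V"
proof -
  have "(\<Sum>n<J. - cube_drop_v n f00 f10 f01 f11) \<le> (\<Sum>n<J. (cube_drop_v n f00 f00 f01 f01 + cube_drop_v n f10 f10 f11 f11) / 2)"
    by (intro sum_mono cube_drop_v_cs c)
  then have "- (\<Sum>n<J. cube_drop_v n f00 f10 f01 f11) \<le> ((\<Sum>n<J. cube_drop_v n f00 f00 f01 f01) + (\<Sum>n<J. cube_drop_v n f10 f10 f11 f11)) / 2"
    by (simp add: sum_negf sum.distrib sum_divide_distrib[symmetric])
  with sum_cube_drop_v_le2[OF c(1,3), of J] sum_cube_drop_v_le2[OF c(2,4), of J] have 1: "- (\<Sum>n<J. cube_drop_v n f00 f10 f01 f11) \<le> 2 * V" by simp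
  have "(\<Sum>n<J. - cube_drop_w n f00 f10 f01 f11) \<le> (\<Sum>n<J. (cube_drop_w n f00 f10 f00 f10 + cube_drop_w n f01 f11 f01 f11) / 2)"
    by (intro sum_mono cube_drop_w_cs c)
  then have "- (\<Sum>n<J. cube_drop_w n f00 f10 f01 f11) \<le> ((\<Sum>n<J. cube_drop_w n f00 f10 f00 f10) + (\<Sum>n<J. cube_drop_w n f01 f11 f01 f11)) / 2"
    by (simp add: sum_negf sum.distrib sum_divide_distrib[symmetric])
  with sum_cube_drop_w_le2[OF c(1,2), of J] sum_cube_drop_w_le2[OF c(3,4), of J] have 2: "- (\<Sum>n<J. cube_drop_w n f00 f10 f01 f11) \<le> 2 * V" by simp
  from 1 2 telescope_le[OF c, of J] show ?thesis by linarith
qed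

end

section \<open>Uniform measures on squares and separated scales\<close>

definition sq :: "real \<Rightarrow> plane set" where "sq r = {u. \<forall>i. \<bar>u $ i\<bar> \<le> r}"

definition usq :: "real \<Rightarrow> plane measure" where "usq r = uniform_measure lborel (sq r)"

definition supp_in :: "plane measure \<Rightarrow> real \<Rightarrow> bool" where
  "supp_in \<mu> \<rho> \<longleftrightarrow> (AE u in \<mu>. u \<in> sq \<rho>)"

lemma sq_cbox: "sq r = cbox (\<chi> i. - r) (\<chi> i. r)"
  by (auto simp: sq_def mem_box_cart abs_le_iff minus_le_iff)

lemma sq_borel [measurable, simp]: "sq r \<in> sets borel" by (simp add: sq_cbox)

lemma sq_add: "u \<in> sq r \<Longrightarrow> v \<in> sq s \<Longrightarrow> u + v \<in> sq (r + s)"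
  by (auto simp: sq_def intro!: order_trans[OF abs_triangle_ineq] add_mono)

lemma sq_uminus: "- u \<in> sq r \<longleftrightarrow> u \<in> sq r" by (auto simp: sq_def)

lemma sq_mono: "r \<le> s \<Longrightarrow> u \<in> sq r \<Longrightarrow> u \<in> sq s" by (auto simp: sq_def intro: order_trans)

lemma measure_sq: assumes "0 \<le> r" shows "measure lborel (sq r) = 4 * r\<^sup>2" "emeasure lborel (sq r) = ennreal (4 * r\<^sup>2)"
proof -
  have "0 \<in> sq r" using assms by (simp add: sq_def)
  then have "cbox (\<chi> i. - r) (\<chi> i. r) \<noteq> ({} :: plane set)" unfolding sq_cbox by blast
  from content_cbox_cart[OF this] show 1: "measure lborel (sq r) = 4 * r\<^sup>2"
    unfolding sq_cbox by (simp add: power2_eq_square prod_constant)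
  have "emeasure lborel (sq r) < \<infinity>" unfolding sq_cbox by (rule emeasure_lborel_cbox_finite)
  then show "emeasure lborel (sq r) = ennreal (4 * r\<^sup>2)" by (simp add: emeasure_eq_ennreal_measure 1)
qed

lemma integral_sq: "0 \<le> r \<Longrightarrow> (LBINT w. indicat_real (sq r) w) = 4 * r\<^sup>2" "integrable lborel (indicat_real (sq r))"
proof -
  show "0 \<le> r \<Longrightarrow> (LBINT w. indicat_real (sq r) w) = 4 * r\<^sup>2" using measure_sq(1)[of r] by simp
  show "integrable lborel (indicat_real (sq r))" unfolding sq_cbox
    by (rule integrable_real_indicator[OF _ emeasure_lborel_cbox_finite]) simp
qed

lemma bprob_usq: assumes "0 < r" shows "bprob (usq r)"
proof -
  have "emeasure lborel (sq r) \<noteq> 0" "emeasure lborel (sq r) \<noteq> \<infinity>" using measure_sq(2)[of r] assms by auto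
  then show ?thesis unfolding usq_def bprob_def by (auto intro: prob_space_uniform_measure)
qed

lemma integral_usq:
  fixes f :: "plane \<Rightarrow> real"
  assumes "0 < r" and [measurable]: "f \<in> borel_measurable borel"
  shows "(\<integral>u. f u \<partial>usq r) = (LBINT u. indicator (sq r) u * f u) / (4 * r\<^sup>2)"
proof -
  have "usq r = density lborel (\<lambda>u. ennreal (indicator (sq r) u / (4 * r\<^sup>2)))"
    unfolding usq_def uniform_measure_def measure_sq(2)[OF less_imp_le[OF assms(1)]]
    by (intro arg_cong[where f="density lborel"] ext) (use assms(1) in \<open>auto simp: indicator_def divide_ennreal[symmetric]\<close>)
  then show ?thesis using assms(1) by (simp add: integral_density)
qed

lemma symm_measure_usq: assumes "0 < r" shows "symm_measure (usq r)"
  unfolding symm_measure_def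
proof (intro allI impI)
  fix f :: "plane \<Rightarrow> real" and C assume [measurable]: "f \<in> borel_measurable borel" and "\<forall>x. \<bar>f x\<bar> \<le> C"
  have "(LBINT u. indicator (sq r) u * f (- u)) = (\<integral>u. indicator (sq r) u * f u \<partial>distr lborel borel uminus)"
    by (subst integral_distr) (auto simp: indicator_def sq_uminus)
  also have "distr lborel borel uminus = (lborel :: plane measure)"
    using lborel_affine[of "-1" "0 :: plane"] by (simp add: density_1)
  finally show "(\<integral>u. f (- u) \<partial>usq r) = (\<integral>u. f u \<partial>usq r)" using assms by (simp add: integral_usq)
qed

lemma supp_in_usq: assumes "0 < r" shows "supp_in (usq r) r"
  unfolding supp_in_def usq_def
  by (rule AE_uniform_measureI) auto

lemma supp_in_mono: "supp_in \<mu> r \<Longrightarrow> r \<le> s \<Longrightarrow> supp_in \<mu> s"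
  unfolding supp_in_def by (auto elim: eventually_mono intro: sq_mono)

lemma supp_in_conv: assumes "bprob \<mu>" "bprob \<nu>" "supp_in \<mu> r" "supp_in \<nu> s" shows "supp_in (\<mu> \<star> \<nu>) (r + s)"
proof -
  note [measurable_cong] = bprobD(2)[OF assms(1)] bprobD(2)[OF assms(2)]
  interpret M: prob_space \<mu> using bprobD[OF assms(1)] by simp
  interpret N: prob_space \<nu> using bprobD[OF assms(2)] by simp
  interpret pair_prob_space \<mu> \<nu> ..
  have "AE x in \<mu>. AE y in \<nu>. x + y \<in> sq (r + s)"
    using assms(3,4) unfolding supp_in_def by (auto elim!: eventually_mono intro: sq_add)
  then have "AE z in \<mu> \<Otimes>\<^sub>M \<nu>. (case z of (x, y) \<Rightarrow> x + y) \<in> sq (r + s)"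
    by (intro AE_pair_measure) (auto simp: case_prod_beta')
  then show ?thesis unfolding supp_in_def convolution_def
    by (subst AE_distr_iff) (auto simp: case_prod_beta')
qed

text \<open>The square of half-side \<open>r\<close> and its shift by \<open>u\<close> both contain
  \<open>sq (r - \<rho>)\<close>, so the two averages differ by an integral over a set of relative
  area at most \<open>4 * \<rho> / r\<close>. For \<open>\<rho> > r\<close> the claim is weaker than
  the trivial bound 2.\<close>

lemma avg_usq_slow:
  assumes "0 < r" "u \<in> sq \<rho>" and [measurable]: "f \<in> borel_measurable borel" and f: "\<And>x. \<bar>f x\<bar> \<le> 1"
  shows "\<bar>avg (usq r) f (y + u) - avg (usq r) f y\<bar> \<le> 4 * \<rho> / r"
proof -
  have \<rho>: "0 \<le> \<rho>" using assms(2) unfolding sq_def by (auto intro: order_trans[OF abs_ge_zero])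
  show ?thesis
  proof (cases "\<rho> \<le> r")
    case False
    have "\<bar>avg (usq r) f z\<bar> \<le> 1" for z by (rule avg_bound[OF bprob_usq[OF assms(1)] assms(3) f])
    from this[of "y + u"] this[of y] have "\<bar>avg (usq r) f (y + u) - avg (usq r) f y\<bar> \<le> 2" by linarith
    also have "2 \<le> 4 * \<rho> / r" using False assms(1) by (simp add: field_simps)
    finally show ?thesis .
  next
    case True
    let ?I = "\<lambda>s. indicat_real (sq s)"
    have i: "integrable lborel (\<lambda>w. ?I r w * f (y + w))" for y
      by (rule Bochner_Integration.integrable_bound[OF integral_sq(2)[of r]]) (use f in \<open>auto simp: indicator_def\<close>)
    have i2: "integrable lborel (\<lambda>w. ?I r (w - u))"
      using lborel_shift(2)[of "?I r" "- u"] integral_sq(2) by simp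
    have i3: "integrable lborel (\<lambda>w. ?I r (w - u) * f (y + w))"
      by (rule Bochner_Integration.integrable_bound[OF i2]) (use f in \<open>auto simp: indicator_def\<close>)
    have "(LBINT w. ?I r w * f (y + u + w)) = (LBINT w. (\<lambda>w. ?I r (w - u) * f (y + w)) (w + u))"
      by (simp add: ac_simps)
    also have "\<dots> = (LBINT w. ?I r (w - u) * f (y + w))"
      by (rule lborel_shift(1)) measurable
    finally have "avg (usq r) f (y + u) - avg (usq r) f y = (LBINT w. ?I r (w - u) * f (y + w) - ?I r w * f (y + w)) / (4 * r\<^sup>2)"
      unfolding avg_def using assms(1) i i3 by (simp add: integral_usq diff_divide_distrib)
    also have "\<bar>\<dots>\<bar> \<le> (LBINT w. ?I r (w - u) + ?I r w - 2 * ?I (r - \<rho>) w) / (4 * r\<^sup>2)"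
    proof -
      have "\<bar>LBINT w. ?I r (w - u) * f (y + w) - ?I r w * f (y + w)\<bar> \<le> (LBINT w. \<bar>?I r (w - u) * f (y + w) - ?I r w * f (y + w)\<bar>)"
        by (rule integral_abs_bound)
      also have "\<dots> \<le> (LBINT w. ?I r (w - u) + ?I r w - 2 * ?I (r - \<rho>) w)"
      proof (rule integral_mono)
        fix w
        have "w - u \<in> sq r \<and> w \<in> sq r" if "w \<in> sq (r - \<rho>)"
          using sq_add[OF that, of "- u" \<rho>] assms(2) sq_mono[OF _ that, of r] \<rho> by (simp add: sq_uminus)
        then show "\<bar>?I r (w - u) * f (y + w) - ?I r w * f (y + w)\<bar> \<le> ?I r (w - u) + ?I r w - 2 * ?I (r - \<rho>) w"
          using f[of "y + w"] by (auto simp: indicator_def)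
      qed (use i i3 i2 integral_sq(2) in auto)
      finally show ?thesis using assms(1) by (simp add: divide_right_mono abs_divide)
    qed
    also have "(LBINT w. ?I r (w - u) + ?I r w - 2 * ?I (r - \<rho>) w) = 8 * r\<^sup>2 - 8 * (r - \<rho>)\<^sup>2"
      using i2 integral_sq(2) lborel_shift(1)[of "?I r" "- u"] True assms(1) measure_sq(1)[of r] measure_sq(1)[of "r - \<rho>"] by simp
    also have "(8 * r\<^sup>2 - 8 * (r - \<rho>)\<^sup>2) / (4 * r\<^sup>2) \<le> 4 * \<rho> / r"
      using assms(1) \<rho> by (simp add: field_simps power2_eq_square)
    finally show ?thesis .
  qed
qed

lemma avg_avg_close:
  assumes "bprob \<mu>" "supp_in \<mu> \<rho>" "h \<in> borel_measurable borel" "\<And>x. \<bar>h x\<bar> \<le> C"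
    "\<And>y u. u \<in> sq \<rho> \<Longrightarrow> \<bar>h (y + u) - h y\<bar> \<le> \<kappa>"
  shows "\<bar>avg \<mu> h y - h y\<bar> \<le> \<kappa>"
proof -
  interpret prob_space \<mu> using bprobD[OF assms(1)] by simp
  note [measurable] = assms(3)
  have i: "integrable \<mu> (\<lambda>u. h (y + u))" by (rule bprob_integrable[OF assms(1) _ assms(4)]) measurable
  have "avg \<mu> h y - h y = (\<integral>u. h (y + u) - h y \<partial>\<mu>)"
    unfolding avg_def using i bprob_const[OF assms(1), of "h y"] by simp
  also have "\<bar>\<dots>\<bar> \<le> (\<integral>u. \<bar>h (y + u) - h y\<bar> \<partial>\<mu>)" by (rule integral_abs_bound)
  also have "\<dots> \<le> (\<integral>u. \<kappa> \<partial>\<mu>)"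
    by (rule integral_mono_AE) (use i assms(2,5) in \<open>auto simp: supp_in_def elim!: eventually_mono\<close>)
  finally show ?thesis unfolding bprob_const[OF assms(1)] .
qed

lemma avg_avg_usq_close:
  assumes "bprob \<mu>" "supp_in \<mu> \<rho>" "0 < r" "f \<in> borel_measurable borel" "\<And>x. \<bar>f x\<bar> \<le> 1"
  shows "\<bar>avg \<mu> (avg (usq r) f) y - avg (usq r) f y\<bar> \<le> 4 * \<rho> / r"
  by (rule avg_avg_close[OF assms(1,2) avg_measurable[OF bprob_usq[OF assms(3)] assms(4)] avg_bound[OF bprob_usq[OF assms(3)] assms(4,5)]])
    (rule avg_usq_slow[OF assms(3) _ assms(4,5)])

lemma unit_fn_avg: assumes "bprob \<mu>" "unit_fn V f" shows "unit_fn V (avg \<mu> f)"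
  unfolding unit_fn_def
  using nice_fnD[OF nice_fn_avg[OF assms(1) unit_fnD(7)[OF assms(2)]]] avg_le[OF assms(1) unit_fnD(1,2,3)[OF assms(2)]]
    avg_integral(1)[OF assms(1) unit_fnD(7)[OF assms(2)]] unit_fnD(6)[OF assms(2)] by auto

text \<open>One factor \<open>\<bar>f x - g x\<bar>\<close> is bounded by \<open>\<kappa>\<close>,
  the other by \<open>f x + g x\<close>, whose integral is at most \<open>2 * V\<close>. This turns
  pointwise closeness into an L2 bound although the domain has infinite area.\<close>

lemma sq_diff_le:
  assumes "unit_fn V f" "unit_fn V g" "\<And>x. \<bar>f x - g x\<bar> \<le> \<kappa>"
  shows "(LBINT x. (f x - g x)\<^sup>2) \<le> 2 * \<kappa> * V"
proof -
  note i = unit_fnD(5)[OF assms(1)] unit_fnD(5)[OF assms(2)]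
  have k: "0 \<le> \<kappa>" by (rule order_trans[OF abs_ge_zero assms(3)])
  have "(LBINT x. (f x - g x)\<^sup>2) \<le> (LBINT x. \<kappa> * (f x + g x))"
  proof (rule integral_mono)
    fix x
    have "(f x - g x)\<^sup>2 = \<bar>f x - g x\<bar> * \<bar>f x - g x\<bar>" by (simp add: power2_eq_square)
    also have "\<dots> \<le> \<kappa> * (f x + g x)"
      using unit_fnD(2)[OF assms(1), of x] unit_fnD(2)[OF assms(2), of x] k by (intro mult_mono assms(3)) auto
    finally show "(f x - g x)\<^sup>2 \<le> \<kappa> * (f x + g x)" .
  qed (use i nice_fnD(2)[OF nice_fn_sq[OF nice_fn_diff[OF unit_fnD(7)[OF assms(1)] unit_fnD(7)[OF assms(2)]]]] in auto)
  also have "\<dots> = \<kappa> * ((LBINT x. f x) + (LBINT x. g x))" using i by simp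
  also have "\<dots> \<le> \<kappa> * (V + V)" using k unit_fnD(6)[OF assms(1)] unit_fnD(6)[OF assms(2)] by (intro mult_left_mono) auto
  finally show ?thesis by simp
qed

lemma sq_sum3_le: assumes "nice_fn f" "nice_fn g" "nice_fn h" 
  shows "(LBINT x. (f x + g x + h x)\<^sup>2) \<le> 3 * (LBINT x. (f x)\<^sup>2) + 3 * (LBINT x. (g x)\<^sup>2) + 3 * (LBINT x. (h x)\<^sup>2)"
proof -
  have "(LBINT x. (f x + g x + h x)\<^sup>2) \<le> (LBINT x. 3 * (f x)\<^sup>2 + 3 * (g x)\<^sup>2 + 3 * (h x)\<^sup>2)"
  proof (rule integral_mono)
    fix x
    have "0 \<le> (f x - g x)\<^sup>2 + (f x - h x)\<^sup>2 + (g x - h x)\<^sup>2" by simp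
    then show "(f x + g x + h x)\<^sup>2 \<le> 3 * (f x)\<^sup>2 + 3 * (g x)\<^sup>2 + 3 * (h x)\<^sup>2"
      by (simp add: power2_eq_square algebra_simps)
  qed (use assms nice_fnD(2)[OF nice_fn_sq] nice_fn_add in auto)
  also have "\<dots> = 3 * (LBINT x. (f x)\<^sup>2) + 3 * (LBINT x. (g x)\<^sup>2) + 3 * (LBINT x. (h x)\<^sup>2)"
    using assms nice_fnD(2)[OF nice_fn_sq] by simp
  finally show ?thesis .
qed

lemma sq_sum2_le: assumes "nice_fn f" "nice_fn g"
  shows "(LBINT x. (f x + g x)\<^sup>2) \<le> 2 * (LBINT x. (f x)\<^sup>2) + 2 * (LBINT x. (g x)\<^sup>2)"
proof -
  have "(LBINT x. (f x + g x)\<^sup>2) \<le> (LBINT x. 2 * (f x)\<^sup>2 + 2 * (g x)\<^sup>2)"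
  proof (rule integral_mono)
    fix x
    have "0 \<le> (f x - g x)\<^sup>2" by simp
    then show "(f x + g x)\<^sup>2 \<le> 2 * (f x)\<^sup>2 + 2 * (g x)\<^sup>2" by (simp add: power2_eq_square algebra_simps)
  qed (use assms nice_fnD(2)[OF nice_fn_sq] nice_fn_add in auto)
  also have "\<dots> = 2 * (LBINT x. (f x)\<^sup>2) + 2 * (LBINT x. (g x)\<^sup>2)"
    using assms nice_fnD(2)[OF nice_fn_sq] by simp
  finally show ?thesis .
qed

lemma avg_diff:
  assumes "bprob \<mu>" "nice_fn f" "nice_fn g"
  shows "avg \<mu> (\<lambda>x. f x - g x) y = avg \<mu> f y - avg \<mu> g y"
  using avg_add[OF assms, of "-1" y] by simp

text \<open>Here \<open>m\<close> is meant to live at a much finer scale than \<open>\<mu>\<close>,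
  and \<open>p\<close> at a much coarser one: averaging by \<open>m\<close> beforehand is invisible
  to \<open>\<mu>\<close>, and averages by \<open>p\<close> are almost unchanged by
  \<open>\<mu>\<close>.\<close>

definition separated :: "real \<Rightarrow> plane measure \<Rightarrow> plane measure \<Rightarrow> plane measure \<Rightarrow> bool" where
  "separated \<kappa> m \<mu> p \<longleftrightarrow> (\<forall>f y. f \<in> borel_measurable borel \<longrightarrow> (\<forall>x. \<bar>f x\<bar> \<le> 1) \<longrightarrow>
     \<bar>avg \<mu> (avg m f) y - avg \<mu> f y\<bar> \<le> \<kappa> \<and> \<bar>avg \<mu> (avg p f) y - avg p f y\<bar> \<le> \<kappa>)"

context chain
begin

text \<open>With \<open>R\<close> the convolution by \<open>b k\<close> and \<open>b (Suc k)\<close> and \<open>h\<close> the average of \<open>f\<close> along the chain up to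
  \<open>k\<close>, this is \<open>R\<^sup>2 h\<close>; the square gives \<open>\<parallel>h - R\<^sup>2 h\<parallel>\<^sup>2 \<le> \<parallel>h\<parallel>\<^sup>2 - \<parallel>R h\<parallel>\<^sup>2\<close>.\<close>
definition smoothing :: "nat \<Rightarrow> (plane \<Rightarrow> real) \<Rightarrow> plane \<Rightarrow> real" where
  "smoothing k f = avg (b (Suc k)) (avg (b k) (avg (b (Suc k)) (avg (b k) (avg (pconv b k) f))))"

text \<open>The drop covers the two factors \<open>b k\<close> and \<open>b (Suc k)\<close>. For the
  configurations \<open>b k\<close> is of the scale under study up to a constant, and
  \<open>b (Suc k)\<close> is the much coarser one.\<close>

definition edrop :: "nat \<Rightarrow> (plane \<Rightarrow> real) \<Rightarrow> real" where
  "edrop k f = (LBINT y. (avg (pconv b k) f y)\<^sup>2) - (LBINT y. (avg (pconv b (Suc (Suc k))) f y)\<^sup>2)"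

lemma edrop_nonneg: "nice_fn f \<Longrightarrow> 0 \<le> edrop k f"
  unfolding edrop_def using energy_mono[OF bprob_b, of f k "Suc (Suc k)"] by simp

lemma unit_fn_smoothing: "unit_fn V f \<Longrightarrow> unit_fn V (smoothing k f)"
  unfolding smoothing_def by (intro unit_fn_avg bprob_b bprob_pconv)

text \<open>The difference splits into \<open>avg \<mu> G - avg \<mu> h\<close>,
  \<open>avg \<mu> (h - X)\<close> and \<open>avg \<mu> X - X\<close>. The first and the last are
  small by separation, as the outermost factor of \<open>X\<close> is \<open>b (Suc k)\<close>; the
  middle one by contraction and the bound on \<open>h - X\<close>. The constant 12 is
  \<open>3 * (2 + 2)\<close>.\<close>

lemma approx_smoothing:
  assumes "bprob \<mu>" "separated \<kappa> (pconv b k) \<mu> (b (Suc k))" "unit_fn V G"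
  shows "(LBINT y. (avg \<mu> G y - smoothing k G y)\<^sup>2) \<le> 12 * \<kappa> * V + 3 * edrop k G"
proof -
  let ?b0 = "avg (b k)" and ?b1 = "avg (b (Suc k))"
  define h where "h = avg (pconv b k) G"
  define Rh where "Rh = ?b1 (?b0 h)"
  define X where "X = ?b1 (?b0 Rh)"
  have c: "unit_fn V h" "unit_fn V Rh" "unit_fn V X" "unit_fn V (?b0 h)" "unit_fn V (?b0 Rh)" "unit_fn V (?b1 h)"
    unfolding h_def Rh_def X_def by (intro unit_fn_avg bprob_b bprob_pconv assms)+
  note n = c[THEN unit_fnD(7)] unit_fnD(7)[OF assms(3)]
  have X: "smoothing k G = X" by (simp add: smoothing_def X_def Rh_def h_def)
  have Rh: "Rh = avg (pconv b (Suc (Suc k))) G"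
    unfolding avg_pconv_Suc[OF bprob_b unit_fnD(7)[OF assms(3)]] Rh_def h_def ..
  have cm: "?b0 (?b1 h) = Rh" unfolding Rh_def by (rule avg_commute[OF bprob_b bprob_b unit_fnD(1)[OF c(1)] unit_fnD(4)[OF c(1)]])
  \<comment> \<open>One of the two smoothing steps is moved to the left factor: both averages are
    self-adjoint and they commute, so the inner product of \<open>h\<close> and \<open>X\<close> is
    the square norm of \<open>Rh\<close>.\<close>
  have "(LBINT y. h y * X y) = (LBINT y. ?b1 h y * ?b0 Rh y)"
    unfolding X_def by (rule avg_adjoint[OF bprob_b symm_b n(1) n(5)])
  also have "\<dots> = (LBINT y. Rh y * Rh y)"
    unfolding avg_adjoint[OF bprob_b symm_b n(6) n(2)] cm ..
  finally have hX: "(LBINT y. h y * X y) = (LBINT y. (Rh y)\<^sup>2)" by (simp add: power2_eq_square)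
  have XR: "(LBINT y. (X y)\<^sup>2) \<le> (LBINT y. (Rh y)\<^sup>2)"
    unfolding X_def using avg_sq_le[OF bprob_b n(2), of k] avg_sq_le[OF bprob_b n(5), of "Suc k"] by linarith
  have "(LBINT y. (h y - X y)\<^sup>2) = (LBINT y. (h y)\<^sup>2 - 2 * (h y * X y) + (X y)\<^sup>2)"
    by (simp add: power2_diff algebra_simps)
  also have "\<dots> = (LBINT y. (h y)\<^sup>2) - 2 * (LBINT y. h y * X y) + (LBINT y. (X y)\<^sup>2)"
    using nice_fnD(2)[OF nice_fn_sq[OF n(1)]] nice_fnD(2)[OF nice_fn_sq[OF n(3)]] nice_fnD(2)[OF nice_fn_mult[OF n(1,3)]] by simp
  also have "\<dots> \<le> edrop k G" using hX XR by (simp add: edrop_def h_def Rh)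
  finally have main: "(LBINT y. (h y - X y)\<^sup>2) \<le> edrop k G" .
  have 1: "(LBINT y. (avg \<mu> G y - avg \<mu> h y)\<^sup>2) \<le> 2 * \<kappa> * V"
    by (rule sq_diff_le[OF unit_fn_avg[OF assms(1,3)] unit_fn_avg[OF assms(1) c(1)]], unfold h_def, subst abs_minus_commute)
      (use assms(2) unit_fnD(1,4)[OF assms(3)] in \<open>simp add: separated_def\<close>)
  have "X = ?b1 (?b0 Rh)" by (simp add: X_def)
  then have 2: "(LBINT y. (avg \<mu> X y - X y)\<^sup>2) \<le> 2 * \<kappa> * V"
    by (intro sq_diff_le[OF unit_fn_avg[OF assms(1) c(3)] c(3)])
      (use assms(2) unit_fnD(1,4)[OF c(5)] in \<open>simp add: separated_def\<close>)
  have 3: "(LBINT y. (avg \<mu> (\<lambda>y. h y - X y) y)\<^sup>2) \<le> edrop k G"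
    by (rule order_trans[OF avg_sq_le[OF assms(1) nice_fn_diff[OF n(1,3)]] main])
  have "(LBINT y. (avg \<mu> G y - smoothing k G y)\<^sup>2)
    = (LBINT y. ((avg \<mu> G y - avg \<mu> h y) + avg \<mu> (\<lambda>y. h y - X y) y + (avg \<mu> X y - X y))\<^sup>2)"
    unfolding X by (simp add: avg_diff[OF assms(1) n(1,3)])
  also have "\<dots> \<le> 3 * (2 * \<kappa> * V) + 3 * edrop k G + 3 * (2 * \<kappa> * V)"
  proof (rule order_trans[OF sq_sum3_le])
    show "3 * (LBINT y. (avg \<mu> G y - avg \<mu> h y)\<^sup>2) + 3 * (LBINT y. (avg \<mu> (\<lambda>y. h y - X y) y)\<^sup>2)
      + 3 * (LBINT y. (avg \<mu> X y - X y)\<^sup>2) \<le> 3 * (2 * \<kappa> * V) + 3 * edrop k G + 3 * (2 * \<kappa> * V)"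
      using 1 2 3 by linarith
  qed (use nice_fn_diff nice_fn_avg[OF assms(1)] n in auto)
  finally show ?thesis by (simp add: algebra_simps)
qed

text \<open>Both averages are close to \<open>smoothing k G\<close>, which involves neither measure.
  The constants are \<open>2 * (12 + 12)\<close> and \<open>2 * (3 + 3)\<close>.\<close>

lemma separated_pair:
  assumes "bprob \<mu>" "separated \<kappa> (pconv b k) \<mu> (b (Suc k))" "bprob \<mu>'" "separated \<kappa> (pconv b k) \<mu>' (b (Suc k))" "unit_fn V G"
  shows "(LBINT y. (avg \<mu> G y - avg \<mu>' G y)\<^sup>2) \<le> 48 * \<kappa> * V + 12 * edrop k G"
proof -
  have n: "nice_fn (\<lambda>y. avg \<mu> G y - smoothing k G y)" "nice_fn (\<lambda>y. smoothing k G y - avg \<mu>' G y)"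
    by (auto intro!: nice_fn_diff unit_fnD(7)[OF unit_fn_smoothing] unit_fnD(7)[OF unit_fn_avg] assms)
  have "(LBINT y. (avg \<mu> G y - avg \<mu>' G y)\<^sup>2) = (LBINT y. ((avg \<mu> G y - smoothing k G y) + (smoothing k G y - avg \<mu>' G y))\<^sup>2)" by simp
  also have "\<dots> \<le> 2 * (LBINT y. (avg \<mu> G y - smoothing k G y)\<^sup>2) + 2 * (LBINT y. (avg \<mu>' G y - smoothing k G y)\<^sup>2)"
    using sq_sum2_le[OF n] by (simp add: power2_commute)
  also have "\<dots> \<le> 48 * \<kappa> * V + 12 * edrop k G"
    using approx_smoothing[OF assms(1,2,5)] approx_smoothing[OF assms(3,4,5)] by simp
  finally show ?thesis .
qed

lemma edrop_eq_dconv: "nice_fn f \<Longrightarrow> edrop k f = (\<integral>u. corr f f u \<partial>dconv b k) - (\<integral>u. corr f f u \<partial>dconv b (Suc (Suc k)))"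
  unfolding edrop_def dconv_inner[OF bprob_b symm_b] by (simp add: power2_eq_square dconv_inner[OF bprob_b symm_b])

text \<open>Only even levels are summed since \<open>edrop\<close> spans two. The sum is at most the
  square norm of \<open>f\<close>, hence at most its integral because
  \<open>0 \<le> f \<le> 1\<close>.\<close>

lemma sum_edrop_le: assumes "unit_fn V f" shows "(\<Sum>n<J. edrop (2 * n) f) \<le> V"
proof -
  have "(\<Sum>n<J. edrop (2 * n) f) = (LBINT y. (avg (pconv b 0) f y)\<^sup>2) - (LBINT y. (avg (pconv b (2 * J)) f y)\<^sup>2)"
    by (induction J) (auto simp: edrop_def simp del: pconv.simps)
  also have "\<dots> \<le> (LBINT y. (f y)\<^sup>2)"
    using avg_sq_le[OF bprob_pconv[of b 0, OF bprob_b] unit_fnD(7)[OF assms]] 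
    by (smt (verit) Bochner_Integration.integral_nonneg zero_le_power2)
  also have "\<dots> \<le> (LBINT y. f y)"
    by (rule integral_mono[OF nice_fnD(2)[OF nice_fn_sq[OF unit_fnD(7)[OF assms]]] unit_fnD(5)[OF assms]])
      (use unit_fnD(2,3)[OF assms] in \<open>auto simp: power2_eq_square intro: mult_left_le\<close>)
  finally show ?thesis using unit_fnD(6)[OF assms] by linarith
qed

end

section \<open>The configuration form\<close>

text \<open>The inequality \<open>\<mu> \<le> c * \<nu>\<close> between measures, tested on bounded
  functions. It carries \<open>v1\<close>, \<open>v2\<close> from the measures of the configuration
  to \<open>dconv b (2*n+1)\<close>, for which the averaged drop is a part of a telescoping
  sum.\<close>

definition dominated :: "real \<Rightarrow> plane measure \<Rightarrow> plane measure \<Rightarrow> bool" where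
  "dominated c \<mu> \<nu> \<longleftrightarrow> (\<forall>f C. f \<in> borel_measurable borel \<longrightarrow> (\<forall>x. 0 \<le> f x \<and> f x \<le> C) \<longrightarrow> (\<integral>x. f x \<partial>\<mu>) \<le> c * (\<integral>x. (f x :: real) \<partial>\<nu>))"

lemma dominated_twice:
  fixes D :: "plane \<Rightarrow> plane \<Rightarrow> real"
  assumes p: "bprob \<mu>1" "bprob \<mu>2" "bprob \<nu>" and d: "dominated c \<mu>1 \<nu>" "dominated c \<mu>2 \<nu>" "0 \<le> c"
    and m: "case_prod D \<in> borel_measurable (borel \<Otimes>\<^sub>M borel)" and b: "\<And>v w. 0 \<le> D v w" "\<And>v w. D v w \<le> M"
  shows "(\<integral>v. \<integral>w. D v w \<partial>\<mu>2 \<partial>\<mu>1) \<le> c\<^sup>2 * (\<integral>v. \<integral>w. D v w \<partial>\<nu> \<partial>\<nu>)"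
proof -
  note [measurable] = m
  have m1: "(\<lambda>w. D v w) \<in> borel_measurable borel" for v
  proof -
    have "(\<lambda>w. case_prod D (v, w)) \<in> borel_measurable borel" by measurable
    then show ?thesis by simp
  qed
  have m2: "(\<lambda>v. \<integral>w. D v w \<partial>\<mu>) \<in> borel_measurable borel" if "bprob \<mu>" for \<mu> by (rule bprob_integral_measurable[OF that m])
  have b2: "0 \<le> (\<integral>w. D v w \<partial>\<mu>)" "(\<integral>w. D v w \<partial>\<mu>) \<le> M" if "bprob \<mu>" for \<mu> v by (rule bprob_integral_le[OF that m1 b])+
  have b2': "\<bar>\<integral>w. D v w \<partial>\<mu>\<bar> \<le> M" if "bprob \<mu>" for \<mu> v using b2[OF that] by simp
  have "(\<integral>v. \<integral>w. D v w \<partial>\<mu>2 \<partial>\<mu>1) \<le> (\<integral>v. c * (\<integral>w. D v w \<partial>\<nu>) \<partial>\<mu>1)"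
  proof (rule integral_mono)
    show "(\<integral>w. D v w \<partial>\<mu>2) \<le> c * (\<integral>w. D v w \<partial>\<nu>)" for v using d(2) m1[of v] b unfolding dominated_def by blast
  qed (auto intro!: bprob_integrable[OF p(1) m2[OF p(2)] b2'[OF p(2)]] bprob_integrable[OF p(1) m2[OF p(3)] b2'[OF p(3)]])
  also have "\<dots> = c * (\<integral>v. \<integral>w. D v w \<partial>\<nu> \<partial>\<mu>1)" by simp
  also have "(\<integral>v. \<integral>w. D v w \<partial>\<nu> \<partial>\<mu>1) \<le> c * (\<integral>v. \<integral>w. D v w \<partial>\<nu> \<partial>\<nu>)"
    using d(1) m2[OF p(3)] b2[OF p(3)] unfolding dominated_def by blast
  finally show ?thesis using d(3) by (simp add: power2_eq_square mult_left_mono mult.assoc)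
qed

lemma integral3_diff_bound:
  assumes p: "bprob \<mu>1" "bprob \<mu>2" "bprob \<mu>3" "bprob \<mu>3'" and t: "kernel3 C K"
    and D: "case_prod D \<in> borel_measurable (borel \<Otimes>\<^sub>M borel)" "\<And>v w. \<bar>D v w\<bar> \<le> M"
    and le: "\<And>u v. \<bar>(\<integral>w. K u v w \<partial>\<mu>3) - (\<integral>w. K u v w \<partial>\<mu>3')\<bar> \<le> D u v"
  shows "\<bar>integral3 \<mu>1 \<mu>2 \<mu>3 K - integral3 \<mu>1 \<mu>2 \<mu>3' K\<bar> \<le> (\<integral>u. \<integral>v. D u v \<partial>\<mu>2 \<partial>\<mu>1)"
proof -
  have i: "integrable \<mu>2 (\<lambda>v. \<integral>w. K u v w \<partial>\<mu>)" "integrable \<mu>1 (\<lambda>u. \<integral>v. \<integral>w. K u v w \<partial>\<mu> \<partial>\<mu>2)" if "bprob \<mu>" for \<mu> u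
    by (rule bprob_integrable[OF p(2) kernel3_inner2(3)[OF p(2) that t] kernel3_inner(2)[OF that t]]
        bprob_integrable[OF p(1) kernel3_inner2(1,2)[OF p(2) that t]])+
  have m1: "(\<lambda>w. D v w) \<in> borel_measurable borel" for v
  proof -
    note [measurable] = D(1)
    have "(\<lambda>w. case_prod D (v, w)) \<in> borel_measurable borel" by measurable
    then show ?thesis by simp
  qed
  have j: "integrable \<mu>2 (D u)" "integrable \<mu>1 (\<lambda>u. \<integral>v. D u v \<partial>\<mu>2)" for u
    by (rule bprob_integrable[OF p(2) m1 D(2)] bprob_integrable[OF p(1) bprob_integral_measurable[OF p(2) D(1)] bprob_integral_bound[OF p(2) m1 D(2)]])+
  have "integral3 \<mu>1 \<mu>2 \<mu>3 K - integral3 \<mu>1 \<mu>2 \<mu>3' K = (\<integral>u. \<integral>v. (\<integral>w. K u v w \<partial>\<mu>3) - (\<integral>w. K u v w \<partial>\<mu>3') \<partial>\<mu>2 \<partial>\<mu>1)"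
    unfolding integral3_def using i[OF p(3)] i[OF p(4)] by simp
  also have "\<bar>\<dots>\<bar> \<le> (\<integral>u. \<bar>\<integral>v. (\<integral>w. K u v w \<partial>\<mu>3) - (\<integral>w. K u v w \<partial>\<mu>3') \<partial>\<mu>2\<bar> \<partial>\<mu>1)"
    by (rule integral_abs_bound)
  also have "\<dots> \<le> (\<integral>u. \<integral>v. D u v \<partial>\<mu>2 \<partial>\<mu>1)"
  proof (rule integral_mono)
    show "integrable \<mu>1 (\<lambda>u. \<bar>\<integral>v. (\<integral>w. K u v w \<partial>\<mu>3) - (\<integral>w. K u v w \<partial>\<mu>3') \<partial>\<mu>2\<bar>)"
      using i[OF p(3)] i[OF p(4)] by (subst Bochner_Integration.integral_diff) auto
    fix u
    have "\<bar>\<integral>v. (\<integral>w. K u v w \<partial>\<mu>3) - (\<integral>w. K u v w \<partial>\<mu>3') \<partial>\<mu>2\<bar> \<le> (\<integral>v. \<bar>(\<integral>w. K u v w \<partial>\<mu>3) - (\<integral>w. K u v w \<partial>\<mu>3')\<bar> \<partial>\<mu>2)"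
      by (rule integral_abs_bound)
    also have "\<dots> \<le> (\<integral>v. D u v \<partial>\<mu>2)"
      by (rule integral_mono) (use i[OF p(3)] i[OF p(4)] j le in auto)
    finally show "\<bar>\<integral>v. (\<integral>w. K u v w \<partial>\<mu>3) - (\<integral>w. K u v w \<partial>\<mu>3') \<partial>\<mu>2\<bar> \<le> (\<integral>v. D u v \<partial>\<mu>2)" .
  qed (rule j)
  finally show ?thesis .
qed

lemma integral3_close_AE:
  assumes p: "bprob \<mu>1" "bprob \<mu>2" "bprob \<mu>3" and s: "supp_in \<mu>1 \<rho>" "supp_in \<mu>2 \<rho>" "supp_in \<mu>3 \<rho>" and t: "kernel3 C K" "kernel3 D L"
    and le: "\<And>u v w. u \<in> sq \<rho> \<Longrightarrow> v \<in> sq \<rho> \<Longrightarrow> w \<in> sq \<rho> \<Longrightarrow> \<bar>K u v w - L u v w\<bar> \<le> e"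
  shows "\<bar>integral3 \<mu>1 \<mu>2 \<mu>3 K - integral3 \<mu>1 \<mu>2 \<mu>3 L\<bar> \<le> e"
proof -
  have AEI: "\<bar>(\<integral>w. f w \<partial>\<mu>) - (\<integral>w. g w \<partial>\<mu>)\<bar> \<le> e" 
    if "bprob \<mu>" "supp_in \<mu> \<rho>" "integrable \<mu> f" "integrable \<mu> g" "\<And>w. w \<in> sq \<rho> \<Longrightarrow> \<bar>f w - g w\<bar> \<le> e" for \<mu> and f g :: "plane \<Rightarrow> real"
  proof -
    interpret prob_space \<mu> using bprobD[OF that(1)] by simp
    have "\<bar>(\<integral>w. f w - g w \<partial>\<mu>)\<bar> \<le> (\<integral>w. \<bar>f w - g w\<bar> \<partial>\<mu>)" by (rule integral_abs_bound)
    also have "\<dots> \<le> (\<integral>w. e \<partial>\<mu>)"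
      by (rule integral_mono_AE) (use that(2-) in \<open>auto simp: supp_in_def elim!: eventually_mono\<close>)
    finally show ?thesis using that(3,4) unfolding bprob_const[OF that(1)] by simp
  qed
  show ?thesis unfolding integral3_def
    by (intro AEI p s le bprob_integrable[OF p(3) kernel3_slice(1)[OF t(1)] kernel3D(2)[OF t(1)]] bprob_integrable[OF p(3) kernel3_slice(1)[OF t(2)] kernel3D(2)[OF t(2)]]
     bprob_integrable[OF p(2) kernel3_inner2(3)[OF p(2,3) t(1)] kernel3_inner(2)[OF p(3) t(1)]]
     bprob_integrable[OF p(2) kernel3_inner2(3)[OF p(2,3) t(2)] kernel3_inner(2)[OF p(3) t(2)]]
     bprob_integrable[OF p(1) kernel3_inner2(1,2)[OF p(2,3) t(1)]] bprob_integrable[OF p(1) kernel3_inner2(1,2)[OF p(2,3) t(2)]])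
qed

text \<open>The weights \<open>g\<close> at \<open>x\<close> and \<open>a\<close> at the three
  points are kept apart from \<open>c\<close>, because the averages over s_1, s_2, s_3 first appear
  as a factor of \<open>a\<close> and are later moved, as a cube, into \<open>g\<close>.\<close>

definition config3 where
  "config3 g a c v1 v2 v3 = (\<integral>x. g x * a (x + v1) * a (x + v2) * a (x + v3) * (c (x + v1 + v2) * c (x + v1 + v3) * (c (x + v2 + v3) :: real)) \<partial>(lborel :: plane measure))"

definition config_avg where "config_avg g a c \<mu>1 \<mu>2 \<mu>3 = integral3 \<mu>1 \<mu>2 \<mu>3 (config3 g a c)"

lemma config3_kernel3:
  assumes "unit_fn V g" "unit_fn V a" "unit_fn V c"
  shows "kernel3 V (config3 g a c)" "0 \<le> config3 g a c v1 v2 v3"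
proof -
  note [measurable] = assms[THEN unit_fnD(1)]
  have "(\<lambda>(u, v, w). config3 g a c u v w) \<in> borel_measurable (borel \<Otimes>\<^sub>M borel \<Otimes>\<^sub>M borel)"
    unfolding config3_def by measurable
  moreover have K: "0 \<le> config3 g a c u v w \<and> config3 g a c u v w \<le> V" for u v w
  proof -
    have "unit_fn V (\<lambda>x. g x * a (x + u) * a (x + v) * a (x + w) * (c (x + u + v) * c (x + u + w) * c (x + v + w)))"
      unfolding add.assoc by (intro unit_fn_mult[where W=V] unit_fn_shift assms)
    from unit_fnD[OF this] show ?thesis unfolding config3_def by (intro conjI Bochner_Integration.integral_nonneg) auto
  qed
  ultimately show "kernel3 V (config3 g a c)" by (auto simp: kernel3_def abs_le_iff intro: order_trans[of _ 0])
  show "0 \<le> config3 g a c v1 v2 v3" using K by auto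
qed

lemma config3_sym: "config3 g a c v1 v2 v3 = config3 g a c v2 v1 v3" "config3 g a c v1 v2 v3 = config3 g a c v1 v3 v2"
  by (simp_all add: config3_def ac_simps)

lemma config_avg_sym:
  assumes "bprob \<mu>1" "bprob \<mu>2" "bprob \<mu>3" "unit_fn V g" "unit_fn V a" "unit_fn V c"
  shows "config_avg g a c \<mu>1 \<mu>2 \<mu>3 = config_avg g a c \<mu>2 \<mu>1 \<mu>3" "config_avg g a c \<mu>1 \<mu>2 \<mu>3 = config_avg g a c \<mu>1 \<mu>3 \<mu>2"
proof -
  note t = config3_kernel3(1)[OF assms(4-6)]
  have e: "(\<lambda>v u w. config3 g a c u v w) = config3 g a c" "(\<lambda>u w v. config3 g a c u v w) = config3 g a c"
    by (intro ext, rule config3_sym)+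
  show "config_avg g a c \<mu>1 \<mu>2 \<mu>3 = config_avg g a c \<mu>2 \<mu>1 \<mu>3"
    unfolding config_avg_def integral3_swap12[OF assms(1-3) t] e ..
  show "config_avg g a c \<mu>1 \<mu>2 \<mu>3 = config_avg g a c \<mu>1 \<mu>3 \<mu>2"
    unfolding config_avg_def integral3_swap23[OF assms(2,3) t] e ..
qed

text \<open>The measures are exchanged one at a time; the symmetry of \<open>config3\<close> in the
  three shifts moves the one being exchanged to the innermost place.\<close>

lemma config_avg_all_change:
  assumes "bprob \<mu>" "bprob \<mu>'" "unit_fn V g" "unit_fn V a" "unit_fn V c"
    and e: "\<And>\<mu>1 \<mu>2. \<mu>1 \<in> {\<mu>, \<mu>'} \<Longrightarrow> \<mu>2 \<in> {\<mu>, \<mu>'} \<Longrightarrow> \<bar>config_avg g a c \<mu>1 \<mu>2 \<mu> - config_avg g a c \<mu>1 \<mu>2 \<mu>'\<bar> \<le> e"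
  shows "\<bar>config_avg g a c \<mu> \<mu> \<mu> - config_avg g a c \<mu>' \<mu>' \<mu>'\<bar> \<le> 3 * e"
proof -
  note s = config_avg_sym[OF _ _ _ assms(3-5)]
  have "config_avg g a c \<mu> \<mu> \<mu>' = config_avg g a c \<mu> \<mu>' \<mu>" "config_avg g a c \<mu> \<mu>' \<mu>' = config_avg g a c \<mu>' \<mu>' \<mu>"
    using s(1)[of \<mu> \<mu>' \<mu>'] s(2)[of \<mu> \<mu> \<mu>'] s(2)[of \<mu>' \<mu> \<mu>'] assms(1,2) by simp_all
  then show ?thesis using e[of \<mu> \<mu>] e[of \<mu> \<mu>'] e[of \<mu>' \<mu>'] by simp
qed

text \<open>Young's inequality with parameter \<open>\<delta>\<close>, together with
  \<open>(H x)\<^sup>2 \<le> H x\<close>. One term stays proportional to \<open>V\<close>, and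
  \<open>\<delta>\<close> can be fixed before \<open>Z\<close> is made small.\<close>

lemma inner_small:
  assumes "unit_fn V H" "nice_fn f" "0 < \<delta>" "(LBINT x. (f x)\<^sup>2) \<le> Z"
  shows "\<bar>LBINT x. H x * f x\<bar> \<le> \<delta> * V / 2 + Z / (2 * \<delta>)" "(LBINT x. H x * \<bar>f x\<bar>) \<le> \<delta> * V / 2 + Z / (2 * \<delta>)"
proof -
  note nH = unit_fnD(7)[OF assms(1)]
  have "\<bar>LBINT x. H x * f x\<bar> \<le> (LBINT x. \<bar>H x * f x\<bar>)" by (rule integral_abs_bound)
  also have "\<dots> = (LBINT x. H x * \<bar>f x\<bar>)" using unit_fnD(2)[OF assms(1)] by (simp add: abs_mult)
  finally have 1: "\<bar>LBINT x. H x * f x\<bar> \<le> (LBINT x. H x * \<bar>f x\<bar>)" .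
  have "(LBINT x. H x * \<bar>f x\<bar>) \<le> (LBINT x. (\<delta> / 2) * H x + (1 / (2 * \<delta>)) * (f x)\<^sup>2)"
  proof (rule integral_mono)
    fix x
    have "0 \<le> (\<delta> * H x - \<bar>f x\<bar>)\<^sup>2" by simp
    then have "2 * \<delta> * (H x * \<bar>f x\<bar>) \<le> \<delta>\<^sup>2 * (H x)\<^sup>2 + (f x)\<^sup>2" by (simp add: power2_eq_square algebra_simps)
    also have "\<dots> \<le> \<delta>\<^sup>2 * H x + (f x)\<^sup>2"
      using unit_fnD(2,3)[OF assms(1), of x] by (auto simp: power2_eq_square intro!: mult_left_mono mult_left_le)
    finally have "(2 * \<delta> * (H x * \<bar>f x\<bar>)) / (2 * \<delta>) \<le> (\<delta>\<^sup>2 * H x + (f x)\<^sup>2) / (2 * \<delta>)"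
      using assms(3) by (intro divide_right_mono) auto
    then show "H x * \<bar>f x\<bar> \<le> (\<delta> / 2) * H x + (1 / (2 * \<delta>)) * (f x)\<^sup>2"
      using assms(3) by (simp add: add_divide_distrib power2_eq_square)
  qed (use nice_fnD(2)[OF nice_fn_mult[OF nH nice_fn_abs[OF assms(2)]]] nice_fnD(2)[OF nice_fn_sq[OF assms(2)]] unit_fnD(5)[OF assms(1)] in auto)
  also have "\<dots> = (\<delta> / 2) * (LBINT x. H x) + (1 / (2 * \<delta>)) * (LBINT x. (f x)\<^sup>2)"
    using nice_fnD(2)[OF nice_fn_sq[OF assms(2)]] unit_fnD(5)[OF assms(1)] by simp
  also have "\<dots> \<le> (\<delta> / 2) * V + (1 / (2 * \<delta>)) * Z"
    using assms(3,4) unit_fnD(6)[OF assms(1)] by (intro add_mono mult_left_mono) auto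
  finally show 2: "(LBINT x. H x * \<bar>f x\<bar>) \<le> \<delta> * V / 2 + Z / (2 * \<delta>)" by simp
  show "\<bar>LBINT x. H x * f x\<bar> \<le> \<delta> * V / 2 + Z / (2 * \<delta>)" using 1 2 by linarith
qed

text \<open>The factor \<open>w\<close> will be the indicator of a large window that contains all points concerned. It only
  replaces the constant \<open>1\<close>, which is not integrable.\<close>
definition face_product where "face_product a c w v1 v2 = (\<lambda>y. a y * c (y + v1) * c (y + v2) * (w (y + v1 + v2) :: real))"

lemma unit_fn_face_product: "unit_fn V a \<Longrightarrow> unit_fn V c \<Longrightarrow> unit_fn V w \<Longrightarrow> unit_fn V (face_product a c w v1 v2)"
  unfolding face_product_def add.assoc by (intro unit_fn_mult[where W=V] unit_fn_shift) auto

text \<open>For fixed \<open>v1\<close>, \<open>v2\<close> the factors without \<open>v3\<close>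
  form \<open>H\<close>, those with \<open>v3\<close> form the shift of \<open>face_product\<close>
  by \<open>v3\<close>. The integral over \<open>v3\<close> is thus the inner product of
  \<open>H\<close> with an average of \<open>face_product\<close>, and only this average feels the
  change of measure.\<close>

lemma config3_inner_change:
  assumes c: "unit_fn V g" "unit_fn V a" "unit_fn V c" "unit_fn V w" and p: "bprob \<mu>" "bprob \<mu>'" and "0 < \<delta>"
    and wabs: "\<And>y v v'. a y * c (y + v) * c (y + v') * w (y + v + v') = a y * c (y + v) * c (y + v')"
    and Z: "(LBINT y. (avg \<mu> (face_product a c w v1 v2) y - avg \<mu>' (face_product a c w v1 v2) y)\<^sup>2) \<le> Z"
  shows "\<bar>(\<integral>v3. config3 g a c v1 v2 v3 \<partial>\<mu>) - (\<integral>v3. config3 g a c v1 v2 v3 \<partial>\<mu>')\<bar> \<le> \<delta> * V / 2 + Z / (2 * \<delta>)"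
proof -
  define H where "H = (\<lambda>x. g x * a (x + v1) * a (x + v2) * c (x + v1 + v2))"
  let ?G = "face_product a c w v1 v2"
  have cH: "unit_fn V H" unfolding H_def add.assoc by (intro unit_fn_mult[where W=V] unit_fn_shift c)
  note cG = unit_fn_face_product[OF c(2,3,4), of v1 v2]
  have P: "config3 g a c v1 v2 v3 = corr H ?G v3" for v3
    unfolding config3_def corr_def H_def face_product_def wabs by (simp add: ac_simps)
  have e: "(\<integral>v3. config3 g a c v1 v2 v3 \<partial>\<mu>) = (LBINT y. H y * avg \<mu> ?G y)" if "bprob \<mu>" for \<mu>
    unfolding P by (rule avg_inner_corr[OF that unit_fnD(7)[OF cH] unit_fnD(7)[OF cG], symmetric])
  have n: "nice_fn (avg \<mu> ?G)" "nice_fn (avg \<mu>' ?G)" by (intro nice_fn_avg p unit_fnD(7)[OF cG])+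
  have "(\<integral>v3. config3 g a c v1 v2 v3 \<partial>\<mu>) - (\<integral>v3. config3 g a c v1 v2 v3 \<partial>\<mu>') = (LBINT y. H y * (avg \<mu> ?G y - avg \<mu>' ?G y))"
    unfolding e[OF p(1)] e[OF p(2)] using nice_fnD(2)[OF nice_fn_mult[OF unit_fnD(7)[OF cH] n(1)]] nice_fnD(2)[OF nice_fn_mult[OF unit_fnD(7)[OF cH] n(2)]]
    by (simp add: right_diff_distrib)
  then show ?thesis using inner_small(1)[OF cH nice_fn_diff[OF n] assms(7) Z] by simp
qed

text \<open>For comparisons whose error is the same for every function, such as arc against
  mollified arc: the bound is constant in \<open>v1\<close>, \<open>v2\<close> and survives
  integration over them.\<close>

lemma config_avg_change_const:
  assumes c: "unit_fn V g" "unit_fn V a" "unit_fn V c" "unit_fn V w" and p: "bprob \<mu>" "bprob \<mu>'" "bprob \<mu>1" "bprob \<mu>2" and "0 < \<delta>"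
    and wabs: "\<And>y v v'. a y * c (y + v) * c (y + v') * w (y + v + v') = a y * c (y + v) * c (y + v')"
    and Z: "\<And>G. unit_fn V G \<Longrightarrow> (LBINT y. (avg \<mu> G y - avg \<mu>' G y)\<^sup>2) \<le> Z"
  shows "\<bar>config_avg g a c \<mu>1 \<mu>2 \<mu> - config_avg g a c \<mu>1 \<mu>2 \<mu>'\<bar> \<le> \<delta> * V / 2 + Z / (2 * \<delta>)"
proof -
  have "\<bar>config_avg g a c \<mu>1 \<mu>2 \<mu> - config_avg g a c \<mu>1 \<mu>2 \<mu>'\<bar> \<le> (\<integral>u. \<integral>v. \<delta> * V / 2 + Z / (2 * \<delta>) \<partial>\<mu>2 \<partial>\<mu>1)"
    unfolding config_avg_def
    by (rule integral3_diff_bound[OF p(3,4,1,2) config3_kernel3(1)[OF c(1-3)] _ order_refl config3_inner_change[OF c p(1,2) assms(9) wabs Z[OF unit_fn_face_product[OF c(2,3,4)]]]]) auto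
  then show ?thesis unfolding bprob_const[OF p(4)] bprob_const[OF p(3)] .
qed

context chain
begin

lemma edrop_face_product:
  assumes "unit_fn V a" "unit_fn V c" "unit_fn V w"
  shows "edrop k (face_product a c w v1 v2) = (\<integral>u. cube_corr a c c w u v1 v2 \<partial>dconv b k) - (\<integral>u. cube_corr a c c w u v1 v2 \<partial>dconv b (Suc (Suc k)))"
  by (simp only: edrop_eq_dconv[OF unit_fnD(7)[OF unit_fn_face_product[OF assms]]] cube_corr_corr_u) (simp only: face_product_def)

text \<open>The error depends on \<open>v1\<close>, \<open>v2\<close> through the energy drop of
  \<open>face_product\<close>. Domination replaces both measures by \<open>dconv b (2*n+1)\<close>,
  exactly the level of \<open>v\<close> and \<open>w\<close> in \<open>cube_drop_u\<close>, and
  costs a factor \<open>C\<close> for each.\<close>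

lemma config_avg_change_edrop:
  assumes c: "unit_fn V g" "unit_fn V a" "unit_fn V c" "unit_fn V w" and p: "bprob \<mu>" "bprob \<mu>'" "bprob \<mu>1" "bprob \<mu>2" and "0 < \<delta>"
    and wabs: "\<And>y v v'. a y * c (y + v) * c (y + v') * w (y + v + v') = a y * c (y + v) * c (y + v')"
    and gd: "separated \<kappa> (pconv b (2*n)) \<mu> (b (Suc (2*n)))" "separated \<kappa> (pconv b (2*n)) \<mu>' (b (Suc (2*n)))"
    and d: "dominated C \<mu>1 (dconv b (2*n+1))" "dominated C \<mu>2 (dconv b (2*n+1))" "0 \<le> C"
  shows "\<bar>config_avg g a c \<mu>1 \<mu>2 \<mu> - config_avg g a c \<mu>1 \<mu>2 \<mu>'\<bar> \<le> \<delta> * V / 2 + (48 * \<kappa> * V + 12 * (C\<^sup>2 * cube_drop_u n a c c w)) / (2 * \<delta>)"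
proof -
  define D where "D = (\<lambda>v1 v2. edrop (2*n) (face_product a c w v1 v2))"
  define q where "q = 12 / (2 * \<delta>)"
  define e where "e = \<delta> * V / 2 + 48 * \<kappa> * V / (2 * \<delta>)"
  have q: "0 \<le> q" using assms(9) by (simp add: q_def)
  note t = cube_corr_kernels(1)[OF c(2,3,3,4)]
  have De: "D v w' = (\<integral>u. cube_corr a c c w u v w' \<partial>dconv b (2*n)) - (\<integral>u. cube_corr a c c w u v w' \<partial>dconv b (2*n+2))" for v w'
    unfolding D_def edrop_face_product[OF c(2-4)] by simp
  note [measurable] = kernel3_inner(1)[OF bprob_nu t]
  have Dm: "case_prod D \<in> borel_measurable (borel \<Otimes>\<^sub>M borel)"
    unfolding De[abs_def] case_prod_beta'
    by (intro borel_measurable_diff) (use kernel3_inner(1)[OF bprob_nu t] in \<open>simp_all add: case_prod_beta'\<close>)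
  have D0: "0 \<le> D v w'" for v w' unfolding D_def by (rule edrop_nonneg[OF unit_fnD(7)[OF unit_fn_face_product[OF c(2-4)]]])
  have D1: "D v w' \<le> 2 * V" for v w'
  proof -
    have a: "\<bar>\<integral>u. cube_corr a c c w u v w' \<partial>dconv b i\<bar> \<le> V" for i by (rule kernel3_inner(2)[OF bprob_nu t])
    from a[of "2*n"] a[of "2*n+2"] show ?thesis unfolding De by linarith
  qed
  have Db: "\<bar>e + q * D v w'\<bar> \<le> \<bar>e\<bar> + q * (2 * V)" for v w'
    using mult_left_mono[OF D1 q, of v w'] mult_nonneg_nonneg[OF q D0, of v w'] by linarith
  have "\<bar>config_avg g a c \<mu>1 \<mu>2 \<mu> - config_avg g a c \<mu>1 \<mu>2 \<mu>'\<bar> \<le> (\<integral>u. \<integral>v. e + q * D u v \<partial>\<mu>2 \<partial>\<mu>1)"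
    unfolding config_avg_def
  proof (rule integral3_diff_bound[OF p(3,4,1,2) config3_kernel3(1)[OF c(1-3)] _ Db])
    note [measurable] = Dm
    show "(\<lambda>(u, v). e + q * D u v) \<in> borel_measurable (borel \<Otimes>\<^sub>M borel)" by measurable
    fix u v
    have "\<bar>(\<integral>v3. config3 g a c u v v3 \<partial>\<mu>) - (\<integral>v3. config3 g a c u v v3 \<partial>\<mu>')\<bar> \<le> \<delta> * V / 2 + (48 * \<kappa> * V + 12 * D u v) / (2 * \<delta>)"
      unfolding D_def
      by (rule config3_inner_change[OF c p(1,2) assms(9) wabs separated_pair[OF p(1) gd(1) p(2) gd(2) unit_fn_face_product[OF c(2-4)]]])
    then show "\<bar>(\<integral>v3. config3 g a c u v v3 \<partial>\<mu>) - (\<integral>v3. config3 g a c u v v3 \<partial>\<mu>')\<bar> \<le> e + q * D u v"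
      by (simp add: e_def q_def add_divide_distrib)
  qed
  also have "\<dots> = e + q * (\<integral>u. \<integral>v. D u v \<partial>\<mu>2 \<partial>\<mu>1)"
  proof -
    have Dm1: "(\<lambda>w. D v w) \<in> borel_measurable borel" for v
    proof -
      note [measurable] = Dm
      have "(\<lambda>w. case_prod D (v, w)) \<in> borel_measurable borel" by measurable
      then show ?thesis by simp
    qed
    have Dab: "\<bar>D v w'\<bar> \<le> 2 * V" for v w' using D0 D1 by simp
    interpret M2: prob_space \<mu>2 using bprobD[OF p(4)] by simp
    interpret M1: prob_space \<mu>1 using bprobD[OF p(3)] by simp
    have "integrable \<mu>2 (D u)" for u by (rule bprob_integrable[OF p(4) Dm1 Dab])
    moreover have "integrable \<mu>1 (\<lambda>u. \<integral>v. D u v \<partial>\<mu>2)"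
      by (rule bprob_integrable[OF p(3) bprob_integral_measurable[OF p(4) Dm] bprob_integral_bound[OF p(4) Dm1 Dab]])
    ultimately show ?thesis by (simp add: M1.prob_space M2.prob_space)
  qed
  also have "\<dots> \<le> e + q * (C\<^sup>2 * (\<integral>u. \<integral>v. D u v \<partial>dconv b (2*n+1) \<partial>dconv b (2*n+1)))"
    by (intro add_left_mono mult_left_mono dominated_twice[OF p(3,4) bprob_nu d Dm D0 D1] q)
  also have "(\<integral>u. \<integral>v. D u v \<partial>dconv b (2*n+1) \<partial>dconv b (2*n+1)) = cube_drop_u n a c c w"
  proof -
    have i: "integrable (dconv b (2*n+1)) (\<lambda>v. \<integral>w'. cube_corr a c c w w' u v \<partial>dconv b i)" "integrable (dconv b (2*n+1)) (\<lambda>u. \<integral>v. \<integral>w'. cube_corr a c c w w' u v \<partial>dconv b i \<partial>dconv b (2*n+1))" for i u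
      by (rule bprob_integrable[OF bprob_nu kernel3_inner2(3)[OF bprob_nu bprob_nu t] kernel3_inner(2)[OF bprob_nu t]]
        bprob_integrable[OF bprob_nu kernel3_inner2(1,2)[OF bprob_nu bprob_nu t]])+
    show ?thesis unfolding De cube_drop_u_def cube_form_def integral3_def using i by simp
  qed
  finally show ?thesis by (simp add: e_def q_def add_divide_distrib)
qed

end

lemma prod3_diff:
  fixes x y z t :: real
  assumes "0 \<le> x" "x \<le> 1" "0 \<le> y" "y \<le> 1" "0 \<le> z" "z \<le> 1" "0 \<le> t" "t \<le> 1"
  shows "\<bar>x * y * z - t ^ 3\<bar> \<le> \<bar>x - t\<bar> + \<bar>y - t\<bar> + \<bar>z - t\<bar>"
proof -
  have "x * y * z - t ^ 3 = (x - t) * (y * z) + (y - t) * (t * z) + (z - t) * (t * t)"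
    by (simp add: algebra_simps power3_eq_cube)
  also have "\<bar>\<dots>\<bar> \<le> \<bar>x - t\<bar> * (y * z) + \<bar>y - t\<bar> * (t * z) + \<bar>z - t\<bar> * (t * t)"
    using assms by (intro order_trans[OF abs_triangle_ineq] add_mono) (auto simp: abs_mult)
  also have "\<dots> \<le> \<bar>x - t\<bar> * 1 + \<bar>y - t\<bar> * 1 + \<bar>z - t\<bar> * 1"
    using assms by (intro add_mono mult_left_mono) (auto intro: mult_le_one)
  finally show ?thesis by simp
qed

lemma mult3_le:
  fixes x y z :: real
  assumes "0 \<le> x" "x \<le> 1" "0 \<le> y" "y \<le> 1" "0 \<le> z" "z \<le> 1"
  shows "0 \<le> x * y * z" "x * y * z \<le> x" "x * y * z \<le> y" "x * y * z \<le> z" "x * y * z \<le> 1"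
proof -
  show "0 \<le> x * y * z" using assms by simp
  have xy: "x * y \<le> x * 1" "x * y \<le> 1 * y" using assms by (intro mult_mono; simp)+
  have "x * y * z \<le> (x * y) * 1" using assms by (intro mult_left_mono) auto
  with xy show "x * y * z \<le> x" "x * y * z \<le> y" "x * y * z \<le> 1" using assms by auto
  have "x * y * z \<le> 1 * z" using xy(1) assms by (intro mult_right_mono) auto
  then show "x * y * z \<le> z" by simp
qed

text \<open>Each \<open>f (x + v)\<close> is replaced by \<open>\<beta> (x + v)\<close>, at the cost
  of their difference weighted by \<open>a\<close>, and then by \<open>\<beta> x\<close> at the cost
  \<open>\<kappa>\<close>. The other factors are at most one; a factor \<open>a\<close> or
  \<open>c\<close> is retained so that the errors are bounded by multiples of integrals of
  weights.\<close>

lemma config3_slow: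
  assumes c: "unit_fn V c" "unit_fn V a" "unit_fn V f" "unit_fn V \<beta>"
    and v: "\<And>x v. v \<in> {v1, v2, v3} \<Longrightarrow> \<bar>\<beta> (x + v) - \<beta> x\<bar> \<le> \<kappa>"
  shows "\<bar>config3 c (\<lambda>x. a x * f x) c v1 v2 v3 - config3 (\<lambda>x. c x * \<beta> x ^ 3) a c v1 v2 v3\<bar> \<le> 3 * (LBINT x. a x * \<bar>f x - \<beta> x\<bar>) + 3 * \<kappa> * V"
proof -
  let ?a = "\<lambda>x. a x * f x" and ?g = "\<lambda>x. c x * \<beta> x ^ 3" and ?e = "\<lambda>x. a x * \<bar>f x - \<beta> x\<bar>"
  have ca: "unit_fn V ?a" by (rule unit_fn_mult[OF c(2,3)])
  have cg: "unit_fn V ?g" unfolding power3_eq_cube by (intro unit_fn_mult[where W=V] c)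
  let ?P = "\<lambda>g a x. g x * a (x + v1) * a (x + v2) * a (x + v3) * (c (x + v1 + v2) * c (x + v1 + v3) * c (x + v2 + v3))"
  have cP: "unit_fn V (?P g a)" if "unit_fn V g" "unit_fn V a" for g a
    unfolding add.assoc by (intro unit_fn_mult[where W=V] unit_fn_shift that c)
  note i = unit_fnD(5)[OF cP[OF c(1) ca]] unit_fnD(5)[OF cP[OF cg c(2)]]
  have ne: "nice_fn ?e" by (intro nice_fn_mult nice_fn_abs nice_fn_diff c[THEN unit_fnD(7)])
  have k: "0 \<le> \<kappa>" by (rule order_trans[OF abs_ge_zero v[of v1 0]]) simp
  have eq: "config3 c ?a c v1 v2 v3 - config3 ?g a c v1 v2 v3 = (LBINT x. ?P c ?a x - ?P ?g a x)"
    unfolding config3_def using i by simp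
  have "\<bar>config3 c ?a c v1 v2 v3 - config3 ?g a c v1 v2 v3\<bar> \<le> (LBINT x. \<bar>?P c ?a x - ?P ?g a x\<bar>)" unfolding eq by (rule integral_abs_bound)
  also have "\<dots> \<le> (LBINT x. ?e (x + v1) + ?e (x + v2) + ?e (x + v3) + 3 * \<kappa> * c x)"
  proof (rule integral_mono)
    fix x
    let ?A = "a (x + v1) * a (x + v2) * a (x + v3)" and ?C = "c (x + v1 + v2) * c (x + v1 + v3) * c (x + v2 + v3)"
    let ?x = "f (x + v1)" and ?y = "f (x + v2)" and ?z = "f (x + v3)" and ?t = "\<beta> x"
    have A: "0 \<le> ?A" "?A \<le> a (x + v1)" "?A \<le> a (x + v2)" "?A \<le> a (x + v3)" "?A \<le> 1"
      by (rule mult3_le[OF unit_fnD(2,3)[OF c(2)] unit_fnD(2,3)[OF c(2)] unit_fnD(2,3)[OF c(2)]])+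
    have C: "0 \<le> ?C" "?C \<le> 1"
      by (rule mult3_le[OF unit_fnD(2,3)[OF c(1)] unit_fnD(2,3)[OF c(1)] unit_fnD(2,3)[OF c(1)]])+
    have cx: "0 \<le> c x" "c x \<le> 1" using unit_fnD(2,3)[OF c(1)] by auto
    have "?P c ?a x - ?P ?g a x = c x * (?A * ?C) * (?x * ?y * ?z - ?t ^ 3)"
      by (simp add: algebra_simps)
    then have "\<bar>?P c ?a x - ?P ?g a x\<bar> = c x * (?A * ?C) * \<bar>?x * ?y * ?z - ?t ^ 3\<bar>"
      using abs_mult[of "c x * (?A * ?C)"] abs_of_nonneg[OF mult_nonneg_nonneg[OF cx(1) mult_nonneg_nonneg[OF A(1) C(1)]]] by presburger
    also have "\<dots> \<le> c x * (?A * 1) * (\<bar>?x - ?t\<bar> + \<bar>?y - ?t\<bar> + \<bar>?z - ?t\<bar>)"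
      by (intro mult_mono prod3_diff mult_nonneg_nonneg unit_fnD(2,3)[OF c(3)] unit_fnD(2,3)[OF c(4)] order_refl A C cx) auto
    also have "\<dots> \<le> c x * (?A * 1) * ((\<bar>?x - \<beta> (x + v1)\<bar> + \<kappa>) + (\<bar>?y - \<beta> (x + v2)\<bar> + \<kappa>) + (\<bar>?z - \<beta> (x + v3)\<bar> + \<kappa>))"
      using v[of v1 x] v[of v2 x] v[of v3 x] by (intro mult_left_mono add_mono) (use A cx in auto)
    also have "\<dots> = c x * (?A * \<bar>?x - \<beta> (x + v1)\<bar> + ?A * \<bar>?y - \<beta> (x + v2)\<bar> + ?A * \<bar>?z - \<beta> (x + v3)\<bar>) + 3 * \<kappa> * (c x * ?A)"
      by (simp add: algebra_simps)
    also have "\<dots> \<le> 1 * (?e (x + v1) + ?e (x + v2) + ?e (x + v3)) + 3 * \<kappa> * (c x * 1)"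
      by (intro add_mono mult_mono A cx mult_nonneg_nonneg add_nonneg_nonneg abs_ge_zero order_refl) (use k unit_fnD(2)[OF c(2)] in auto)
    finally show "\<bar>?P c ?a x - ?P ?g a x\<bar> \<le> ?e (x + v1) + ?e (x + v2) + ?e (x + v3) + 3 * \<kappa> * c x" by simp
  qed (use i nice_fnD(2)[OF nice_fn_shift[OF ne]] unit_fnD(5)[OF c(1)] in \<open>auto intro!: Bochner_Integration.integrable_add\<close>)
  also have "\<dots> = 3 * (LBINT x. ?e x) + 3 * \<kappa> * (LBINT x. c x)"
    using nice_fnD(2)[OF nice_fn_shift[OF ne]] unit_fnD(5)[OF c(1)] lborel_shift(1)[OF nice_fnD(1)[OF ne]] by simp
  also have "\<dots> \<le> 3 * (LBINT x. ?e x) + 3 * \<kappa> * V"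
    using unit_fnD(6)[OF c(1)] k by (intro add_left_mono mult_left_mono) auto
  finally show ?thesis .
qed

section \<open>Smoothing by an arc of non-vanishing curvature\<close>

definition L1_continuous :: "(plane \<Rightarrow> real) \<Rightarrow> bool" where
  "L1_continuous h \<longleftrightarrow> (\<forall>v. v \<longlonglongrightarrow> 0 \<longrightarrow> (\<lambda>n. LBINT u. \<bar>h (u + v n) - h u\<bar>) \<longlonglongrightarrow> 0)"

text \<open>By invariance under shifts the error of approximation enters twice with the same value,
  at the shifted and at the unshifted argument: \<open>r / 4 + r / 2 + r / 4\<close>.\<close>

lemma L1_continuous_closure:
  assumes h: "integrable lborel h"
    and ap: "\<And>e. 0 < e \<Longrightarrow> \<exists>g. integrable lborel g \<and> L1_continuous g \<and> (LBINT u. \<bar>h u - g u\<bar>) \<le> e"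
  shows "L1_continuous h"
  unfolding L1_continuous_def
proof (intro allI impI LIMSEQ_I)
  fix v :: "nat \<Rightarrow> plane" and r :: real assume v: "v \<longlonglongrightarrow> 0" and r: "0 < r"
  obtain g where g: "integrable lborel g" "L1_continuous g" "(LBINT u. \<bar>h u - g u\<bar>) \<le> r / 4" using ap[of "r/4"] r by auto
  have mh [measurable]: "h \<in> borel_measurable borel" "g \<in> borel_measurable borel" using h g(1) by auto
  from g(2) v have "(\<lambda>n. LBINT u. \<bar>g (u + v n) - g u\<bar>) \<longlonglongrightarrow> 0" by (auto simp: L1_continuous_def)
  from LIMSEQ_D[OF this, of "r/2"] r obtain N where N: "\<And>n. N \<le> n \<Longrightarrow> (LBINT u. \<bar>g (u + v n) - g u\<bar>) < r / 2" by auto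
  have hs: "integrable lborel (\<lambda>u. h (u + w))" "integrable lborel (\<lambda>u. g (u + w))" for w
    using lborel_shift(2)[OF mh(1)] lborel_shift(2)[OF mh(2)] h g(1) by auto
  have "(LBINT u. \<bar>h (u + v n) - h u\<bar>) < r" if "N \<le> n" for n
  proof -
    have "(LBINT u. \<bar>h (u + v n) - h u\<bar>) \<le> (LBINT u. \<bar>h (u + v n) - g (u + v n)\<bar> + \<bar>g (u + v n) - g u\<bar> + \<bar>h u - g u\<bar>)"
      by (rule integral_mono) (use h g(1) hs in \<open>auto intro!: Bochner_Integration.integrable_add integrable_abs Bochner_Integration.integrable_diff\<close>)
    also have "\<dots> = (LBINT u. \<bar>h (u + v n) - g (u + v n)\<bar>) + (LBINT u. \<bar>g (u + v n) - g u\<bar>) + (LBINT u. \<bar>h u - g u\<bar>)"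
      using h g(1) hs by simp
    also have "(LBINT u. \<bar>h (u + v n) - g (u + v n)\<bar>) = (LBINT u. \<bar>h u - g u\<bar>)"
      using lborel_shift(1)[of "\<lambda>u. \<bar>h u - g u\<bar>" "v n"] by simp
    finally show ?thesis using g(3) N[OF that] by linarith
  qed
  then show "\<exists>no. \<forall>n\<ge>no. norm ((LBINT u. \<bar>h (u + v n) - h u\<bar>) - 0) < r"
    by (intro exI[of _ N]) auto
qed

text \<open>The positive part of \<open>1\<^sub>S(u) - 1\<^sub>S(u + v\<^sub>n)\<close> tends to \<open>0\<close> pointwise because \<open>S\<close> is open, and the
  negative part has the same integral.\<close>
lemma L1_continuous_open:
  assumes "open S" "emeasure lborel S < \<infinity>"
  shows "L1_continuous (indicat_real S)"
  unfolding L1_continuous_def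
proof (intro allI impI)
  fix v :: "nat \<Rightarrow> plane" assume v: "v \<longlonglongrightarrow> 0"
  have [measurable]: "S \<in> sets borel" using assms(1) by simp
  have i: "integrable lborel (indicat_real S)" by (rule integrable_real_indicator) (use assms in auto)
  have iss: "integrable lborel (\<lambda>u. indicat_real S (u + w))" for w using lborel_shift(2)[of "indicat_real S" w] i by simp
  define p where "p = (\<lambda>n u. max 0 (indicat_real S u - indicat_real S (u + v n)))"
  have ip: "integrable lborel (p n)" for n unfolding p_def using i iss by (intro integrable_max) auto
  have "(\<lambda>n. LBINT u. p n u) \<longlonglongrightarrow> (\<integral>u. 0 \<partial>(lborel :: plane measure))"
  proof (rule integral_dominated_convergence[where w="indicat_real S"])
    show "AE u in lborel. (\<lambda>n. p n u) \<longlonglongrightarrow> 0"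
    proof (rule AE_I2)
      fix u
      show "(\<lambda>n. p n u) \<longlonglongrightarrow> 0"
      proof (cases "u \<in> S")
        case True
        have "(\<lambda>n. u + v n) \<longlonglongrightarrow> u" using tendsto_add[OF tendsto_const v, of u] by simp
        from topological_tendstoD[OF this assms(1) True] have "eventually (\<lambda>n. p n u = 0) sequentially"
          by eventually_elim (use True in \<open>auto simp: p_def\<close>)
        then show ?thesis by (simp add: tendsto_eventually)
      qed (auto simp: p_def)
    qed
    show "AE u in lborel. norm (p n u) \<le> indicat_real S u" for n
      by (rule AE_I2) (auto simp: p_def indicator_def)
  qed (use ip i in auto)
  then have lim: "(\<lambda>n. 2 * (LBINT u. p n u)) \<longlonglongrightarrow> 0" using tendsto_mult_right_zero by fastforce
  have "(LBINT u. \<bar>indicat_real S (u + v n) - indicat_real S u\<bar>) = 2 * (LBINT u. p n u)" for n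
  proof -
    have "(LBINT u. \<bar>indicat_real S (u + v n) - indicat_real S u\<bar>) = (LBINT u. 2 * p n u - (indicat_real S u - indicat_real S (u + v n)))"
      by (rule Bochner_Integration.integral_cong) (auto simp: p_def max_def)
    also have "\<dots> = 2 * (LBINT u. p n u) - ((LBINT u. indicat_real S u) - (LBINT u. indicat_real S (u + v n)))"
      using ip i iss by simp
    also have "(LBINT u. indicat_real S (u + v n)) = (LBINT u. indicat_real S u)" by (rule lborel_shift(1)) measurable
    finally show ?thesis by simp
  qed
  then show "(\<lambda>n. LBINT u. \<bar>indicat_real S (u + v n) - indicat_real S u\<bar>) \<longlonglongrightarrow> 0" using lim by simp
qed

lemma L1_continuous_cmult: assumes "L1_continuous h" shows "L1_continuous (\<lambda>u. h u * c)"
  unfolding L1_continuous_def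
proof (intro allI impI)
  fix v :: "nat \<Rightarrow> plane" assume v: "v \<longlonglongrightarrow> 0"
  have "(LBINT u. \<bar>h (u + v n) * c - h u * c\<bar>) = (LBINT u. \<bar>h (u + v n) - h u\<bar>) * \<bar>c\<bar>" for n
    unfolding left_diff_distrib[symmetric] abs_mult by simp
  then show "(\<lambda>n. LBINT u. \<bar>h (u + v n) * c - h u * c\<bar>) \<longlonglongrightarrow> 0"
    using assms v by (auto simp: L1_continuous_def intro!: tendsto_mult_left_zero)
qed

lemma L1_continuous_add:
  assumes "integrable lborel f" "integrable lborel g" "L1_continuous f" "L1_continuous g" shows "L1_continuous (\<lambda>u. f u + g u)"
  unfolding L1_continuous_def
proof (intro allI impI)
  fix v :: "nat \<Rightarrow> plane" assume v: "v \<longlonglongrightarrow> 0"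
  have m [measurable]: "f \<in> borel_measurable borel" "g \<in> borel_measurable borel" using assms(1,2) by auto
  have hs: "integrable lborel (\<lambda>u. f (u + w))" "integrable lborel (\<lambda>u. g (u + w))" for w
    using lborel_shift(2)[OF m(1)] lborel_shift(2)[OF m(2)] assms(1,2) by auto
  have l: "(\<lambda>n. (LBINT u. \<bar>f (u + v n) - f u\<bar>) + (LBINT u. \<bar>g (u + v n) - g u\<bar>)) \<longlonglongrightarrow> 0"
    using assms(3,4) v tendsto_add_zero unfolding L1_continuous_def by blast
  show "(\<lambda>n. LBINT u. \<bar>f (u + v n) + g (u + v n) - (f u + g u)\<bar>) \<longlonglongrightarrow> 0"
  proof (rule tendsto_sandwich[OF _ _ tendsto_const l])
    show "eventually (\<lambda>n. 0 \<le> (LBINT u. \<bar>f (u + v n) + g (u + v n) - (f u + g u)\<bar>)) sequentially" by simp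
    have "(LBINT u. \<bar>f (u + v n) + g (u + v n) - (f u + g u)\<bar>) \<le> (LBINT u. \<bar>f (u + v n) - f u\<bar> + \<bar>g (u + v n) - g u\<bar>)" for n
      by (rule integral_mono) (use assms hs in \<open>auto intro!: Bochner_Integration.integrable_add integrable_abs Bochner_Integration.integrable_diff\<close>)
    also have "\<dots> n = (LBINT u. \<bar>f (u + v n) - f u\<bar>) + (LBINT u. \<bar>g (u + v n) - g u\<bar>)" for n
      using assms hs by simp
    finally show "eventually (\<lambda>n. (LBINT u. \<bar>f (u + v n) + g (u + v n) - (f u + g u)\<bar>) \<le> (LBINT u. \<bar>f (u + v n) - f u\<bar>) + (LBINT u. \<bar>g (u + v n) - g u\<bar>)) sequentially"
      by (intro always_eventually allI)
  qed
qed

text \<open>Outer regularity provides an open superset whose indicator is close in L1.\<close>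

lemma L1_continuous_indicator:
  assumes "A \<in> sets borel" "emeasure lborel A < \<infinity>" shows "L1_continuous (indicat_real A)"
proof (rule L1_continuous_closure)
  note [measurable] = assms(1)
  show i: "integrable lborel (indicat_real A)" by (rule integrable_real_indicator) (use assms in auto)
  fix e :: real assume e: "0 < e"
  have "A \<in> sets lebesgue" using assms(1) by simp
  from sets_lebesgue_outer_open[OF this e] obtain S where S: "open S" "A \<subseteq> S" "S - A \<in> lmeasurable" "emeasure lebesgue (S - A) < ennreal e"
    by blast
  have [measurable]: "S \<in> sets borel" using S by simp
  have d: "emeasure lborel (S - A) < ennreal e" using S(4) by simp
  have "emeasure lborel S \<le> emeasure lborel A + emeasure lborel (S - A)"
    using emeasure_subadditive[of A lborel "S - A"] S(2) by (simp add: Un_absorb1)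
  also have "\<dots> < \<infinity>" using assms(2) d by (auto simp: less_top[symmetric] ennreal_add_eq_top)
  finally have fS: "emeasure lborel S < \<infinity>" .
  have iS: "integrable lborel (indicat_real S)" by (rule integrable_real_indicator) (use fS in auto)
  have "(LBINT u. \<bar>indicat_real A u - indicat_real S u\<bar>) = (LBINT u. indicat_real (S - A) u)"
    by (rule Bochner_Integration.integral_cong) (use S(2) in \<open>auto simp: indicator_def\<close>)
  also have "\<dots> = measure lborel (S - A)" by simp
  also have "\<dots> \<le> e" using d e by (simp add: measure_def enn2real_leI)
  finally show "\<exists>g. integrable lborel g \<and> L1_continuous g \<and> (LBINT u. \<bar>indicat_real A u - g u\<bar>) \<le> e"
    using iS L1_continuous_open[OF S(1) fS] by blast
qed

lemma L1_continuous_integrable: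
  assumes "integrable lborel h" shows "L1_continuous h"
  using assms
proof (induct rule: integrable_induct)
  case (base A c)
  then show ?case using L1_continuous_cmult[OF L1_continuous_indicator[of A], of c] by simp
next
  case (add f g)
  then show ?case by (intro L1_continuous_add)
next
  case (lim f s)
  show ?case
  proof (rule L1_continuous_closure[OF lim(5)])
    fix e :: real assume e: "0 < e"
    have "(\<lambda>i. LBINT u. \<bar>f u - s i u\<bar>) \<longlonglongrightarrow> (\<integral>u. 0 \<partial>(lborel :: plane measure))"
    proof (rule integral_dominated_convergence[where w="\<lambda>u. 3 * \<bar>f u\<bar>"])
      show "AE u in lborel. (\<lambda>i. \<bar>f u - s i u\<bar>) \<longlonglongrightarrow> 0"
      proof (rule AE_I2)
        fix u
        have "(\<lambda>i. \<bar>f u - s i u\<bar>) \<longlonglongrightarrow> \<bar>f u - f u\<bar>" using lim(3)[of u] by (intro tendsto_intros) auto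
        then show "(\<lambda>i. \<bar>f u - s i u\<bar>) \<longlonglongrightarrow> 0" by simp
      qed
      show "AE u in lborel. norm \<bar>f u - s i u\<bar> \<le> 3 * \<bar>f u\<bar>" for i
        by (rule AE_I2) (use lim(4)[of _ i] in \<open>auto intro!: order_trans[OF abs_triangle_ineq4] simp: algebra_simps\<close>)
    qed (use lim in auto)
    from LIMSEQ_D[OF this e] obtain i where "(LBINT u. \<bar>f u - s i u\<bar>) < e" by auto
    then show "\<exists>g. integrable lborel g \<and> L1_continuous g \<and> (LBINT u. \<bar>f u - g u\<bar>) \<le> e"
      using lim by (intro exI[of _ "s i"]) auto
  qed
qed

lemma L1_translation:
  fixes h :: "plane \<Rightarrow> real"
  assumes "integrable lborel h" "0 < e"
  obtains d where "0 < d" "\<And>v. norm v < d \<Longrightarrow> (\<integral>u. \<bar>h (u + v) - h u\<bar> \<partial>(lborel :: plane measure)) \<le> e"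
proof (rule ccontr)
  assume "\<not> thesis"
  with that have "\<forall>n. \<exists>v. norm v < inverse (real (Suc n)) \<and> \<not> (LBINT u. \<bar>h (u + v) - h u\<bar>) \<le> e"
    by (metis inverse_positive_iff_positive of_nat_0_less_iff zero_less_Suc)
  then obtain v where v: "\<And>n. norm (v n) < inverse (real (Suc n))" "\<And>n. \<not> (LBINT u. \<bar>h (u + v n) - h u\<bar>) \<le> e" by metis
  have "v \<longlonglongrightarrow> 0"
    by (rule Lim_null_comparison[OF always_eventually LIMSEQ_inverse_real_of_nat], rule allI, rule less_imp_le, rule v(1))
  with L1_continuous_integrable[OF assms(1)] have "(\<lambda>n. LBINT u. \<bar>h (u + v n) - h u\<bar>) \<longlonglongrightarrow> 0" by (auto simp: L1_continuous_def)
  from LIMSEQ_D[OF this assms(2)] v(2) show False by (auto simp: not_le) (meson le_refl less_asym)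
qed

lemma sq_norm: "u \<in> sq r \<Longrightarrow> norm u \<le> 2 * r"
proof -
  assume u: "u \<in> sq r"
  have "norm u \<le> (\<Sum>i\<in>UNIV. \<bar>u $ i\<bar>)" by (rule norm_le_l1_cart)
  also have "\<dots> \<le> (\<Sum>i\<in>(UNIV :: 2 set). r)" by (intro sum_mono) (use u in \<open>auto simp: sq_def\<close>)
  finally show ?thesis by simp
qed

text \<open>A measure with an L1 density changes little in total variation under small shifts, by
  continuity of translations. The resulting \<open>\<epsilon>\<close> serves all \<open>f\<close>
  bounded by one at once, as an estimate of an operator norm requires.\<close>

lemma absolutely_continuous_box_close:
  fixes \<eta> :: real
  assumes "bprob \<rho>" "absolutely_continuous lborel \<rho>" "0 < \<eta>"
  obtains \<epsilon> where "0 < \<epsilon>" "\<epsilon> \<le> 1" "\<And>f. f \<in> borel_measurable borel \<Longrightarrow> (\<And>x. \<bar>f x\<bar> \<le> 1) \<Longrightarrow>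
     \<bar>(\<integral>u. f u \<partial>\<rho>) - (\<integral>u. (\<integral>w. f (u + w) \<partial>usq \<epsilon>) \<partial>\<rho>)\<bar> \<le> \<eta>"
proof -
  interpret finite_measure \<rho> using bprobD[OF assms(1)] by simp
  have sN: "sets \<rho> = sets lborel" using bprobD(2)[OF assms(1)] by simp
  obtain D where D: "D \<in> borel_measurable lborel" "AE x in lborel. RN_deriv lborel \<rho> x = ennreal (D x)" "\<And>x. 0 \<le> D x"
    by (rule sigma_finite_measure.real_RN_deriv[OF sigma_finite_lborel finite_measure_axioms assms(2) sN]) blast
  note [measurable] = D(1)[simplified]
  have "\<rho> = density lborel (RN_deriv lborel \<rho>)"
    by (rule sigma_finite_measure.density_RN_deriv[OF sigma_finite_lborel assms(2), symmetric]) (use bprobD(2)[OF assms(1)] in simp)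
  also have "\<dots> = density lborel D" by (rule density_cong) (use D(2) in auto)
  finally have \<rho>: "\<rho> = density lborel D" .
  have iD: "integrable lborel D"
  proof (rule integrableI_nonneg)
    have "emeasure \<rho> UNIV = (\<integral>\<^sup>+x. D x \<partial>lborel)" by (subst \<rho>) (simp add: emeasure_density)
    then show "(\<integral>\<^sup>+x. D x \<partial>lborel) < \<infinity>" by (metis emeasure_finite infinity_ennreal_def less_top)
  qed (use D in auto)
  from L1_translation[OF iD assms(3)] obtain d where d: "0 < d" "\<And>v. norm v < d \<Longrightarrow> (LBINT u. \<bar>D (u + v) - D u\<bar>) \<le> \<eta>" by blast
  \<comment> \<open>Points of \<open>sq \<epsilon>\<close> have norm at most
    \<open>2 * \<epsilon>\<close>, which has to stay below \<open>d\<close>.\<close>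
  define \<epsilon> where "\<epsilon> = min 1 (d / 3)"
  have \<epsilon>: "0 < \<epsilon>" "\<epsilon> \<le> 1" "2 * \<epsilon> < d" using d(1) by (auto simp: \<epsilon>_def)
  show ?thesis
  proof (rule that[OF \<epsilon>(1,2)])
    fix f :: "plane \<Rightarrow> real" assume f [measurable]: "f \<in> borel_measurable borel" and f1: "\<And>x. \<bar>f x\<bar> \<le> 1"
    have w: "\<bar>(\<integral>u. f (u + w) \<partial>\<rho>) - (\<integral>u. f u \<partial>\<rho>)\<bar> \<le> \<eta>"
      if "w \<in> sq \<epsilon>" and f [measurable]: "f \<in> borel_measurable borel" and f1: "\<And>x. \<bar>f x\<bar> \<le> 1" for w and f :: "plane \<Rightarrow> real"
    proof -
      have iDs: "integrable lborel (\<lambda>u. D (u - w))" using lborel_shift(2)[of D "- w"] iD by simp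
      have i1: "integrable lborel (\<lambda>u. D u * f u)"
        by (rule Bochner_Integration.integrable_bound[OF iD]) (use f1 D(3) in \<open>auto simp: abs_mult mult_left_le\<close>)
      have i2: "integrable lborel (\<lambda>u. D (u - w) * f u)"
        by (rule Bochner_Integration.integrable_bound[OF iDs]) (use f1 D(3) in \<open>auto simp: abs_mult mult_left_le\<close>)
      note i = i1 i2
      have "(\<integral>u. f (u + w) \<partial>\<rho>) = (LBINT u. (\<lambda>u. D (u - w) * f u) (u + w))"
        by (subst \<rho>) (use D(3) in \<open>simp add: integral_density\<close>)
      also have "\<dots> = (LBINT u. D (u - w) * f u)" by (rule lborel_shift(1)) measurable
      finally have "(\<integral>u. f (u + w) \<partial>\<rho>) - (\<integral>u. f u \<partial>\<rho>) = (LBINT u. D (u - w) * f u - D u * f u)"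
        using i by (subst (2) \<rho>) (use D(3) in \<open>simp add: integral_density\<close>)
      also have "\<bar>\<dots>\<bar> \<le> (LBINT u. \<bar>D (u - w) * f u - D u * f u\<bar>)" by (rule integral_abs_bound)
      also have "\<dots> \<le> (LBINT u. \<bar>D (u + (- w)) - D u\<bar>)"
      proof (rule integral_mono)
        show "integrable lborel (\<lambda>u. \<bar>D (u - w) * f u - D u * f u\<bar>)"
          by (intro integrable_abs Bochner_Integration.integrable_diff i)
        show "\<bar>D (u - w) * f u - D u * f u\<bar> \<le> \<bar>D (u + (- w)) - D u\<bar>" for u
          using f1[of u] by (simp add: left_diff_distrib[symmetric] abs_mult mult_left_le)
      qed (use iDs iD in simp)
      also have "\<dots> \<le> \<eta>" by (rule d(2)) (use sq_norm[OF that(1)] \<epsilon>(3) in simp)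
      finally show ?thesis .
    qed
    note pU = bprob_usq[OF \<epsilon>(1)]
    have "(\<integral>u. (\<integral>w. f (u + w) \<partial>usq \<epsilon>) \<partial>\<rho>) = (\<integral>w. (\<integral>u. f (u + w) \<partial>\<rho>) \<partial>usq \<epsilon>)"
    proof (rule bprob_swap[OF assms(1) pU])
      show "(\<lambda>(u, w). f (u + w)) \<in> borel_measurable (borel \<Otimes>\<^sub>M borel)" by measurable
    qed (rule f1)
    also have "\<dots> = avg (usq \<epsilon>) (\<lambda>w. \<integral>u. f (u + w) \<partial>\<rho>) 0" by (simp add: avg_def)
    also have "\<bar>\<dots> - (\<integral>u. f (u + 0) \<partial>\<rho>)\<bar> \<le> \<eta>"
    proof (rule avg_avg_close[OF pU supp_in_usq[OF \<epsilon>(1)]])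
      show "(\<lambda>w. \<integral>u. f (u + w) \<partial>\<rho>) \<in> borel_measurable borel" by (rule bprob_integral_measurable[OF assms(1)]) measurable
      show "\<bar>\<integral>u. f (u + x) \<partial>\<rho>\<bar> \<le> 1" for x by (rule bprob_integral_bound[OF assms(1)]) (use f1 in auto)
      fix y u assume u: "u \<in> sq \<epsilon>"
      show "\<bar>(\<integral>x. f (x + (y + u)) \<partial>\<rho>) - (\<integral>x. f (x + y) \<partial>\<rho>)\<bar> \<le> \<eta>"
        using w[OF u, of "\<lambda>x. f (x + y)"] f1 by (simp add: ac_simps)
    qed
    finally show "\<bar>(\<integral>u. f u \<partial>\<rho>) - (\<integral>u. (\<integral>w. f (u + w) \<partial>usq \<epsilon>) \<partial>\<rho>)\<bar> \<le> \<eta>" by simp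
  qed
qed

section \<open>The measure on an arc and the law of the difference of two of its points\<close>

definition cross2 :: "plane \<Rightarrow> plane \<Rightarrow> real" where "cross2 a b = a $ 1 * b $ 2 - a $ 2 * b $ 1"

definition unif_interval :: "real \<Rightarrow> real measure" where "unif_interval l = uniform_measure lborel {0..l}"

definition arc_measure :: "(real \<Rightarrow> plane) \<Rightarrow> real \<Rightarrow> real \<Rightarrow> plane measure" where
  "arc_measure \<gamma> l t = distr (unif_interval l) borel (\<lambda>\<theta>. t *\<^sub>R \<gamma> \<theta>)"

text \<open>The negligibility of preimages under a differentiable map is obtained in
  \<open>real^2\<close>, while Fubini for the two parameters lives on pairs; this identifies the two
  Lebesgue measures.\<close>

lemma distr_lborel_vec2: "distr (lborel :: plane measure) borel (\<lambda>p. (p $ 1, p $ 2)) = (lborel :: (real \<times> real) measure)"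
proof (rule lborel_eqI[symmetric])
  fix l u :: "real \<times> real"
  assume le: "\<And>b. b \<in> Basis \<Longrightarrow> l \<bullet> b \<le> u \<bullet> b"
  have le': "fst l \<le> fst u" "snd l \<le> snd u"
    using le[of "(1, 0)"] le[of "(0, 1)"] by (auto simp: Basis_prod_def inner_prod_def)
  let ?L = "(\<chi> i. if i = 1 then fst l else snd l) :: plane" and ?R = "(\<chi> i. if i = 1 then fst u else snd u) :: plane"
  have e: "(\<lambda>p :: plane. (p $ 1, p $ 2)) -` box l u = box ?L ?R"
    by (auto simp: mem_box_cart forall_2 mem_box Basis_prod_def inner_prod_def)
  have c: "(\<lambda>p :: plane. (p $ 1, p $ 2)) \<in> borel_measurable borel"
    by (intro borel_measurable_continuous_onI continuous_intros)
  have "emeasure (distr lborel borel (\<lambda>p :: plane. (p $ 1, p $ 2))) (box l u) = emeasure lborel (box ?L ?R)"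
    using c by (subst emeasure_distr) (auto simp: e)
  also have "\<dots> = (\<Prod>b\<in>Basis. (?R - ?L) \<bullet> b)"
  proof (rule emeasure_lborel_box)
    show "?L \<bullet> b \<le> ?R \<bullet> b" if "b \<in> Basis" for b
      using that le' by (auto simp: Basis_vec_def inner_axis)
  qed
  also have "(\<Prod>b\<in>(Basis :: plane set). (?R - ?L) \<bullet> b) = (fst u - fst l) * (snd u - snd l)"
  proof -
    have B: "(Basis :: plane set) = {axis 1 1, axis 2 1}" by (auto simp: Basis_vec_def UNIV_2)
    show ?thesis unfolding B by (simp add: axis_eq_axis inner_axis)
  qed
  also have "\<dots> = (\<Prod>b\<in>Basis. (u - l) \<bullet> b)"
    by (simp add: Basis_prod_def inner_prod_def)
  finally show "emeasure (distr lborel borel (\<lambda>p :: plane. (p $ 1, p $ 2))) (box l u) = (\<Prod>b\<in>Basis. (u - l) \<bullet> b)" .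
qed simp

lemma prob_unif_interval: assumes "0 < l" shows "prob_space (unif_interval l)" "sets (unif_interval l) = sets borel"
  unfolding unif_interval_def using assms by (auto intro!: prob_space_uniform_measure)

lemma bprob_arc_measure: assumes "0 < l" "\<gamma> \<in> borel_measurable borel" shows "bprob (arc_measure \<gamma> l t)"
proof -
  note [measurable_cong] = prob_unif_interval(2)[OF assms(1)]
  note [measurable] = assms(2)
  interpret prob_space "unif_interval l" by (rule prob_unif_interval[OF assms(1)])
  have "prob_space (arc_measure \<gamma> l t)" unfolding arc_measure_def by (rule prob_space_distr) measurable
  then show ?thesis by (simp add: bprob_def arc_measure_def)
qed

lemma integral_arc_measure:
  fixes f :: "plane \<Rightarrow> real"
  assumes "0 < l" "\<gamma> \<in> borel_measurable borel" "f \<in> borel_measurable borel"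
  shows "(\<integral>u. f u \<partial>arc_measure \<gamma> l t) = (\<integral>\<theta>. f (t *\<^sub>R \<gamma> \<theta>) \<partial>unif_interval l)"
proof -
  note [measurable_cong] = prob_unif_interval(2)[OF assms(1)]
  note [measurable] = assms(2,3)
  show ?thesis unfolding arc_measure_def by (rule integral_distr) measurable
qed

lemma bprob_refl: assumes "bprob \<mu>" shows "bprob (distr \<mu> borel uminus)"
proof -
  note [measurable_cong] = bprobD(2)[OF assms]
  interpret prob_space \<mu> using bprobD[OF assms] by simp
  have "prob_space (distr \<mu> borel uminus)" by (rule prob_space_distr) measurable
  then show ?thesis by (simp add: bprob_def)
qed

lemma integral_refl:
  fixes f :: "plane \<Rightarrow> real"
  assumes "bprob \<mu>" "f \<in> borel_measurable borel" shows "(\<integral>u. f u \<partial>distr \<mu> borel uminus) = (\<integral>u. f (- u) \<partial>\<mu>)"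
proof -
  note [measurable_cong] = bprobD(2)[OF assms(1)]
  show ?thesis by (rule integral_distr) (use assms(2) in measurable)
qed

text \<open>An arc need not be symmetric, so the adjoint of its average is the average over the
  reflected measure. Composing the two yields \<open>arc_difference\<close>.\<close>

lemma adjoint_refl:
  assumes "bprob \<mu>" "nice_fn f" "nice_fn g"
  shows "(LBINT y. avg \<mu> f y * g y) = (LBINT y. f y * avg (distr \<mu> borel uminus) g y)"
proof -
  have "(LBINT y. f y * avg (distr \<mu> borel uminus) g y) = (\<integral>u. corr f g u \<partial>distr \<mu> borel uminus)"
    by (rule avg_inner_corr[OF bprob_refl[OF assms(1)] assms(2,3)])
  also have "\<dots> = (\<integral>u. corr f g (- u) \<partial>\<mu>)" by (rule integral_refl[OF assms(1) corr_measurable[OF assms(2,3)]])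
  also have "\<dots> = (\<integral>u. corr g f u \<partial>\<mu>)" by (simp add: corr_swap[OF assms(2,3)])
  also have "\<dots> = (LBINT y. g y * avg \<mu> f y)" by (rule avg_inner_corr[OF assms(1,3,2), symmetric])
  finally show ?thesis by (simp add: mult.commute)
qed

definition arc_difference :: "(real \<Rightarrow> plane) \<Rightarrow> real \<Rightarrow> real \<Rightarrow> plane measure" where
  "arc_difference \<gamma> l t = (distr (arc_measure \<gamma> l t) borel uminus \<star> arc_measure \<gamma> l t)"

lemma bprob_arc_difference: "0 < l \<Longrightarrow> \<gamma> \<in> borel_measurable borel \<Longrightarrow> bprob (arc_difference \<gamma> l t)"
  unfolding arc_difference_def by (intro bprob_conv bprob_refl bprob_arc_measure)

lemma integral_arc_difference:
  fixes f :: "plane \<Rightarrow> real"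
  assumes "0 < l" and [measurable]: "\<gamma> \<in> borel_measurable borel" "f \<in> borel_measurable borel" and "\<And>x. \<bar>f x\<bar> \<le> C"
  shows "(\<integral>u. f u \<partial>arc_difference \<gamma> l t) = (\<integral>s. \<integral>s'. f (t *\<^sub>R (\<gamma> s' - \<gamma> s)) \<partial>unif_interval l \<partial>unif_interval l)"
proof -
  note [measurable_cong] = prob_unif_interval(2)[OF assms(1)]
  interpret prob_space "unif_interval l" by (rule prob_unif_interval[OF assms(1)])
  note p = bprob_arc_measure[OF assms(1,2), of t]
  have m: "(\<lambda>u. \<integral>v. f (- u + v) \<partial>arc_measure \<gamma> l t) \<in> borel_measurable borel"
    "(\<lambda>u. \<integral>v. f (u + v) \<partial>arc_measure \<gamma> l t) \<in> borel_measurable borel"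
    by (rule bprob_integral_measurable[OF p], measurable)+
  have "(\<integral>u. f u \<partial>arc_difference \<gamma> l t) = (\<integral>u. \<integral>v. f (u + v) \<partial>arc_measure \<gamma> l t \<partial>distr (arc_measure \<gamma> l t) borel uminus)"
    unfolding arc_difference_def by (rule integral_conv[OF bprob_refl[OF p] p assms(3,4)])
  also have "\<dots> = (\<integral>u. \<integral>v. f (- u + v) \<partial>arc_measure \<gamma> l t \<partial>arc_measure \<gamma> l t)"
    by (rule integral_refl[OF p m(2)])
  also have "\<dots> = (\<integral>s. \<integral>v. f (- (t *\<^sub>R \<gamma> s) + v) \<partial>arc_measure \<gamma> l t \<partial>unif_interval l)"
    by (rule integral_arc_measure[OF assms(1,2) m(1)])
  also have "\<dots> = (\<integral>s. \<integral>s'. f (- (t *\<^sub>R \<gamma> s) + t *\<^sub>R \<gamma> s') \<partial>unif_interval l \<partial>unif_interval l)"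
    by (intro Bochner_Integration.integral_cong refl integral_arc_measure[OF assms(1,2)]) measurable
  finally show ?thesis by (simp add: scaleR_diff_right)
qed

text \<open>Dilation reduces every \<open>t\<close> to 1, which makes the mollification parameter in
  \<open>arc_smoothing\<close> independent of the scale.\<close>

lemma arc_difference_scale:
  fixes f :: "plane \<Rightarrow> real"
  assumes "0 < l" and [measurable]: "\<gamma> \<in> borel_measurable borel" "f \<in> borel_measurable borel" and "\<And>x. \<bar>f x\<bar> \<le> C"
  shows "(\<integral>u. f u \<partial>arc_difference \<gamma> l t) = (\<integral>u. f (t *\<^sub>R u) \<partial>arc_difference \<gamma> l 1)"
  unfolding integral_arc_difference[OF assms]
  by (subst integral_arc_difference[OF assms(1,2), where C=C]) (use assms(4) in auto)

lemma cross2_inj: assumes "cross2 a b \<noteq> 0" shows "inj (\<lambda>q :: plane. q $ 2 *\<^sub>R b - q $ 1 *\<^sub>R a)"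
proof -
  have lin: "linear (\<lambda>q :: plane. q $ 2 *\<^sub>R b - q $ 1 *\<^sub>R a)"
    by (rule linearI) (auto simp: algebra_simps)
  show ?thesis unfolding linear_injective_0[OF lin]
  proof (intro allI impI)
    fix q :: plane assume q: "q $ 2 *\<^sub>R b - q $ 1 *\<^sub>R a = 0"
    have c: "q $ 2 * b $ 1 = q $ 1 * a $ 1" "q $ 2 * b $ 2 = q $ 1 * a $ 2"
      using arg_cong[OF q, of "\<lambda>v. v $ 1"] arg_cong[OF q, of "\<lambda>v. v $ 2"] by simp_all
    have "q $ 2 * cross2 a b = 0" "q $ 1 * cross2 a b = 0" unfolding cross2_def using c by algebra+
    then show "q = 0" using assms by (simp add: vec_eq_iff forall_2)
  qed
qed

text \<open>The map from \<open>(s, s')\<close> to \<open>\<gamma> s' - \<gamma> s\<close> has the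
  Jacobian \<open>cross2 (\<gamma>' s) (\<gamma>' s')\<close> up to sign, nonzero off the diagonal.
  Preimages of null sets under a differentiable map with injective derivative are null, and so is
  the diagonal; Fubini then gives null probability for two independent parameters.\<close>

lemma arc_difference_ac:
  assumes l: "0 < l" and d: "\<And>s. (\<gamma> has_vector_derivative \<gamma>' s) (at s)"
    and ne: "\<And>s s'. s \<in> {0..l} \<Longrightarrow> s' \<in> {0..l} \<Longrightarrow> s \<noteq> s' \<Longrightarrow> cross2 (\<gamma>' s) (\<gamma>' s') \<noteq> 0"
  shows "absolutely_continuous lborel (arc_difference \<gamma> l 1)"
proof -
  have cont: "continuous_on UNIV \<gamma>"
    by (auto intro!: continuous_at_imp_continuous_on has_vector_derivative_continuous[OF d])
  then have [measurable]: "\<gamma> \<in> borel_measurable borel" by (rule borel_measurable_continuous_onI)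
  note [measurable_cong] = prob_unif_interval(2)[OF l]
  interpret prob_space "unif_interval l" by (rule prob_unif_interval[OF l])
  show ?thesis unfolding absolutely_continuous_def
  proof
    fix N assume N: "N \<in> null_sets (lborel :: plane measure)"
    then have [measurable]: "N \<in> sets borel" by auto
    have negN: "negligible N" using N by (simp add: negligible_iff_null_sets null_sets_completionI)
    let ?\<Phi> = "\<lambda>p :: plane. \<gamma> (p $ 2) - \<gamma> (p $ 1)"
    let ?S = "{p :: plane. p $ 1 \<in> {0..l} \<and> p $ 2 \<in> {0..l} \<and> p $ 1 \<noteq> p $ 2}"
    have "negligible {p \<in> ?S. ?\<Phi> p \<in> N}"
    proof (rule negligible_differentiable_vimage[OF negN, where f' = "\<lambda>p q. q $ 2 *\<^sub>R \<gamma>' (p $ 2) - q $ 1 *\<^sub>R \<gamma>' (p $ 1)"])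
      fix p assume p: "p \<in> ?S"
      show "inj (\<lambda>q :: plane. q $ 2 *\<^sub>R \<gamma>' (p $ 2) - q $ 1 *\<^sub>R \<gamma>' (p $ 1))"
        by (rule cross2_inj) (use p ne in auto)
      have g: "(\<gamma> has_derivative (\<lambda>h. h *\<^sub>R \<gamma>' s)) (at s)" for s using d by (simp add: has_vector_derivative_def)
      have c: "((\<lambda>p :: plane. \<gamma> (p $ i)) has_derivative (\<lambda>q. q $ i *\<^sub>R \<gamma>' (p $ i))) (at p)" for i
        by (rule has_derivative_compose[of "\<lambda>p. p $ i" "\<lambda>q. q $ i" p UNIV \<gamma> "\<lambda>h. h *\<^sub>R \<gamma>' (p $ i)", OF bounded_linear_imp_has_derivative[OF bounded_linear_vec_nth] g])
      show "(?\<Phi> has_derivative (\<lambda>q. q $ 2 *\<^sub>R \<gamma>' (p $ 2) - q $ 1 *\<^sub>R \<gamma>' (p $ 1))) (at p within ?S)"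
        by (rule has_derivative_at_withinI[OF has_derivative_diff[OF c[of 2] c[of 1]]])
    qed
    \<comment> \<open>The diagonal, where the derivative is not injective, written as a line through
      the origin.\<close>
    moreover have "negligible {p :: plane. (axis 1 1 - axis 2 1) \<bullet> p = 0}"
      by (rule negligible_hyperplane) (auto simp: vec_eq_iff forall_2 axis_def)
    ultimately have "negligible ({p \<in> ?S. ?\<Phi> p \<in> N} \<union> {p. (axis 1 1 - axis 2 1) \<bullet> p = 0})" by (rule negligible_Un)
    then have "negligible {p. p $ 1 \<in> {0..l} \<and> p $ 2 \<in> {0..l} \<and> ?\<Phi> p \<in> N}"
      by (rule negligible_subset) (auto simp: inner_diff_left inner_axis')
    moreover have [measurable]: "(\<lambda>p :: plane. p $ i) \<in> borel_measurable borel" for i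
      by (intro borel_measurable_continuous_onI continuous_intros)
    have "{p. p $ 1 \<in> {0..l} \<and> p $ 2 \<in> {0..l} \<and> ?\<Phi> p \<in> N} \<in> sets borel" by measurable
    ultimately have "{p. p $ 1 \<in> {0..l} \<and> p $ 2 \<in> {0..l} \<and> ?\<Phi> p \<in> N} \<in> null_sets lborel"
      by (simp add: negligible_iff_null_sets null_sets_completion_iff)
    then have "AE p in lborel. \<not> (p $ 1 \<in> {0..l} \<and> p $ 2 \<in> {0..l} \<and> ?\<Phi> p \<in> N)"
      by (rule AE_I') auto
    then have ae: "AE p in (lborel :: plane measure). (\<lambda>(s, s'). \<not> (s \<in> {0..l} \<and> s' \<in> {0..l} \<and> \<gamma> s' - \<gamma> s \<in> N)) (p $ 1, p $ 2 :: real)" by simp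
    define Q where "Q = (\<lambda>(s, s'). \<not> (s \<in> {0..l} \<and> s' \<in> {0..l} \<and> \<gamma> s' - \<gamma> s \<in> N))"
    have m1: "(\<lambda>p :: plane. (p $ 1, p $ 2)) \<in> lborel \<rightarrow>\<^sub>M borel"
      by (simp add: borel_measurable_continuous_onI continuous_intros)
    have "{z \<in> space (borel \<Otimes>\<^sub>M borel). Q z} \<in> sets (borel \<Otimes>\<^sub>M borel)" unfolding Q_def by measurable
    then have m2: "{z \<in> space borel. Q z} \<in> sets borel" unfolding borel_prod .
    have "AE z in distr (lborel :: plane measure) borel (\<lambda>p. (p $ 1, p $ 2)). Q z"
      unfolding AE_distr_iff[OF m1 m2] using ae by (simp add: Q_def)
    then have "AE z in lborel \<Otimes>\<^sub>M lborel. Q z"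
      unfolding distr_lborel_vec2 lborel_prod .
    from lborel_pair.AE_pair[OF this[unfolded Q_def]] have "AE s in lborel. AE s' in lborel. \<not> (s \<in> {0..l} \<and> s' \<in> {0..l} \<and> \<gamma> s' - \<gamma> s \<in> N)" by simp
    then have ae2: "AE s in unif_interval l. AE s' in unif_interval l. \<gamma> s' - \<gamma> s \<notin> N"
      unfolding unif_interval_def using l by (auto simp: AE_uniform_measure elim!: eventually_mono)
    have "emeasure (arc_difference \<gamma> l 1) N = ennreal (\<integral>u. indicator N u \<partial>arc_difference \<gamma> l 1)"
    proof -
      interpret R: prob_space "arc_difference \<gamma> l 1" using bprobD(1)[OF bprob_arc_difference[OF l]] by simp
      have "N \<in> sets (arc_difference \<gamma> l 1)" using bprobD(2)[OF bprob_arc_difference[OF l], of \<gamma> 1] by simp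
      then show ?thesis by (simp add: R.emeasure_eq_measure)
    qed
    also have "(\<integral>u. indicator N u \<partial>arc_difference \<gamma> l 1) = (\<integral>s. \<integral>s'. indicat_real N (\<gamma> s' - \<gamma> s) \<partial>unif_interval l \<partial>unif_interval l)"
      by (subst integral_arc_difference[OF l, where C=1]) (auto simp: indicator_def)
    also have "\<dots> = (\<integral>s. 0 \<partial>unif_interval l)"
    proof (rule integral_cong_AE)
      show "AE s in unif_interval l. (\<integral>s'. indicat_real N (\<gamma> s' - \<gamma> s) \<partial>unif_interval l) = 0"
        using ae2
      proof eventually_elim
        case (elim s)
        have "(\<integral>s'. indicat_real N (\<gamma> s' - \<gamma> s) \<partial>unif_interval l) = (\<integral>s'. 0 \<partial>unif_interval l)"
          by (rule integral_cong_AE) (use elim in \<open>auto elim: eventually_mono\<close>)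
        then show ?case by simp
      qed
    qed simp_all
    finally have "emeasure (arc_difference \<gamma> l 1) N = 0" by simp
    then show "N \<in> null_sets (arc_difference \<gamma> l 1)"
      using bprobD(2)[OF bprob_arc_difference[OF l], of \<gamma> 1] by (auto simp: null_sets_def)
  qed
qed

lemma usq_scale:
  fixes f :: "plane \<Rightarrow> real"
  assumes "0 < t" "0 < r" and [measurable]: "f \<in> borel_measurable borel"
  shows "(\<integral>w. f w \<partial>usq (r * t)) = (\<integral>w. f (t *\<^sub>R w) \<partial>usq r)"
proof -
  have [measurable]: "(\<lambda>w :: plane. t *\<^sub>R w) \<in> borel_measurable borel" by measurable
  have "lborel = density (distr lborel borel (\<lambda>x :: plane. 0 + t *\<^sub>R x)) (\<lambda>_. \<bar>t\<bar> ^ DIM(plane))"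
    by (rule lborel_affine) (use assms in simp)
  then have e: "(lborel :: plane measure) = density (distr lborel borel (\<lambda>x :: plane. t *\<^sub>R x)) (\<lambda>_. ennreal (t\<^sup>2))"
    using assms(1) by (simp add: ennreal_power)
  have "(LBINT u. indicator (sq (r * t)) u * f u) = (LBINT u. t\<^sup>2 * (indicator (sq (r * t)) (t *\<^sub>R u) * f (t *\<^sub>R u)))"
    by (subst e, subst integral_density) (auto simp: integral_distr)
  also have "\<dots> = t\<^sup>2 * (LBINT u. indicator (sq r) u * f (t *\<^sub>R u))"
    using assms by (auto intro!: Bochner_Integration.integral_cong simp: indicator_def sq_def abs_mult mult.commute)
  finally show ?thesis
    using assms by (subst (1 2) integral_usq) (auto simp: power_mult_distrib)
qed

text \<open>Let \<open>F\<close> be \<open>G\<close> minus its average over the small square. The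
  square norm of the arc average of \<open>F\<close> is the inner product of \<open>F\<close> with
  its average over \<open>arc_difference\<close>; the latter is at most \<open>\<eta>\<close>
  everywhere, and \<open>\<bar>F\<bar>\<close> has integral at most \<open>2 * V\<close>.\<close>

lemma arc_smoothing:
  assumes l: "0 < l" and d: "\<And>s. (\<gamma> has_vector_derivative \<gamma>' s) (at s)"
    and ne: "\<And>s s'. s \<in> {0..l} \<Longrightarrow> s' \<in> {0..l} \<Longrightarrow> s \<noteq> s' \<Longrightarrow> cross2 (\<gamma>' s) (\<gamma>' s') \<noteq> 0" and "0 < \<eta>"
  obtains \<epsilon> where "0 < \<epsilon>" "\<epsilon> \<le> 1"
    "\<And>t V G. 0 < t \<Longrightarrow> unit_fn V G \<Longrightarrow> (LBINT y. (avg (arc_measure \<gamma> l t) G y - avg (arc_measure \<gamma> l t \<star> usq (\<epsilon> * t)) G y)\<^sup>2) \<le> 2 * \<eta> * V"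
proof -
  have cont: "continuous_on UNIV \<gamma>"
    by (auto intro!: continuous_at_imp_continuous_on has_vector_derivative_continuous[OF d])
  then have mg [measurable]: "\<gamma> \<in> borel_measurable borel" by (rule borel_measurable_continuous_onI)
  obtain \<epsilon> where \<epsilon>: "0 < \<epsilon>" "\<epsilon> \<le> 1" "\<And>f. f \<in> borel_measurable borel \<Longrightarrow> (\<And>x. \<bar>f x\<bar> \<le> 1) \<Longrightarrow>
     \<bar>(\<integral>u. f u \<partial>arc_difference \<gamma> l 1) - (\<integral>u. (\<integral>w. f (u + w) \<partial>usq \<epsilon>) \<partial>arc_difference \<gamma> l 1)\<bar> \<le> \<eta>"
    by (rule absolutely_continuous_box_close[OF bprob_arc_difference[OF l mg] arc_difference_ac[OF l d ne] assms(4)]) blast+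
  show ?thesis
  proof (rule that[OF \<epsilon>(1,2)])
    fix t V G assume t: "0 < (t :: real)" and G: "unit_fn V G"
    let ?\<sigma> = "arc_measure \<gamma> l t" and ?usq = "usq (\<epsilon> * t)"
    note p = bprob_arc_measure[OF l mg, of t]
    have pU: "bprob ?usq" by (rule bprob_usq) (use \<epsilon> t in simp)
    note pd = bprob_arc_difference[OF l mg, of t]
    note [measurable] = unit_fnD(1)[OF G]
    define F where "F = (\<lambda>y. G y - avg ?usq G y)"
    have nG: "nice_fn G" "nice_fn (avg ?usq G)" by (rule unit_fnD(7)[OF G], rule nice_fn_avg[OF pU unit_fnD(7)[OF G]])
    have nF: "nice_fn F" unfolding F_def by (rule nice_fn_diff[OF nG])
    have aF: "avg ?\<sigma> F y = avg ?\<sigma> G y - avg (?\<sigma> \<star> ?usq) G y" for y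
      unfolding F_def avg_diff[OF p nG] avg_conv[OF p pU unit_fnD(1)[OF G] unit_fnD(4)[OF G]] ..
    obtain C where C: "\<And>x. \<bar>F x\<bar> \<le> C" using nF nice_fn_bdE by blast
    have small: "\<bar>avg (arc_difference \<gamma> l t) F y\<bar> \<le> \<eta>" for y
    proof -
      have "avg (arc_difference \<gamma> l t) F y = avg (arc_difference \<gamma> l t) G y - avg (arc_difference \<gamma> l t) (avg ?usq G) y"
        unfolding F_def by (rule avg_diff[OF pd nG])
      also have "avg (arc_difference \<gamma> l t) G y = (\<integral>u. G (y + t *\<^sub>R u) \<partial>arc_difference \<gamma> l 1)"
        unfolding avg_def by (rule arc_difference_scale[OF l mg, where C=1]) (use unit_fnD(4)[OF G] in auto)
      also have "avg (arc_difference \<gamma> l t) (avg ?usq G) y = (\<integral>u. avg ?usq G (y + t *\<^sub>R u) \<partial>arc_difference \<gamma> l 1)"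
        unfolding avg_def[of "arc_difference \<gamma> l t"] by (rule arc_difference_scale[OF l mg, where C=1])
          (use avg_bound[OF pU unit_fnD(1)[OF G] unit_fnD(4)[OF G]] nice_fnD(1)[OF nG(2)] in auto)
      also have "\<dots> = (\<integral>u. (\<integral>w. G (y + t *\<^sub>R (u + w)) \<partial>usq \<epsilon>) \<partial>arc_difference \<gamma> l 1)"
      proof (rule Bochner_Integration.integral_cong[OF refl])
        fix u
        have "avg ?usq G (y + t *\<^sub>R u) = (\<integral>w. G (y + t *\<^sub>R u + t *\<^sub>R w) \<partial>usq \<epsilon>)"
          unfolding avg_def by (rule usq_scale) (use t \<epsilon> in auto)
        then show "avg ?usq G (y + t *\<^sub>R u) = (\<integral>w. G (y + t *\<^sub>R (u + w)) \<partial>usq \<epsilon>)" by (simp add: scaleR_add_right add.assoc)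
      qed
      finally show ?thesis using \<epsilon>(3)[of "\<lambda>u. G (y + t *\<^sub>R u)"] unit_fnD(4)[OF G] by simp
    qed
    have "(LBINT y. (avg ?\<sigma> F y)\<^sup>2) = (LBINT y. F y * avg (distr ?\<sigma> borel uminus) (avg ?\<sigma> F) y)"
      using adjoint_refl[OF p nF nice_fn_avg[OF p nF]] by (simp add: power2_eq_square)
    also have "avg (distr ?\<sigma> borel uminus) (avg ?\<sigma> F) = avg (arc_difference \<gamma> l t) F"
      unfolding arc_difference_def by (rule avg_conv[OF bprob_refl[OF p] p nice_fnD(1)[OF nF] C, symmetric])
    also have "(LBINT y. F y * avg (arc_difference \<gamma> l t) F y) \<le> (LBINT y. \<eta> * (G y + avg ?usq G y))"
    proof (rule integral_mono)
      fix y
      have "F y * avg (arc_difference \<gamma> l t) F y \<le> \<bar>F y\<bar> * \<bar>avg (arc_difference \<gamma> l t) F y\<bar>" by (metis abs_ge_self abs_mult)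
      also have "\<dots> \<le> (G y + avg ?usq G y) * \<eta>"
        using small unit_fnD(2)[OF G, of y] unit_fnD(2)[OF unit_fn_avg[OF pU G], of y] by (intro mult_mono) (auto simp: F_def)
      finally show "F y * avg (arc_difference \<gamma> l t) F y \<le> \<eta> * (G y + avg ?usq G y)" by (simp add: mult.commute)
    qed (use nice_fnD(2)[OF nice_fn_mult[OF nF nice_fn_avg[OF pd nF]]] nice_fnD(2)[OF nG(1)] nice_fnD(2)[OF nG(2)] in auto)
    also have "\<dots> = \<eta> * ((LBINT y. G y) + (LBINT y. avg ?usq G y))" using nice_fnD(2)[OF nG(1)] nice_fnD(2)[OF nG(2)] by simp
    also have "\<dots> \<le> \<eta> * (V + V)"
      using assms(4) unit_fnD(6)[OF G] unit_fnD(6)[OF unit_fn_avg[OF pU G]] by (intro mult_left_mono) auto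
    finally show "(LBINT y. (avg ?\<sigma> G y - avg (?\<sigma> \<star> ?usq) G y)\<^sup>2) \<le> 2 * \<eta> * V" unfolding aF by simp
  qed
qed

section \<open>Comparison of the arc with the square at a good scale\<close>

lemma avg_ge_supp_in:
  assumes "bprob m" "supp_in m s" "g \<in> borel_measurable borel" "\<And>x. \<bar>g x\<bar> \<le> C" "\<And>u. u \<in> sq s \<Longrightarrow> L \<le> g (z + u)"
  shows "L \<le> avg m g z"
proof -
  interpret prob_space m using bprobD[OF assms(1)] by simp
  note [measurable] = assms(3)
  have "(\<integral>u. L \<partial>m) \<le> (\<integral>u. g (z + u) \<partial>m)"
  proof (rule integral_mono_AE)
    show "integrable m (\<lambda>u. g (z + u))" by (rule bprob_integrable[OF assms(1) _ assms(4)]) measurable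
    show "AE u in m. L \<le> g (z + u)" using assms(2,5) unfolding supp_in_def by (auto elim: eventually_mono)
  qed simp
  then show ?thesis unfolding bprob_const[OF assms(1)] avg_def .
qed

text \<open>On \<open>sq (r / 2)\<close> the doubled convolution has at least a sixteenth of the
  density \<open>1 / (4 * r\<^sup>2)\<close>. A square of half-side \<open>r\<close> centred in
  \<open>sq (r / 2)\<close> covers all of \<open>sq (r / 2)\<close>; shifts by \<open>m\<close> move
  centres in \<open>sq (r / 4)\<close> no further than \<open>sq (r / 2)\<close>; the other square
  loses the factor 16.\<close>

lemma box_convolution_lower:
  fixes f :: "plane \<Rightarrow> real"
  assumes m: "bprob m" "supp_in m (r / 4)" and r: "0 < r" and f: "f \<in> borel_measurable borel" "\<And>x. 0 \<le> f x" "\<And>x. f x \<le> C"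
  shows "(LBINT u. indicator (sq (r / 2)) u * f u) / (4 * r\<^sup>2) \<le> 16 * (\<integral>u. f u \<partial>((m \<star> usq r) \<star> (m \<star> usq r)))"
proof -
  note [measurable] = f(1)
  note pU = bprob_usq[OF r]
  define L where "L = (LBINT u. indicator (sq (r / 2)) u * f u) / (4 * r\<^sup>2)"
  have C: "0 \<le> C" using f(2,3)[of 0] by linarith
  have fb: "\<bar>f x\<bar> \<le> C" for x using f(2,3)[of x] by simp
  have L0: "0 \<le> L" unfolding L_def by (intro divide_nonneg_nonneg Bochner_Integration.integral_nonneg) (use f in auto)
  have i: "integrable lborel (\<lambda>u. indicator (sq s) (u + z) * f (u + w))" for s z w
  proof (rule Bochner_Integration.integrable_bound[of _ "\<lambda>u. C * indicator (sq s) (u + z)"])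
    show "integrable lborel (\<lambda>u. C * indicat_real (sq s) (u + z))"
      using lborel_shift(2)[of "indicat_real (sq s)" z] integral_sq(2) by simp
  qed (use fb C in \<open>auto simp: indicator_def\<close>)
  have g1: "L \<le> avg (usq r) f z" if "z \<in> sq (r / 2)" for z
  proof -
    have "(LBINT u. indicator (sq (r / 2)) u * f u) = (LBINT u. (\<lambda>u. indicator (sq (r / 2)) u * f u) (u + z))"
      by (rule lborel_shift(1)[symmetric]) measurable
    also have "\<dots> \<le> (LBINT u. indicator (sq r) u * f (z + u))"
    proof (rule integral_mono)
      fix u
      have "u \<in> sq r" if "u + z \<in> sq (r / 2)"
        using sq_add[OF that, of "- z" "r / 2"] \<open>z \<in> sq (r / 2)\<close> by (simp add: sq_uminus)
      then show "indicator (sq (r / 2)) (u + z) * f (u + z) \<le> indicator (sq r) u * f (z + u)"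
        using f(2) by (auto simp: indicator_def add.commute)
    qed (use i[of "r/2" z z] i[of r 0 z] in \<open>auto simp: add.commute\<close>)
    finally show ?thesis unfolding L_def avg_def by (subst integral_usq[OF r]) (auto intro: divide_right_mono)
  qed
  have m1: "avg (usq r) f \<in> borel_measurable borel" "\<bar>avg (usq r) f x\<bar> \<le> C" for x
    by (rule avg_measurable[OF pU f(1)], rule avg_bound[OF pU f(1) fb])
  have g2: "L \<le> avg m (avg (usq r) f) z" if "z \<in> sq (r / 4)" for z
    by (rule avg_ge_supp_in[OF m m1], rule g1) (use sq_add[OF that] in fastforce)
  define g where "g = avg m (avg (usq r) f)"
  have m2: "g \<in> borel_measurable borel" "\<bar>g x\<bar> \<le> C" for x
    unfolding g_def by (rule avg_measurable[OF m(1) m1(1)], rule avg_bound[OF m(1) m1])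
  note [measurable] = m2(1)
  have g0: "0 \<le> g x" for x unfolding g_def
    using avg_le(1)[OF m(1) m1(1), of 0 C] avg_le[OF pU f(1,2,3)] by blast
  have ig: "integrable lborel (\<lambda>u. indicator (sq s) u * g (u + w))" for s w
    by (rule Bochner_Integration.integrable_bound[OF integrable_mult_right[OF integral_sq(2), of C]]) (use m2 C in \<open>auto simp: indicator_def\<close>)
  \<comment> \<open>The part \<open>sq (r / 4)\<close> of the square around \<open>z\<close> has one
    sixteenth of its area, and there \<open>g\<close> is at least \<open>L\<close> by
    \<open>g2\<close>; elsewhere \<open>g\<close> is nonnegative.\<close>
  have g3: "L / 16 \<le> avg (usq r) g z" if "z \<in> sq (r / 4)" for z
  proof -
    have "L * (4 * (r / 4)\<^sup>2) = (LBINT u. L * indicat_real (sq (r / 4)) (u + z))"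
      using lborel_shift(1)[of "indicat_real (sq (r / 4))" z] integral_sq(1)[of "r / 4"] r by simp
    also have "\<dots> \<le> (LBINT u. indicator (sq r) u * g (z + u))"
    proof (rule integral_mono)
      fix u
      have "u \<in> sq r" if "u + z \<in> sq (r / 4)"
        using sq_add[OF that, of "- z" "r / 4"] \<open>z \<in> sq (r / 4)\<close> r sq_mono[of "r/4 + r/4" r u] by (simp add: sq_uminus)
      then show "L * indicat_real (sq (r / 4)) (u + z) \<le> indicator (sq r) u * g (z + u)"
        using g2[of "u + z"] g0 by (auto simp: indicator_def add.commute g_def)
    qed (use ig[of r z] lborel_shift(2)[of "indicat_real (sq (r / 4))" z] integral_sq(2) in \<open>auto simp: add.commute\<close>)
    finally have "(L * (4 * (r / 4)\<^sup>2)) / (4 * r\<^sup>2) \<le> (LBINT u. indicator (sq r) u * g (z + u)) / (4 * r\<^sup>2)"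
      by (rule divide_right_mono) simp
    moreover have "(L * (4 * (r / 4)\<^sup>2)) / (4 * r\<^sup>2) = L / 16" using r by (simp add: power2_eq_square)
    ultimately show ?thesis unfolding avg_def by (subst integral_usq[OF r]) auto
  qed
  have m3: "avg (usq r) g \<in> borel_measurable borel" "\<bar>avg (usq r) g x\<bar> \<le> C" for x
    by (rule avg_measurable[OF pU m2(1)], rule avg_bound[OF pU m2])
  have "L / 16 \<le> avg m (avg (usq r) g) 0"
    by (rule avg_ge_supp_in[OF m m3]) (use g3 in simp)
  also have "avg m (avg (usq r) g) = avg ((m \<star> usq r) \<star> (m \<star> usq r)) f"
    unfolding avg_conv[OF bprob_conv[OF m(1) pU] bprob_conv[OF m(1) pU] f(1) fb] avg_conv[OF m(1) pU f(1) fb]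
      g_def[symmetric] avg_conv[OF m(1) pU m2] ..
  finally show ?thesis unfolding L_def[symmetric] by (simp add: avg_def)
qed

lemma integral_usq_le:
  fixes f :: "plane \<Rightarrow> real"
  assumes "0 < s" "u \<in> sq (q - s)" "f \<in> borel_measurable borel" "\<And>x. 0 \<le> f x" "\<And>x. f x \<le> C"
  shows "(\<integral>w. f (u + w) \<partial>usq s) \<le> (LBINT w. indicator (sq q) w * f w) / (4 * s\<^sup>2)"
proof -
  note [measurable] = assms(3)
  have C: "0 \<le> C" using assms(4,5)[of 0] by linarith
  have fb: "\<bar>f x\<bar> \<le> C" for x using assms(4,5)[of x] by simp
  have i: "integrable lborel (\<lambda>w. indicator (sq p) w * f (w + z))" for p z
    by (rule Bochner_Integration.integrable_bound[OF integrable_mult_right[OF integral_sq(2), of C]]) (use fb C in \<open>auto simp: indicator_def\<close>)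
  have i2: "integrable lborel (\<lambda>w. indicator (sq q) (w + u) * f (w + u))"
    using lborel_shift(2)[of "\<lambda>w. indicator (sq q) w * f w" u] i[of q 0] by simp
  have "(LBINT w. indicator (sq s) w * f (u + w)) \<le> (LBINT w. (\<lambda>w. indicator (sq q) w * f w) (w + u))"
  proof (rule integral_mono)
    fix w
    have "w + u \<in> sq q" if "w \<in> sq s" using sq_add[OF that assms(2)] by simp
    then show "indicator (sq s) w * f (u + w) \<le> indicator (sq q) (w + u) * f (w + u)"
      using assms(4) by (auto simp: indicator_def add.commute)
  qed (use i[of s u] i2 in \<open>auto simp: add.commute\<close>)
  also have "\<dots> = (LBINT w. indicator (sq q) w * f w)" by (rule lborel_shift(1)) measurable
  finally show ?thesis by (subst integral_usq[OF assms(1)]) (auto intro: divide_right_mono)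
qed

text \<open>The mollified measure has density at most \<open>1 / (4 * s\<^sup>2)\<close> and lives
  on \<open>sq (r / 2)\<close>; the constant is the ratio of this bound to the lower density in
  \<open>box_convolution_lower\<close>.\<close>

lemma dominated_box:
  assumes m: "bprob m" "supp_in m (r / 4)" and r: "0 < r" and s: "0 < s" 
    and \<sigma>: "bprob \<sigma>" "supp_in \<sigma> (r / 2 - s)"
  shows "dominated (16 * (r / s)\<^sup>2) (\<sigma> \<star> usq s) ((m \<star> usq r) \<star> (m \<star> usq r))"
  unfolding dominated_def
proof (intro allI impI)
  fix f :: "plane \<Rightarrow> real" and C assume f: "f \<in> borel_measurable borel" and "\<forall>x. 0 \<le> f x \<and> f x \<le> C"
  then have f': "\<And>x. 0 \<le> f x" "\<And>x. f x \<le> C" "\<And>x. \<bar>f x\<bar> \<le> C" by auto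
  note [measurable] = f
  interpret prob_space \<sigma> using bprobD[OF \<sigma>(1)] by simp
  let ?I = "LBINT w. indicator (sq (r / 2)) w * f w"
  have "(\<integral>x. f x \<partial>(\<sigma> \<star> usq s)) = (\<integral>u. \<integral>v. f (u + v) \<partial>usq s \<partial>\<sigma>)"
    by (rule integral_conv[OF \<sigma>(1) bprob_usq[OF s] f f'(3)])
  also have "\<dots> \<le> (\<integral>u. ?I / (4 * s\<^sup>2) \<partial>\<sigma>)"
  proof (rule integral_mono_AE)
    show "integrable \<sigma> (\<lambda>u. \<integral>v. f (u + v) \<partial>usq s)"
    proof (rule bprob_integrable[OF \<sigma>(1)])
      show "(\<lambda>u. \<integral>v. f (u + v) \<partial>usq s) \<in> borel_measurable borel"
        by (rule bprob_integral_measurable[OF bprob_usq[OF s]]) measurable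
      show "\<bar>\<integral>v. f (x + v) \<partial>usq s\<bar> \<le> C" for x by (rule bprob_integral_bound[OF bprob_usq[OF s]]) (use f'(3) in auto)
    qed
    show "AE u in \<sigma>. (\<integral>v. f (u + v) \<partial>usq s) \<le> ?I / (4 * s\<^sup>2)"
      using \<sigma>(2) unfolding supp_in_def by eventually_elim (rule integral_usq_le[OF s _ f f'(1,2)])
  qed simp
  also have "\<dots> = ?I / (4 * s\<^sup>2)" by (rule bprob_const[OF \<sigma>(1)])
  also have "\<dots> = (r / s)\<^sup>2 * (?I / (4 * r\<^sup>2))" using r s by (simp add: power_divide)
  also have "\<dots> \<le> (r / s)\<^sup>2 * (16 * (\<integral>u. f u \<partial>((m \<star> usq r) \<star> (m \<star> usq r))))"
    by (intro mult_left_mono box_convolution_lower[OF m r f f'(1,2)]) simp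
  finally show "(\<integral>x. f x \<partial>(\<sigma> \<star> usq s)) \<le> 16 * (r / s)\<^sup>2 * (\<integral>u. f u \<partial>((m \<star> usq r) \<star> (m \<star> usq r)))" by simp
qed

lemma bprob_return: "bprob (return borel (0 :: plane))" by (simp add: bprob_def prob_space_return)

lemma return_conv: assumes "bprob \<mu>" shows "(return borel 0 \<star> \<mu>) = \<mu>"
proof (rule measure_eqI)
  show "sets (return borel 0 \<star> \<mu>) = sets \<mu>" using bprobD(2)[OF assms] by simp
  fix A assume "A \<in> sets (return borel 0 \<star> \<mu>)"
  then have A: "A \<in> sets borel" by simp
  have "emeasure (return borel 0 \<star> \<mu>) A = (\<integral>\<^sup>+x. \<integral>\<^sup>+y. indicator A (x + y) \<partial>\<mu> \<partial>return borel 0)"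
    using convolution_emeasure'[OF A bprobD(4)[OF bprob_return] bprobD(4)[OF assms] bprobD(2)[OF assms] bprobD(2)[OF bprob_return]] .
  also have "\<dots> = (\<integral>\<^sup>+y. indicator A (0 + y) \<partial>\<mu>)"
  proof (rule nn_integral_return)
    note [measurable_cong] = bprobD(2)[OF assms]
    note [measurable] = A
    interpret prob_space \<mu> using bprobD[OF assms] by simp
    show "(\<lambda>x. \<integral>\<^sup>+y. indicator A (x + y) \<partial>\<mu>) \<in> borel_measurable borel" by measurable
  qed simp
  finally show "emeasure (return borel 0 \<star> \<mu>) A = emeasure \<mu> A"
    using A bprobD(2)[OF assms] by (simp add: nn_integral_indicator)
qed

lemma dominated_usq:
  assumes m: "bprob m" "supp_in m (r / 4)" and r: "0 < r" and s: "0 < s" "s \<le> r / 2"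
  shows "dominated (16 * (r / s)\<^sup>2) (usq s) ((m \<star> usq r) \<star> (m \<star> usq r))"
proof -
  have "supp_in (return borel 0) (r / 2 - s)"
    unfolding supp_in_def using s by (subst AE_return) (auto simp: sq_def pred_def)
  from dominated_box[OF m r s(1) bprob_return this] show ?thesis unfolding return_conv[OF bprob_usq[OF s(1)]] .
qed

lemma dominated_mono:
  assumes "dominated c \<mu> \<nu>" "c \<le> c'" shows "dominated c' \<mu> \<nu>"
  unfolding dominated_def
proof (intro allI impI)
  fix f :: "plane \<Rightarrow> real" and C assume f: "f \<in> borel_measurable borel" and "\<forall>x. 0 \<le> f x \<and> f x \<le> C"
  then have "(\<integral>x. f x \<partial>\<mu>) \<le> c * (\<integral>x. f x \<partial>\<nu>)" "0 \<le> (\<integral>x. f x \<partial>\<nu>)" using assms(1) unfolding dominated_def by auto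
  then show "(\<integral>x. f x \<partial>\<mu>) \<le> c' * (\<integral>x. f x \<partial>\<nu>)" using mult_right_mono[OF assms(2)] by fastforce
qed

lemma supp_in_arc_measure:
  assumes "0 < l" "\<gamma> \<in> borel_measurable borel" "\<And>\<theta>. \<gamma> \<theta> \<in> sq C" "0 \<le> t"
  shows "supp_in (arc_measure \<gamma> l t) (C * t)"
proof -
  note [measurable_cong] = prob_unif_interval(2)[OF assms(1)]
  note [measurable] = assms(2)
  have "t *\<^sub>R \<gamma> \<theta> \<in> sq (C * t)" for \<theta>
    using assms(3)[of \<theta>] assms(4) by (auto simp: sq_def abs_mult mult.commute[of C] intro: mult_left_mono)
  then show ?thesis unfolding supp_in_def arc_measure_def by (subst AE_distr_iff) auto
qed

lemma separated_usq:
  assumes "bprob m" "supp_in m \<rho>" "0 < s" "0 < r" "4 * \<rho> / s \<le> \<kappa>" "4 * s / r \<le> \<kappa>"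
  shows "separated \<kappa> m (usq s) (usq r)"
  unfolding separated_def
proof (intro allI impI conjI)
  fix f :: "plane \<Rightarrow> real" and y assume f: "f \<in> borel_measurable borel" and "\<forall>x. \<bar>f x\<bar> \<le> 1"
  then have f1: "\<And>x. \<bar>f x\<bar> \<le> 1" by auto
  note p = bprob_usq[OF assms(3)]
  have "\<bar>avg m (avg (usq s) f) y - avg (usq s) f y\<bar> \<le> 4 * \<rho> / s" by (rule avg_avg_usq_close[OF assms(1-3) f f1])
  then show "\<bar>avg (usq s) (avg m f) y - avg (usq s) f y\<bar> \<le> \<kappa>"
    unfolding avg_commute[OF p assms(1) f f1] using assms(5) by linarith
  have "\<bar>avg (usq s) (avg (usq r) f) y - avg (usq r) f y\<bar> \<le> 4 * s / r" by (rule avg_avg_usq_close[OF p supp_in_usq[OF assms(3)] assms(4) f f1])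
  then show "\<bar>avg (usq s) (avg (usq r) f) y - avg (usq r) f y\<bar> \<le> \<kappa>" using assms(6) by linarith
qed

text \<open>The square of size \<open>s\<close> alone makes averaging by \<open>m\<close> invisible;
  this fails for a bare measure on a curve and is the reason for mollifying the arc. The other half
  of the claim depends only on the size \<open>q + s\<close> of the support.\<close>

lemma separated_conv_usq:
  assumes "bprob m" "supp_in m \<rho>" "bprob \<sigma>" "supp_in \<sigma> q" "0 < s" "0 < r" "4 * \<rho> / s \<le> \<kappa>" "4 * (q + s) / r \<le> \<kappa>"
  shows "separated \<kappa> m (\<sigma> \<star> usq s) (usq r)"
  unfolding separated_def
proof (intro allI impI conjI)
  fix f :: "plane \<Rightarrow> real" and y assume f: "f \<in> borel_measurable borel" and "\<forall>x. \<bar>f x\<bar> \<le> 1"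
  then have f1: "\<And>x. \<bar>f x\<bar> \<le> 1" by auto
  note p = bprob_usq[OF assms(5)]
  interpret prob_space \<sigma> using bprobD[OF assms(3)] by simp
  let ?h = "avg (usq s) f"
  have h: "?h \<in> borel_measurable borel" "\<bar>?h x\<bar> \<le> 1" for x by (rule avg_measurable[OF p f], rule avg_bound[OF p f f1])
  have mh: "avg m ?h \<in> borel_measurable borel" "\<bar>avg m ?h x\<bar> \<le> 1" for x by (rule avg_measurable[OF assms(1) h(1)], rule avg_bound[OF assms(1) h])
  note [measurable] = h(1) mh(1)
  have i: "integrable \<sigma> (\<lambda>u. avg m ?h (y + u))" "integrable \<sigma> (\<lambda>u. ?h (y + u))"
    by (rule bprob_integrable[OF assms(3) _ mh(2)], measurable, rule bprob_integrable[OF assms(3) _ h(2)], measurable)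
  have mf: "avg m f \<in> borel_measurable borel" "\<bar>avg m f x\<bar> \<le> 1" for x by (rule avg_measurable[OF assms(1) f], rule avg_bound[OF assms(1) f f1])
  have e1: "avg (\<sigma> \<star> usq s) (avg m f) = avg \<sigma> (avg m ?h)"
    unfolding avg_conv[OF assms(3) p mf] avg_commute[OF p assms(1) f f1] ..
  have e2: "avg (\<sigma> \<star> usq s) f = avg \<sigma> ?h" by (rule avg_conv[OF assms(3) p f f1])
  have "avg \<sigma> (avg m ?h) y - avg \<sigma> ?h y = (\<integral>u. avg m ?h (y + u) - ?h (y + u) \<partial>\<sigma>)" unfolding avg_def[of \<sigma>] using i by simp
  also have "\<bar>\<dots>\<bar> \<le> (\<integral>u. \<bar>avg m ?h (y + u) - ?h (y + u)\<bar> \<partial>\<sigma>)" by (rule integral_abs_bound)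
  also have "\<dots> \<le> (\<integral>u. 4 * \<rho> / s \<partial>\<sigma>)"
    by (rule integral_mono) (use i avg_avg_usq_close[OF assms(1,2,5) f f1] in auto)
  also have "\<dots> = 4 * \<rho> / s" by (rule bprob_const[OF assms(3)])
  finally show "\<bar>avg (\<sigma> \<star> usq s) (avg m f) y - avg (\<sigma> \<star> usq s) f y\<bar> \<le> \<kappa>" unfolding e1 e2 using assms(7) by linarith
  have "\<bar>avg (\<sigma> \<star> usq s) (avg (usq r) f) y - avg (usq r) f y\<bar> \<le> 4 * (q + s) / r"
    by (rule avg_avg_usq_close[OF bprob_conv[OF assms(3) p] supp_in_conv[OF assms(3) p assms(4) supp_in_usq[OF assms(5)]] assms(6) f f1])
  then show "\<bar>avg (\<sigma> \<star> usq s) (avg (usq r) f) y - avg (usq r) f y\<bar> \<le> \<kappa>" using assms(8) by linarith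
qed

lemma config_avg_slow:
  assumes c: "unit_fn V c" "unit_fn V a" "unit_fn V f" "unit_fn V \<beta>" and p: "bprob \<mu>" "supp_in \<mu> \<rho>"
    and v: "\<And>x v. v \<in> sq \<rho> \<Longrightarrow> \<bar>\<beta> (x + v) - \<beta> x\<bar> \<le> \<kappa>"
    and "0 < \<delta>" and Z: "(LBINT y. (f y - \<beta> y)\<^sup>2) \<le> Z"
  shows "\<bar>config_avg c (\<lambda>x. a x * f x) c \<mu> \<mu> \<mu> - config_avg (\<lambda>x. c x * \<beta> x ^ 3) a c \<mu> \<mu> \<mu>\<bar> \<le> 3 * (\<delta> * V / 2 + Z / (2 * \<delta>)) + 3 * \<kappa> * V"
proof -
  have ca: "unit_fn V (\<lambda>x. a x * f x)" by (rule unit_fn_mult[OF c(2,3)])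
  have cg: "unit_fn V (\<lambda>x. c x * \<beta> x ^ 3)" unfolding power3_eq_cube by (intro unit_fn_mult[where W=V] c)
  have s: "(LBINT x. a x * \<bar>f x - \<beta> x\<bar>) \<le> \<delta> * V / 2 + Z / (2 * \<delta>)"
    by (rule inner_small(2)[OF c(2) nice_fn_diff[OF unit_fnD(7)[OF c(3)] unit_fnD(7)[OF c(4)]] assms(8) Z])
  show ?thesis unfolding config_avg_def
  proof (rule integral3_close_AE[OF p(1,1,1) p(2,2,2) config3_kernel3(1)[OF c(1) ca c(1)] config3_kernel3(1)[OF cg c(2,1)]])
    fix v1 v2 v3 assume "v1 \<in> sq \<rho>" "v2 \<in> sq \<rho>" "v3 \<in> sq \<rho>"
    then have "\<bar>\<beta> (x + v) - \<beta> x\<bar> \<le> \<kappa>" if "v \<in> {v1, v2, v3}" for x v using v that by auto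
    from config3_slow[OF c this] s
    show "\<bar>config3 c (\<lambda>x. a x * f x) c v1 v2 v3 - config3 (\<lambda>x. c x * \<beta> x ^ 3) a c v1 v2 v3\<bar> \<le> 3 * (\<delta> * V / 2 + Z / (2 * \<delta>)) + 3 * \<kappa> * V"
      by (smt (verit))
  qed
qed

text \<open>The integrals over \<open>s\<^sub>1, s\<^sub>2, s\<^sub>3\<close> factor and appear as the weights \<open>avg \<mu> c\<close>.\<close>
definition config_count where "config_count a c \<mu> = config_avg c (\<lambda>x. a x * avg \<mu> c x) c \<mu> \<mu> \<mu>"

section \<open>The estimate at one scale and the choice of a good scale\<close>

lemma lacunary_sum_le:
  fixes t :: "nat \<Rightarrow> real"
  assumes "\<And>k. \<Lambda> * t k \<le> t (Suc k)" "2 \<le> \<Lambda>" "0 < t 0"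
  shows "0 < t k" "(\<Sum>i<k. t i) \<le> 2 * t k / \<Lambda>"
proof -
  have pos: "0 < t k" for k
  proof (induction k)
    case (Suc k)
    then have "0 < \<Lambda> * t k" using assms(2) by simp
    then show ?case using assms(1)[of k] by linarith
  qed (rule assms(3))
  then show "0 < t k" .
  show "(\<Sum>i<k. t i) \<le> 2 * t k / \<Lambda>"
  proof (induction k)
    case 0 then show ?case using pos[of 0] assms(2) by simp
  next
    case (Suc k)
    have "2 * t k / \<Lambda> \<le> t k" using assms(2) pos[of k] by (simp add: field_simps)
    then have "(\<Sum>i<Suc k. t i) \<le> 2 * t k" using Suc by simp
    also have "2 * t k = 2 * (\<Lambda> * t k) / \<Lambda>" using assms(2) by simp
    also have "\<dots> \<le> 2 * t (Suc k) / \<Lambda>" using assms(1)[of k] assms(2) by (intro divide_right_mono) auto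
    finally show ?case .
  qed
qed

lemma supp_in_pconv:
  assumes "\<And>k. 0 < r k" shows "supp_in (pconv (\<lambda>k. usq (r k)) k) (\<Sum>i<k. r i)"
proof (induction k)
  case 0
  have "0 \<in> sq 0" by (simp add: sq_def)
  then show ?case unfolding supp_in_def pconv.simps by (subst AE_return) (auto simp: pred_def)
next
  case (Suc k)
  have "bprob (pconv (\<lambda>k. usq (r k)) k)" by (rule bprob_pconv) (rule bprob_usq[OF assms])
  from supp_in_conv[OF this bprob_usq[OF assms] Suc supp_in_usq[OF assms]] show ?case by simp
qed

text \<open>\<open>X1\<close> and \<open>X4\<close> replace the weights at the three points by the
  cube of \<open>B\<close> at \<open>x\<close>, a function common to all measures; \<open>X2\<close>
  mollifies the arc and \<open>X3\<close> passes to the square. Freezing the weights comes before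
  the exchange of measures because \<open>avg \<mu> c\<close> itself depends on the measure. Four
  terms \<open>3 * (\<delta> * V / 2)\<close> give \<open>6 * \<delta> * V\<close>.\<close>

lemma one_scale_estimate:
  assumes l: "0 < l" and mg: "\<gamma> \<in> borel_measurable borel" and C0: "\<And>\<theta>. \<gamma> \<theta> \<in> sq C0" "1 \<le> C0"
    and pos: "0 < \<delta>" "0 < \<kappa>" "0 < \<epsilon>" "\<epsilon> \<le> 1" "0 \<le> V"
    and \<Lambda>: "2 \<le> \<Lambda>" "32 * (C0 + 1) / (\<epsilon> * \<kappa>) \<le> \<Lambda>" "16 * (C0 + 1) \<le> \<Lambda>"
    and t: "0 < t 0" "\<And>k. \<Lambda> * t k \<le> t (Suc k)"
    and c: "unit_fn V a" "unit_fn V c" "unit_fn V w"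
    and wabs: "\<And>y v v'. a y * c (y + v) * c (y + v') * w (y + v + v') = a y * c (y + v) * c (y + v')"
    and sm: "\<And>t V G. 0 < t \<Longrightarrow> unit_fn V G \<Longrightarrow> (LBINT y. (avg (arc_measure \<gamma> l t) G y - avg (arc_measure \<gamma> l t \<star> usq (\<epsilon> * t)) G y)\<^sup>2) \<le> 2 * \<eta> * V"
  defines "b \<equiv> \<lambda>k. usq (4 * (C0 + 1) * t k)"
  shows "config_count a c (usq (t (2*n))) - config_count a c (arc_measure \<gamma> l (t (2*n))) \<le> 6 * \<delta> * V + 6 * \<kappa> * V
     + 3 / (2 * \<delta>) * (6 * \<eta> * V + 84 * \<kappa> * V + 9 * chain.edrop b (2*n) c + 12 * ((16 * (4 * (C0 + 1) / \<epsilon>)\<^sup>2)\<^sup>2 * chain.cube_drop_u b n a c c w))"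
proof -
  note tpos = lacunary_sum_le(1)[OF t(2) \<Lambda>(1) t(1)]
  have rpos: "0 < 4 * (C0 + 1) * t k" for k using tpos[of k] C0(2) by simp
  interpret chain b V by unfold_locales (unfold b_def, rule bprob_usq[OF rpos], rule symm_measure_usq[OF rpos])
  define s where "s = t (2*n)"
  \<comment> \<open>The size of the factor \<open>b (2*n)\<close>. It is large enough for
    \<open>sq (r / 2)\<close> to contain the arc together with its mollification
    (\<open>hh\<close>), while \<open>m\<close> fits into \<open>sq (r / 4)\<close>.\<close>
  define r where "r = 4 * (C0 + 1) * s"
  define m where "m = pconv b (2*n)"
  define \<sigma> where "\<sigma> = arc_measure \<gamma> l s"
  define \<sigma>e where "\<sigma>e = (\<sigma> \<star> usq (\<epsilon> * s))"
  define C where "C = 16 * (4 * (C0 + 1) / \<epsilon>)\<^sup>2"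
  define B where "B = smoothing (2*n) c"
  define D where "D = cube_drop_u n a c c w"
  define d where "d = edrop (2*n) c"
  have s: "0 < s" "0 < \<epsilon> * s" "0 < r" using tpos[of "2*n"] pos C0(2) by (auto simp: s_def r_def)
  have pm: "bprob m" unfolding m_def by (rule bprob_pconv[OF bprob_b])
  have "(\<Sum>i<2*n. 4 * (C0 + 1) * t i) \<le> 4 * (C0 + 1) * (2 * s / \<Lambda>)"
    unfolding sum_distrib_left[symmetric] s_def using lacunary_sum_le(2)[OF t(2) \<Lambda>(1) t(1), of "2*n"] C0(2) by (intro mult_left_mono) auto
  then have sm0: "supp_in m (8 * (C0 + 1) * s / \<Lambda>)"
    unfolding m_def b_def by (intro supp_in_mono[OF supp_in_pconv[OF rpos]]) (erule order_trans, simp add: field_simps)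
  have "8 * (C0 + 1) * s / \<Lambda> \<le> 8 * (C0 + 1) * s / 8"
    using \<Lambda>(3) C0(2) s(1) by (intro divide_left_mono) auto
  also have "8 * (C0 + 1) * s / 8 = r / 4" unfolding r_def by (simp add: algebra_simps)
  finally have "8 * (C0 + 1) * s / \<Lambda> \<le> r / 4" .
  then have sm4: "supp_in m (r / 4)" by (rule supp_in_mono[OF sm0])
  have ps: "bprob \<sigma>" unfolding \<sigma>_def by (rule bprob_arc_measure[OF l mg])
  have ss: "supp_in \<sigma> (C0 * s)" unfolding \<sigma>_def by (rule supp_in_arc_measure[OF l mg C0(1)]) (use s in simp)
  have pU: "bprob (usq s)" by (rule bprob_usq[OF s(1)])
  have pe: "bprob \<sigma>e" unfolding \<sigma>e_def by (intro bprob_conv ps bprob_usq s)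
  have es: "\<epsilon> * s \<le> s" using pos s(1) by simp
  have r': "\<Lambda> * r \<le> 4 * (C0 + 1) * t (Suc (2*n))"
    using mult_left_mono[OF t(2)[of "2*n"], of "4 * (C0 + 1)"] C0(2) unfolding r_def s_def by (simp add: algebra_simps)
  have b1: "b (Suc (2*n)) = usq (4 * (C0 + 1) * t (Suc (2*n)))" by (simp add: b_def)
  have e\<kappa>: "32 * (C0 + 1) / \<Lambda> \<le> \<epsilon> * \<kappa>" 
    using \<Lambda>(1,2) pos by (simp add: field_simps)
  \<comment> \<open>The mollifier of size \<open>\<epsilon> * s\<close> is the smallest square that
    must still be much coarser than the accumulated lower levels \<open>m\<close>; this dictates the
    bound on \<open>\<Lambda>\<close> involving \<open>\<epsilon> * \<kappa>\<close>.\<close>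
  have k1: "4 * (8 * (C0 + 1) * s / \<Lambda>) / (\<epsilon> * s) \<le> \<kappa>"
  proof -
    have "4 * (8 * (C0 + 1) * s / \<Lambda>) / (\<epsilon> * s) = (32 * (C0 + 1) / \<Lambda>) / \<epsilon>" using s pos \<Lambda>(1) by (simp add: field_simps)
    also have "\<dots> \<le> (\<epsilon> * \<kappa>) / \<epsilon>" using e\<kappa> pos by (intro divide_right_mono) auto
    finally show ?thesis using pos by simp
  qed
  have "4 * (8 * (C0 + 1) * s / \<Lambda>) / s \<le> 4 * (8 * (C0 + 1) * s / \<Lambda>) / (\<epsilon> * s)"
    using es s C0(2) \<Lambda>(1) by (intro divide_left_mono) auto
  then have k2: "4 * (8 * (C0 + 1) * s / \<Lambda>) / s \<le> \<kappa>" using k1 by linarith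
  have \<kappa>\<Lambda>: "1 / \<Lambda> \<le> \<kappa>"
  proof -
    have "1 / \<Lambda> \<le> 32 * (C0 + 1) / \<Lambda>" using C0(2) \<Lambda>(1) by (intro divide_right_mono) auto
    also have "\<dots> \<le> \<epsilon> * \<kappa>" by (rule e\<kappa>)
    also have "\<dots> \<le> \<kappa>" using pos by (simp add: mult_left_le_one_le)
    finally show ?thesis .
  qed
  have k3: "4 * q / (4 * (C0 + 1) * t (Suc (2*n))) \<le> \<kappa>" if "0 \<le> q" "q \<le> (C0 + 1) * s" for q
  proof -
    have "4 * q / (4 * (C0 + 1) * t (Suc (2*n))) \<le> 4 * ((C0 + 1) * s) / (\<Lambda> * r)"
      using that r' s \<Lambda>(1) by (intro frac_le) auto
    also have "\<dots> = 1 / \<Lambda>" using s C0(2) unfolding r_def by simp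
    finally show ?thesis using \<kappa>\<Lambda> by linarith
  qed
  have gU: "separated \<kappa> (pconv b (2*n)) (usq s) (b (Suc (2*n)))"
    unfolding b1 m_def[symmetric] by (rule separated_usq[OF pm sm0 s(1) rpos k2 k3]) (use s C0(2) in \<open>simp_all add: algebra_simps\<close>)
  have ge: "separated \<kappa> (pconv b (2*n)) \<sigma>e (b (Suc (2*n)))"
    unfolding b1 m_def[symmetric] \<sigma>e_def
    by (rule separated_conv_usq[OF pm sm0 ps ss s(2) rpos k1 k3]) (use s es C0(2) in \<open>auto simp: algebra_simps\<close>)
  have nu1: "dconv b (2*n+1) = ((m \<star> usq r) \<star> (m \<star> usq r))" by (simp add: dconv_def m_def r_def s_def b_def)
  have rs: "r / (\<epsilon> * s) = 4 * (C0 + 1) / \<epsilon>" "r / s = 4 * (C0 + 1)" unfolding r_def using s pos by auto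
  have hh: "C0 * s \<le> r / 2 - \<epsilon> * s"
  proof -
    have "r = 4 * (C0 * s) + 4 * s" by (simp add: r_def algebra_simps)
    moreover have "0 \<le> C0 * s" using C0(2) s by simp
    ultimately show ?thesis using es s by linarith
  qed
  have de: "dominated C \<sigma>e (dconv b (2*n+1))"
    unfolding nu1 \<sigma>e_def C_def rs(1)[symmetric]
    by (rule dominated_box[OF pm sm4 s(3) s(2) ps]) (rule supp_in_mono[OF ss hh])
  have dU: "dominated C (usq s) (dconv b (2*n+1))"
  proof (rule dominated_mono)
    show "dominated (16 * (r / s)\<^sup>2) (usq s) (dconv b (2*n+1))"
      unfolding nu1 by (rule dominated_usq[OF pm sm4 s(3) s(1)]) (use s C0(2) in \<open>simp add: r_def\<close>)
    have "4 * (C0 + 1) \<le> 4 * (C0 + 1) / \<epsilon>" using pos C0(2) by (simp add: le_divide_eq mult_left_le)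
    then show "16 * (r / s)\<^sup>2 \<le> C" unfolding C_def rs(2) using C0(2) by (intro mult_left_mono power_mono) auto
  qed
  have C: "0 \<le> C" by (simp add: C_def)
  have cB: "unit_fn V B" unfolding B_def by (rule unit_fn_smoothing[OF c(2)])
  have cg: "unit_fn V (\<lambda>x. c x * B x ^ 3)" unfolding power3_eq_cube by (intro unit_fn_mult[where W=V] c cB)
  \<comment> \<open>The outermost factor of \<open>smoothing\<close> is
    \<open>b (Suc (2*n))\<close>, a square of the size of the next scale, so \<open>B\<close> hardly
    varies over the shifts of a configuration.\<close>
  have Bslow: "\<bar>B (x + v) - B x\<bar> \<le> \<kappa>" if "v \<in> sq ((C0 + 1) * s)" for x v
  proof -
    define h where "h = avg (b (2*n)) (avg (b (Suc (2*n))) (avg (b (2*n)) (avg (pconv b (2*n)) c)))"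
    have h: "unit_fn V h" unfolding h_def by (intro unit_fn_avg bprob_b bprob_pconv c)
    have "\<bar>avg (b (Suc (2*n))) h (x + v) - avg (b (Suc (2*n))) h x\<bar> \<le> 4 * ((C0 + 1) * s) / (4 * (C0 + 1) * t (Suc (2*n)))"
      unfolding b1 by (rule avg_usq_slow[OF rpos that unit_fnD(1)[OF h] unit_fnD(4)[OF h]])
    also have "\<dots> \<le> \<kappa>" by (rule k3) (use s C0(2) in auto)
    finally show ?thesis unfolding B_def smoothing_def h_def .
  qed
  have ZU: "(LBINT y. (avg (usq s) c y - B y)\<^sup>2) \<le> 12 * \<kappa> * V + 3 * d"
    unfolding B_def d_def by (rule approx_smoothing[OF pU gU c(2)])
  have Ze: "(LBINT y. (avg \<sigma>e c y - B y)\<^sup>2) \<le> 12 * \<kappa> * V + 3 * d"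
    unfolding B_def d_def by (rule approx_smoothing[OF pe ge c(2)])
  have sm1: "(LBINT y. (avg \<sigma> G y - avg \<sigma>e G y)\<^sup>2) \<le> 2 * \<eta> * V" if "unit_fn V G" for G
    unfolding \<sigma>e_def \<sigma>_def by (rule sm[OF s(1) that])
  have n: "nice_fn (avg \<sigma> c)" "nice_fn (avg \<sigma>e c)" "nice_fn B" by (intro nice_fn_avg ps pe unit_fnD(7)[OF c(2)] unit_fnD(7)[OF cB])+
  \<comment> \<open>The singular measure \<open>\<sigma>\<close> need not be separated from the
    lower levels, so it is compared with \<open>B\<close> through \<open>\<sigma>e\<close>; here
    \<open>\<eta>\<close> enters the weights.\<close>
  have "(LBINT y. (avg \<sigma> c y - B y)\<^sup>2) = (LBINT y. ((avg \<sigma> c y - avg \<sigma>e c y) + (avg \<sigma>e c y - B y))\<^sup>2)" by simp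
  also have "\<dots> \<le> 2 * (2 * \<eta> * V) + 2 * (12 * \<kappa> * V + 3 * d)"
    by (rule order_trans[OF sq_sum2_le[OF nice_fn_diff[OF n(1,2)] nice_fn_diff[OF n(2,3)]]], intro add_mono mult_left_mono sm1[OF c(2)] Ze) simp_all
  finally have Z\<sigma>: "(LBINT y. (avg \<sigma> c y - B y)\<^sup>2) \<le> 2 * (2 * \<eta> * V) + 2 * (12 * \<kappa> * V + 3 * d)" .
  have X1: "\<bar>config_count a c \<sigma> - config_avg (\<lambda>x. c x * B x ^ 3) a c \<sigma> \<sigma> \<sigma>\<bar> \<le> 3 * (\<delta> * V / 2 + (2 * (2 * \<eta> * V) + 2 * (12 * \<kappa> * V + 3 * d)) / (2 * \<delta>)) + 3 * \<kappa> * V"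
    unfolding config_count_def by (rule config_avg_slow[OF c(2,1) unit_fn_avg[OF ps c(2)] cB ps supp_in_mono[OF ss] Bslow pos(1) Z\<sigma>]) (use s in \<open>auto simp: algebra_simps\<close>)
  have X4: "\<bar>config_count a c (usq s) - config_avg (\<lambda>x. c x * B x ^ 3) a c (usq s) (usq s) (usq s)\<bar> \<le> 3 * (\<delta> * V / 2 + (12 * \<kappa> * V + 3 * d) / (2 * \<delta>)) + 3 * \<kappa> * V"
    unfolding config_count_def by (rule config_avg_slow[OF c(2,1) unit_fn_avg[OF pU c(2)] cB pU supp_in_mono[OF supp_in_usq[OF s(1)]] Bslow pos(1) ZU]) (use s C0(2) in \<open>auto simp: algebra_simps\<close>)
  have X2: "\<bar>config_avg (\<lambda>x. c x * B x ^ 3) a c \<sigma> \<sigma> \<sigma> - config_avg (\<lambda>x. c x * B x ^ 3) a c \<sigma>e \<sigma>e \<sigma>e\<bar> \<le> 3 * (\<delta> * V / 2 + (2 * \<eta> * V) / (2 * \<delta>))"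
    by (rule config_avg_all_change[OF ps pe cg c(1,2)], rule config_avg_change_const[OF cg c(1,2,3) ps pe _ _ pos(1) wabs sm1]) (use ps pe in auto)
  have X3: "\<bar>config_avg (\<lambda>x. c x * B x ^ 3) a c \<sigma>e \<sigma>e \<sigma>e - config_avg (\<lambda>x. c x * B x ^ 3) a c (usq s) (usq s) (usq s)\<bar> \<le> 3 * (\<delta> * V / 2 + (48 * \<kappa> * V + 12 * (C\<^sup>2 * D)) / (2 * \<delta>))"
    unfolding D_def
    by (rule config_avg_all_change[OF pe pU cg c(1,2)], rule config_avg_change_edrop[OF cg c(1,2,3) pe pU _ _ pos(1) wabs ge gU _ _ C]) (use pe pU de dU in auto)
  have "config_count a c (usq s) - config_count a c \<sigma> \<le> (3 * (\<delta> * V / 2 + (2 * (2 * \<eta> * V) + 2 * (12 * \<kappa> * V + 3 * d)) / (2 * \<delta>)) + 3 * \<kappa> * V)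
     + (3 * (\<delta> * V / 2 + (12 * \<kappa> * V + 3 * d) / (2 * \<delta>)) + 3 * \<kappa> * V) + 3 * (\<delta> * V / 2 + (2 * \<eta> * V) / (2 * \<delta>)) + 3 * (\<delta> * V / 2 + (48 * \<kappa> * V + 12 * (C\<^sup>2 * D)) / (2 * \<delta>))"
    using X1 X2 X3 X4 by linarith
  also have "\<dots> = 6 * \<delta> * V + 6 * \<kappa> * V + 3 / (2 * \<delta>) * (6 * \<eta> * V + 84 * \<kappa> * V + 9 * d + 12 * (C\<^sup>2 * D))"
    using pos(1) by (simp add: field_simps)
  finally show ?thesis unfolding s_def \<sigma>_def d_def D_def C_def .
qed

text \<open>The weighted drops \<open>E n\<close> have sum at most
  \<open>(9 + 60 * C\<^sup>2) * V\<close>, so one of the \<open>J\<close> of them is at most the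
  mean. All constants, including \<open>\<Lambda>\<close> and \<open>J\<close>, precede the scales
  and the functions. Configurations use the even members of \<open>t\<close>; the odd ones provide
  the coarser squares in between.\<close>

lemma exists_good_scale:
  assumes l: "0 < l" and d: "\<And>s. (\<gamma> has_vector_derivative \<gamma>' s) (at s)"
    and ne: "\<And>s s'. s \<in> {0..l} \<Longrightarrow> s' \<in> {0..l} \<Longrightarrow> s \<noteq> s' \<Longrightarrow> cross2 (\<gamma>' s) (\<gamma>' s') \<noteq> 0"
    and C0: "\<And>\<theta>. \<gamma> \<theta> \<in> sq C0" "1 \<le> C0" and \<zeta>: "0 < (\<zeta> :: real)"
  obtains \<Lambda> J where "2 \<le> \<Lambda>"
    "\<And>t V a c w. 0 < t 0 \<Longrightarrow> (\<And>k. \<Lambda> * t k \<le> t (Suc k)) \<Longrightarrow> 0 \<le> V \<Longrightarrow> unit_fn V a \<Longrightarrow> unit_fn V c \<Longrightarrow> unit_fn V w \<Longrightarrow>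
       (\<And>y v v'. a y * c (y + v) * c (y + v') * w (y + v + v') = a y * c (y + v) * c (y + v')) \<Longrightarrow>
       \<exists>n<J. config_count a c (usq (t (2*n))) \<le> config_count a c (arc_measure \<gamma> l (t (2*n))) + \<zeta> * V"
proof -
  have "continuous_on UNIV \<gamma>"
    by (auto intro!: continuous_at_imp_continuous_on has_vector_derivative_continuous[OF d])
  then have mg: "\<gamma> \<in> borel_measurable borel" by (rule borel_measurable_continuous_onI)
  \<comment> \<open>Each of four contributions gets a quarter of \<open>\<zeta> * V\<close>: the
    terms in \<open>\<delta>\<close>, \<open>\<eta>\<close> and \<open>\<kappa>\<close> equal it by
    \<open>e2\<close>, \<open>e3\<close> and \<open>e4\<close>, and the drops, bounded in
    \<open>e1\<close>, determine \<open>J\<close>.\<close>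
  define \<delta> where "\<delta> = \<zeta> / 24"
  define \<eta> where "\<eta> = \<zeta> * \<delta> / 36"
  define \<kappa> where "\<kappa> = \<zeta> * \<delta> / (4 * (6 * \<delta> + 126))"
  have pos: "0 < \<delta>" "0 < \<eta>" "0 < \<kappa>" using \<zeta> by (auto simp: \<delta>_def \<eta>_def \<kappa>_def)
  obtain \<epsilon> where \<epsilon>: "0 < \<epsilon>" "\<epsilon> \<le> 1"
    "\<And>t V G. 0 < t \<Longrightarrow> unit_fn V G \<Longrightarrow> (LBINT y. (avg (arc_measure \<gamma> l t) G y - avg (arc_measure \<gamma> l t \<star> usq (\<epsilon> * t)) G y)\<^sup>2) \<le> 2 * \<eta> * V"
    by (rule arc_smoothing[OF l d ne pos(2)]) blast+
  define C where "C = 16 * (4 * (C0 + 1) / \<epsilon>)\<^sup>2"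
  define \<Lambda> where "\<Lambda> = max 2 (max (32 * (C0 + 1) / (\<epsilon> * \<kappa>)) (16 * (C0 + 1)))"
  obtain J :: nat where J: "0 < J" "3 / (2 * \<delta>) * (9 + 60 * C\<^sup>2) * 4 / \<zeta> < J"
    using reals_Archimedean2[of "max 0 (3 / (2 * \<delta>) * (9 + 60 * C\<^sup>2) * 4 / \<zeta>)"] by (auto simp: max_less_iff_conj)
  have \<Lambda>: "2 \<le> \<Lambda>" "32 * (C0 + 1) / (\<epsilon> * \<kappa>) \<le> \<Lambda>" "16 * (C0 + 1) \<le> \<Lambda>" by (auto simp: \<Lambda>_def)
  show ?thesis
  proof (rule that[OF \<Lambda>(1)])
    fix t :: "nat \<Rightarrow> real" and V a c w
    assume t: "0 < t 0" "\<And>k. \<Lambda> * t k \<le> t (Suc k)" and V: "0 \<le> V" and c: "unit_fn V a" "unit_fn V c" "unit_fn V w"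
      and wabs: "\<And>y v v'. a y * c (y + v) * c (y + v') * w (y + v + v') = a y * c (y + v) * c (y + v')"
    define b where "b = (\<lambda>k. usq (4 * (C0 + 1) * t k))"
    note tpos = lacunary_sum_le(1)[OF t(2) \<Lambda>(1) t(1)]
    have rpos: "0 < 4 * (C0 + 1) * t k" for k using tpos[of k] C0(2) by simp
    interpret chain b V by unfold_locales (unfold b_def, rule bprob_usq[OF rpos], rule symm_measure_usq[OF rpos])
    define E where "E = (\<lambda>n. 9 * edrop (2*n) c + 12 * (C\<^sup>2 * cube_drop_u n a c c w))"
    have main: "config_count a c (usq (t (2*n))) - config_count a c (arc_measure \<gamma> l (t (2*n))) \<le> 6 * \<delta> * V + 6 * \<kappa> * V
       + 3 / (2 * \<delta>) * (6 * \<eta> * V + 84 * \<kappa> * V + E n)" for n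
      using one_scale_estimate[OF l mg C0 pos(1,3) \<epsilon>(1,2) V \<Lambda> t c wabs \<epsilon>(3), of n] unfolding E_def b_def C_def by (simp add: add.assoc)
    have "(\<Sum>n<J. E n) = 9 * (\<Sum>n<J. edrop (2*n) c) + 12 * (C\<^sup>2 * (\<Sum>n<J. cube_drop_u n a c c w))"
      by (simp add: E_def sum.distrib sum_distrib_left)
    also have "\<dots> \<le> 9 * V + 12 * (C\<^sup>2 * (5 * V))"
      by (intro add_mono mult_left_mono sum_edrop_le sum_cube_drop_u_le c) auto
    finally have sE: "(\<Sum>n<J. E n) \<le> (9 + 60 * C\<^sup>2) * V" by (simp add: algebra_simps)
    have "\<exists>n<J. E n \<le> (9 + 60 * C\<^sup>2) * V / J"
    proof (rule ccontr)
      assume "\<not> ?thesis"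
      then have "\<And>n. n < J \<Longrightarrow> (9 + 60 * C\<^sup>2) * V / J < E n" by auto
      then have "(\<Sum>n<J. (9 + 60 * C\<^sup>2) * V / J) < (\<Sum>n<J. E n)" using J(1) by (intro sum_strict_mono) auto
      then show False using sE J(1) by simp
    qed
    then obtain n where n: "n < J" "E n \<le> (9 + 60 * C\<^sup>2) * V / J" by blast
    have "3 / (2 * \<delta>) * E n \<le> 3 / (2 * \<delta>) * ((9 + 60 * C\<^sup>2) * V / J)" using n(2) pos(1) by (intro mult_left_mono) auto
    also have "\<dots> = (3 / (2 * \<delta>) * (9 + 60 * C\<^sup>2) * 4 / \<zeta>) * (\<zeta> * V / (4 * J))"
    proof -
      have "A * (X * V / J) = (A * X * 4 / \<zeta>) * (\<zeta> * V / (4 * J))" for A X using \<zeta> J(1) by (simp add: field_simps)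
      then show ?thesis .
    qed
    also have "\<dots> \<le> J * (\<zeta> * V / (4 * J))" using J(2) \<zeta> V by (intro mult_right_mono) auto
    also have "\<dots> = \<zeta> * V / 4" using J(1) by simp
    finally have e1: "3 / (2 * \<delta>) * E n \<le> \<zeta> * V / 4" .
    have e2: "6 * \<delta> * V = \<zeta> * V / 4" by (simp add: \<delta>_def)
    have e3: "3 / (2 * \<delta>) * (6 * \<eta> * V) = \<zeta> * V / 4" using pos(1) by (simp add: \<eta>_def)
    have "6 * \<kappa> + 126 * \<kappa> / \<delta> = \<kappa> * (6 * \<delta> + 126) / \<delta>" using pos(1) by (simp add: field_simps)
    also have "\<dots> = \<zeta> / 4"
    proof -
      have "6 * \<delta> + 126 \<noteq> 0" using pos(1) by linarith
      then show ?thesis using pos(1) unfolding \<kappa>_def by (simp add: divide_simps)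
    qed
    finally have "(6 * \<kappa> + 126 * \<kappa> / \<delta>) * V = \<zeta> / 4 * V" by simp
    then have e4: "6 * \<kappa> * V + 3 / (2 * \<delta>) * (84 * \<kappa> * V) = \<zeta> * V / 4" using pos(1) by (simp add: field_simps)
    have "config_count a c (usq (t (2*n))) - config_count a c (arc_measure \<gamma> l (t (2*n))) \<le> \<zeta> * V"
      using main[of n] e1 e2 e3 e4 by (simp only: distrib_left)
    then show "\<exists>n<J. config_count a c (usq (t (2*n))) \<le> config_count a c (arc_measure \<gamma> l (t (2*n))) + \<zeta> * V" using n(1) by (intro exI[of _ n]) auto
  qed
qed

section \<open>Translates of a strictly convex curve\<close>

lemma smooth_derivs:
  assumes "smooth \<gamma>"
  obtains \<gamma>' \<gamma>'' where "\<And>s. (\<gamma> has_vector_derivative \<gamma>' s) (at s)" "\<And>s. (\<gamma>' has_vector_derivative \<gamma>'' s) (at s)"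
    "\<And>s. isCont \<gamma>'' s" "\<And>s. signed_curvature \<gamma> s \<noteq> 0 \<Longrightarrow> cross2 (\<gamma>' s) (\<gamma>'' s) \<noteq> 0"
proof -
  let ?D = "\<lambda>f t. vector_derivative f (at t) :: plane"
  define \<gamma>' where "\<gamma>' = ?D \<gamma>"
  define \<gamma>'' where "\<gamma>'' = ?D \<gamma>'"
  have s: "(?D ^^ n) \<gamma> differentiable_on UNIV" for n using assms by (auto simp: smooth_def)
  have d: "f differentiable (at s)" if "f differentiable_on UNIV" for f :: "real \<Rightarrow> plane" and s
    using that by (auto simp: differentiable_on_def)
  have 0: "\<gamma> differentiable (at s)" for s using d[OF s[of 0]] by simp
  have 1: "\<gamma>' differentiable (at s)" for s using d[OF s[of 1]] by (simp add: \<gamma>'_def)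
  have 2: "\<gamma>'' differentiable (at s)" for s using d[OF s[of 2]] by (simp add: \<gamma>''_def \<gamma>'_def numeral_2_eq_2)
  show ?thesis
  proof (rule that)
    show "(\<gamma> has_vector_derivative \<gamma>' s) (at s)" for s using 0 by (simp add: \<gamma>'_def vector_derivative_works[symmetric])
    show "(\<gamma>' has_vector_derivative \<gamma>'' s) (at s)" for s using 1 by (simp add: \<gamma>''_def vector_derivative_works[symmetric])
    show "isCont \<gamma>'' s" for s by (rule differentiable_imp_continuous_within[OF 2])
    show "signed_curvature \<gamma> s \<noteq> 0 \<Longrightarrow> cross2 (\<gamma>' s) (\<gamma>'' s) \<noteq> 0" for s
      by (auto simp: signed_curvature_def cross2_def \<gamma>''_def \<gamma>'_def Let_def)
  qed
qed

lemma inner_vec2: "(a :: plane) \<bullet> b = a $ 1 * b $ 1 + a $ 2 * b $ 2"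
  by (simp add: inner_vec_def sum_2)

lemma periodic_int:
  fixes \<gamma> :: "real \<Rightarrow> 'a"
  assumes "\<And>t. \<gamma> (t + L) = \<gamma> t" shows "\<gamma> (t + of_int m * L) = \<gamma> t"
proof -
  have n: "\<gamma> (t + of_nat n * L) = \<gamma> t" for n t
    by (induction n arbitrary: t) (auto simp: algebra_simps, metis assms add.assoc add.commute)
  show ?thesis
  proof (cases m rule: int_cases2)
    case (nonneg n) then show ?thesis using n[of t n] by simp
  next
    case (nonpos n) then show ?thesis using n[of "t - of_nat n * L" n] by simp
  qed
qed

text \<open>Reduced to one period both parameters coincide, so their difference is a multiple of
  \<open>L\<close> of absolute value less than \<open>L\<close>.\<close>

lemma curve_inj:
  assumes c: "closed_curve_param L \<gamma>" and e: "\<gamma> s = \<gamma> t" and lt: "\<bar>s - t\<bar> < L"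
  shows "s = t"
proof -
  have L: "0 < L" "inj_on \<gamma> {0..<L}" "\<And>t. \<gamma> (t + L) = \<gamma> t" using c by (auto simp: closed_curve_param_def)
  define f where "f = (\<lambda>s. s + of_int (- \<lfloor>s / L\<rfloor>) * L)"
  have f: "f s \<in> {0..<L}" for s
  proof -
    have "of_int \<lfloor>s / L\<rfloor> * L \<le> s" "s < (of_int \<lfloor>s / L\<rfloor> + 1) * L"
      using floor_divide_lower[OF L(1), of s] floor_divide_upper[OF L(1), of s] by auto
    then show ?thesis by (simp add: f_def algebra_simps)
  qed
  have "\<gamma> (f s) = \<gamma> s" for s unfolding f_def by (rule periodic_int[of \<gamma>, OF L(3)])
  with e have "\<gamma> (f s) = \<gamma> (f t)" by simp
  with L(2) f have "f s = f t" by (auto dest: inj_onD)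
  then have "s - t = (of_int \<lfloor>s / L\<rfloor> - of_int \<lfloor>t / L\<rfloor>) * L" by (simp add: f_def algebra_simps)
  then have st: "s - t = of_int (\<lfloor>s / L\<rfloor> - \<lfloor>t / L\<rfloor>) * L" by simp
  then have "\<bar>real_of_int (\<lfloor>s / L\<rfloor> - \<lfloor>t / L\<rfloor>)\<bar> * L < 1 * L" using lt L(1) by (simp add: abs_mult)
  then have "\<bar>real_of_int (\<lfloor>s / L\<rfloor> - \<lfloor>t / L\<rfloor>)\<bar> < 1" using L(1) by (simp only: mult_less_cancel_right_pos)
  then have "\<lfloor>s / L\<rfloor> - \<lfloor>t / L\<rfloor> = 0" by linarith
  then show ?thesis using st by simp
qed

lemma curve_rep:
  assumes c: "closed_curve_param L \<gamma>"
  obtains s' where "\<gamma> s' = \<gamma> s" "\<bar>s' - t\<bar> \<le> L / 2"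
proof -
  have L: "0 < L" "\<And>t. \<gamma> (t + L) = \<gamma> t" using c by (auto simp: closed_curve_param_def)
  define m where "m = round ((s - t) / L)"
  have "\<bar>of_int m - (s - t) / L\<bar> \<le> 1 / 2" unfolding m_def by (rule of_int_round_abs_le)
  then have "\<bar>of_int m - (s - t) / L\<bar> * L \<le> 1 / 2 * L" using L(1) by (intro mult_right_mono) auto
  also have "\<bar>of_int m - (s - t) / L\<bar> * L = \<bar>(of_int m - (s - t) / L) * L\<bar>" using L(1) by (simp add: abs_mult)
  also have "(of_int m - (s - t) / L) * L = of_int m * L - (s - t)" using L(1) by (simp add: field_simps)
  finally have "\<bar>(s + of_int (- m) * L) - t\<bar> \<le> L / 2" by (simp add: abs_minus_commute algebra_simps)
  moreover have "\<gamma> (s + of_int (- m) * L) = \<gamma> s" by (rule periodic_int[of \<gamma>, OF L(2)])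
  ultimately show ?thesis using that by blast
qed

text \<open>Applied to the component of the curve along the normal of a supporting line, this excludes segments
  on the curve.\<close>
lemma isolated_critical_level:
  fixes h :: "real \<Rightarrow> real"
  assumes h: "\<And>s. (h has_real_derivative h' s) (at s)" and h'': "(h' has_real_derivative c) (at t)" "c \<noteq> 0" and "h' t = 0"
  shows "eventually (\<lambda>s. h s \<noteq> h t) (at t)"
proof -
  have "((\<lambda>y. (h' y - h' t) / (y - t)) \<longlongrightarrow> c) (at t)" using h''(1) by (simp add: has_field_derivative_iff)
  from tendsto_imp_eventually_ne[OF this h''(2)] have "eventually (\<lambda>y. h' y \<noteq> 0) (at t)"
    by eventually_elim (use assms(4) in auto)
  then obtain d where d: "0 < d" "\<And>y. y \<noteq> t \<Longrightarrow> dist y t < d \<Longrightarrow> h' y \<noteq> 0"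
    by (auto simp: eventually_at)
  have "h s \<noteq> h t" if s: "s \<noteq> t" "dist s t < d" for s
  proof
    assume e: "h s = h t"
    have dd: "(h has_derivative (*) (h' x)) (at x)" for x using h[of x] by (simp add: has_field_derivative_def)
    have co: "continuous_on S h" for S using h by (meson DERIV_isCont continuous_at_imp_continuous_on)
    have "\<exists>z. min s t < z \<and> z < max s t \<and> (*) (h' z) = (\<lambda>v. 0)"
      by (rule Rolle_deriv[OF _ _ co dd]) (use s e in \<open>auto simp: min_def max_def\<close>)
    then obtain z where z: "min s t < z" "z < max s t" "h' z * 1 = 0" by metis
    have "z \<noteq> t" "dist z t < d" using z s(2) by (auto simp: dist_real_def min_def max_def split: if_splits)
    with d(2) z(3) show False by auto
  qed
  then show ?thesis using d(1) by (auto simp: eventually_at)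
qed

text \<open>If \<open>z\<close> were on the boundary, a supporting line at \<open>z\<close> would
  contain \<open>x\<close> and the segment from \<open>z\<close> to \<open>x\<close> would lie on
  the curve. But at the parameter of \<open>z\<close> the component normal to the line has a
  critical point with nonzero second derivative, which isolates \<open>z\<close> on the line in
  parameter.\<close>

lemma strictly_convex_curve:
  fixes K :: "plane set"
  assumes c: "closed_curve_param L \<gamma>" and nz: "\<And>t. signed_curvature \<gamma> t \<noteq> 0"
    and K: "compact K" "convex K" "interior K \<noteq> {}" "frontier K = range \<gamma>"
    and xy: "x \<in> K" "y \<in> K" "x \<noteq> y" and z: "z \<in> open_segment x y"
  shows "z \<in> interior K"
proof (rule ccontr)
  assume nz': "z \<notin> interior K"
  have "smooth \<gamma>" and L: "0 < L" using c by (auto simp: closed_curve_param_def)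
  from smooth_derivs[OF this(1)] obtain \<gamma>' \<gamma>'' where d: "\<And>s. (\<gamma> has_vector_derivative \<gamma>' s) (at s)" "\<And>s. (\<gamma>' has_vector_derivative \<gamma>'' s) (at s)"
    and cross2: "\<And>s. cross2 (\<gamma>' s) (\<gamma>'' s) \<noteq> 0" using nz by metis
  have cl: "closure K = K" using K(1) by (simp add: compact_imp_closed closure_closed)
  have zK: "z \<in> K" using z xy K(2) by (meson closed_segment_subset open_closed_segment subsetD)
  have ri: "rel_interior K = interior K" using K(3) by (simp add: rel_interior_nonempty_interior)
  obtain a where a: "a \<noteq> 0" "\<And>w. w \<in> K \<Longrightarrow> a \<bullet> z \<le> a \<bullet> w" "\<And>w. w \<in> interior K \<Longrightarrow> a \<bullet> z < a \<bullet> w"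
    by (rule supporting_hyperplane_rel_boundary[OF K(2) zK]) (use nz' ri in auto)
  obtain u where u: "0 < u" "u < 1" "z = (1 - u) *\<^sub>R x + u *\<^sub>R y" using z by (auto simp: in_segment)
  have "a \<bullet> z = (1 - u) * (a \<bullet> x) + u * (a \<bullet> y)" unfolding u(3) by (simp add: inner_add_right)
  moreover have "a \<bullet> z \<le> a \<bullet> x" "a \<bullet> z \<le> a \<bullet> y" using a(2) xy by auto
  ultimately have ax: "a \<bullet> x = a \<bullet> z"
  proof -
    assume e: "a \<bullet> z = (1 - u) * (a \<bullet> x) + u * (a \<bullet> y)" and le: "a \<bullet> z \<le> a \<bullet> x" "a \<bullet> z \<le> a \<bullet> y"
    have "(1 - u) * (a \<bullet> x - a \<bullet> z) + u * (a \<bullet> y - a \<bullet> z) = 0" using e by (simp add: algebra_simps)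
    moreover have "0 \<le> (1 - u) * (a \<bullet> x - a \<bullet> z)" "0 \<le> u * (a \<bullet> y - a \<bullet> z)" using le u by auto
    ultimately have "(1 - u) * (a \<bullet> x - a \<bullet> z) = 0" by linarith
    then show ?thesis using u by simp
  qed
  have xz: "x \<noteq> z" using u xy(3) by (auto simp: algebra_simps scaleR_left_diff_distrib)
  \<comment> \<open>Points of the segment that tend to \<open>z\<close> without reaching it;
    compactness makes a subsequence of their parameters converge.\<close>
  define p where "p = (\<lambda>k :: nat. z + inverse (real (Suc k)) *\<^sub>R (x - z))"
  have pK: "p k \<in> K" for k
  proof -
    have "p k = (1 - inverse (real (Suc k))) *\<^sub>R z + inverse (real (Suc k)) *\<^sub>R x" by (simp add: p_def algebra_simps)
    then show ?thesis using convexD[OF K(2) zK xy(1), of "1 - inverse (real (Suc k))" "inverse (real (Suc k))"] by (simp add: inverse_le_1_iff)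
  qed
  have pa: "a \<bullet> p k = a \<bullet> z" for k by (simp add: p_def inner_add_right inner_diff_right ax)
  have fr: "w \<in> range \<gamma>" if "w \<in> K" "a \<bullet> w = a \<bullet> z" for w
  proof -
    have "w \<notin> interior K" using a(3)[of w] that(2) by auto
    then show ?thesis using that(1) cl unfolding K(4)[symmetric] frontier_def by auto
  qed
  obtain t where t: "z = \<gamma> t" using fr[OF zK] by auto
  have "\<forall>k. \<exists>s. \<gamma> s = p k \<and> \<bar>s - t\<bar> \<le> L / 2"
  proof
    fix k
    obtain s where "\<gamma> s = p k" using fr[OF pK pa] by (metis imageE)
    then show "\<exists>s. \<gamma> s = p k \<and> \<bar>s - t\<bar> \<le> L / 2" using curve_rep[OF c, of s t] by metis
  qed
  then obtain s where s: "\<And>k. \<gamma> (s k) = p k" "\<And>k. \<bar>s k - t\<bar> \<le> L / 2" by metis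
  have "s k \<in> {t - L/2..t + L/2}" for k unfolding atLeastAtMost_iff using s(2)[of k] by linarith
  then obtain q r where q: "q \<in> {t - L/2..t + L/2}" "strict_mono (r :: nat \<Rightarrow> nat)" "(s \<circ> r) \<longlonglongrightarrow> q"
    using compact_Icc[of "t - L/2" "t + L/2"] unfolding compact_def by metis
  have cont: "isCont \<gamma> x" for x by (rule has_vector_derivative_continuous[OF d(1)])
  have "(\<lambda>k. \<gamma> ((s \<circ> r) k)) \<longlonglongrightarrow> \<gamma> q" by (rule isCont_tendsto_compose[OF cont q(3)])
  then have l1: "(\<lambda>k. p (r k)) \<longlonglongrightarrow> \<gamma> q" by (simp add: s(1))
  have "p \<longlonglongrightarrow> z + 0 *\<^sub>R (x - z)" unfolding p_def by (intro tendsto_intros LIMSEQ_inverse_real_of_nat)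
  then have "(p \<circ> r) \<longlonglongrightarrow> z" using LIMSEQ_subseq_LIMSEQ q(2) by fastforce
  then have "\<gamma> q = \<gamma> t" using LIMSEQ_unique l1 t by (auto simp: o_def)
  \<comment> \<open>The parameters were taken within half a period of \<open>t\<close>, so their
    limit is \<open>t\<close> itself and not a different parameter of the same point.\<close>
  then have qt: "q = t" by (rule curve_inj[OF c]) (use q(1) L in auto)
  define h where "h = (\<lambda>s. a \<bullet> \<gamma> s)"
  have h: "(h has_real_derivative a \<bullet> \<gamma>' s) (at s)" for s
    unfolding h_def has_real_derivative_iff_has_vector_derivative
    by (rule bounded_linear.has_vector_derivative[OF bounded_linear_inner_right d(1)])
  have h': "((\<lambda>s. a \<bullet> \<gamma>' s) has_real_derivative a \<bullet> \<gamma>'' s) (at s)" for s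
    unfolding has_real_derivative_iff_has_vector_derivative
    by (rule bounded_linear.has_vector_derivative[OF bounded_linear_inner_right d(2)])
  have gK: "\<gamma> s \<in> K" for s
  proof -
    have "\<gamma> s \<in> frontier K" unfolding K(4) by simp
    then show ?thesis using cl by (simp add: frontier_def)
  qed
  have h0: "a \<bullet> \<gamma>' t = 0"
    by (rule DERIV_local_min[OF h, of 1]) (use a(2) gK t in \<open>auto simp: h_def\<close>)
  \<comment> \<open>A nonzero vector orthogonal to both derivatives would make them parallel,
    against the non-vanishing curvature.\<close>
  have "a \<bullet> \<gamma>'' t \<noteq> 0"
  proof
    assume h2: "a \<bullet> \<gamma>'' t = 0"
    have "a $ 1 * cross2 (\<gamma>' t) (\<gamma>'' t) = 0" "a $ 2 * cross2 (\<gamma>' t) (\<gamma>'' t) = 0"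
      using h0 h2 unfolding inner_vec2 cross2_def by algebra+
    then have "a = 0" using cross2[of t] by (simp add: vec_eq_iff forall_2)
    with a(1) show False by simp
  qed
  from isolated_critical_level[OF h h' this h0] have ev: "eventually (\<lambda>s. h s \<noteq> h t) (at t)" .
  have ne: "s k \<noteq> t" for k
  proof
    assume "s k = t"
    then have "p k = z" using s(1)[of k] t by simp
    then show False using xz by (simp add: p_def)
  qed
  have "filterlim (s \<circ> r) (at t) sequentially"
    unfolding filterlim_at using q(3) qt ne by (auto intro: always_eventually)
  with ev have "eventually (\<lambda>k. h ((s \<circ> r) k) \<noteq> h t) sequentially" by (rule eventually_compose_filterlim)
  then obtain k where "h (s (r k)) \<noteq> h t" by (auto simp: eventually_sequentially)
  then show False using s(1) pa t by (simp add: h_def)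
qed

text \<open>Each of the three points lies on the boundary together with its shift by
  \<open>- d\<close>. In the order across \<open>d\<close>, the middle one lies on the line parallel
  to \<open>d\<close> through a point \<open>e\<close> of the chord from \<open>a\<close> to
  \<open>c\<close>. Both \<open>e\<close> and \<open>e - d\<close> are interior, which forces
  \<open>b\<close> or \<open>b - d\<close> into the interior.\<close>

lemma two_translates_core:
  fixes K :: "plane set"
  assumes sc: "\<And>x y z. x \<in> K \<Longrightarrow> y \<in> K \<Longrightarrow> x \<noteq> y \<Longrightarrow> z \<in> open_segment x y \<Longrightarrow> z \<in> interior K"
    and cl: "closed K" and "d \<noteq> 0"
    and m: "\<And>p. p \<in> {a, b, c} \<Longrightarrow> p \<in> frontier K \<and> p - d \<in> frontier K" and ne: "a \<noteq> b" "b \<noteq> c" "a \<noteq> c"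
    and ord: "cross2 d a \<le> cross2 d b" "cross2 d b \<le> cross2 d c"
  shows False
proof -
  have fK: "p \<in> K" "p \<notin> interior K" if "p \<in> frontier K" for p using that cl by (auto simp: frontier_def)
  have mid: False if "u \<in> K" "v \<in> K" "0 < \<alpha>" "\<alpha> < 1" "u \<noteq> v" "(1 - \<alpha>) *\<^sub>R u + \<alpha> *\<^sub>R v \<in> frontier K" for u v \<alpha>
    using sc[OF that(1,2,5)] fK(2)[OF that(6)] that(3-5) by (auto simp: in_segment)
  \<comment> \<open>With the same position across \<open>d\<close>, the boundary points
    \<open>p\<close>, \<open>p - d\<close>, \<open>q\<close>, \<open>q - d\<close> would be
    collinear and one of them strictly between two others.\<close>
  have line: False if pq: "p \<in> {a, b, c}" "q \<in> {a, b, c}" "p \<noteq> q" "cross2 d p = cross2 d q" for p q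
  proof -
    obtain s where s: "q = p + s *\<^sub>R d"
    proof -
      have "d $ 1 \<noteq> 0 \<or> d $ 2 \<noteq> 0" using assms(3) by (auto simp: vec_eq_iff forall_2)
      then have "q = p + ((q - p) $ 1 / d $ 1) *\<^sub>R d \<or> q = p + ((q - p) $ 2 / d $ 2) *\<^sub>R d"
        using pq(4) by (auto simp: vec_eq_iff forall_2 cross2_def field_simps)
      then show ?thesis using that by blast
    qed
    have s0: "s \<noteq> 0" using s pq(3) by auto
    note mp = m[OF pq(1)] and mq = m[OF pq(2)]
    show False
    proof (cases "s > 0")
      case True
      define \<alpha> where "\<alpha> = 1 / (s + 1)"
      have \<alpha>: "\<alpha> * (s + 1) = 1" "0 < \<alpha>" "\<alpha> < 1" using True by (auto simp: \<alpha>_def)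
      have "(1 - \<alpha>) *\<^sub>R (p - d) + \<alpha> *\<^sub>R q = p - d + (\<alpha> * (s + 1)) *\<^sub>R d"
        by (simp add: s algebra_simps)
      then have e: "(1 - \<alpha>) *\<^sub>R (p - d) + \<alpha> *\<^sub>R q = p" unfolding \<alpha>(1) by simp
      have "p - d \<noteq> q"
      proof
        assume "p - d = q"
        then have "(s + 1) *\<^sub>R d = 0" by (simp add: s algebra_simps)
        then show False using True assms(3) by simp
      qed
      then show False using mid[of "p - d" q \<alpha>] \<alpha> fK(1) mp mq e by auto
    next
      case False
      then have sn: "s < 0" using s0 by simp
      define \<alpha> where "\<alpha> = 1 / (1 - s)"
      have \<alpha>: "\<alpha> * (1 - s) = 1" "0 < \<alpha>" "\<alpha> < 1" using sn by (auto simp: \<alpha>_def)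
      have "(1 - \<alpha>) *\<^sub>R p + \<alpha> *\<^sub>R (q - d) = p - (\<alpha> * (1 - s)) *\<^sub>R d"
        by (simp add: s algebra_simps)
      then have e: "(1 - \<alpha>) *\<^sub>R p + \<alpha> *\<^sub>R (q - d) = p - d" unfolding \<alpha>(1) by simp
      have "p \<noteq> q - d"
      proof
        assume "p = q - d"
        then have "(1 - s) *\<^sub>R d = 0" by (simp add: s algebra_simps)
        then show False using sn assms(3) by simp
      qed
      then show False using mid[of p "q - d" \<alpha>] \<alpha> fK(1) mp mq e by auto
    qed
  qed
  have lt: "cross2 d a < cross2 d b" "cross2 d b < cross2 d c" using ord line[of a b] line[of b c] ne by (auto simp: less_le)
  define \<theta> where "\<theta> = (cross2 d b - cross2 d a) / (cross2 d c - cross2 d a)"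
  have \<theta>: "0 < \<theta>" "\<theta> < 1" using lt by (auto simp: \<theta>_def)
  define e where "e = (1 - \<theta>) *\<^sub>R a + \<theta> *\<^sub>R c"
  have "cross2 d e = cross2 d a + \<theta> * (cross2 d c - cross2 d a)" by (simp add: e_def cross2_def algebra_simps)
  also have "\<dots> = cross2 d b" using lt by (simp add: \<theta>_def)
  finally have ce: "cross2 d e = cross2 d b" .
  have ei: "e \<in> interior K" by (rule sc[of a c]) (use m[of a] m[of c] fK ne \<theta> in \<open>auto simp: in_segment e_def\<close>)
  have edi: "e - d \<in> interior K"
  proof (rule sc[of "a - d" "c - d"])
    have "e - d = (1 - \<theta>) *\<^sub>R (a - d) + \<theta> *\<^sub>R (c - d)" by (simp add: e_def algebra_simps)
    then show "e - d \<in> open_segment (a - d) (c - d)" using \<theta> ne by (auto simp: in_segment)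
  qed (use m[of a] m[of c] fK ne in auto)
  obtain s where s: "b = e + s *\<^sub>R d"
  proof -
    have "d $ 1 \<noteq> 0 \<or> d $ 2 \<noteq> 0" using assms(3) by (auto simp: vec_eq_iff forall_2)
    then have "b = e + ((b - e) $ 1 / d $ 1) *\<^sub>R d \<or> b = e + ((b - e) $ 2 / d $ 2) *\<^sub>R d"
      using ce by (auto simp: vec_eq_iff forall_2 cross2_def field_simps)
    then show ?thesis using that by blast
  qed
  have mb: "b \<in> frontier K" "b - d \<in> frontier K" using m[of b] by auto
  note iK = interior_subset[THEN subsetD]
  \<comment> \<open>For \<open>s > 0\<close> the point \<open>b - d\<close> lies between
    \<open>e - d\<close> and \<open>b\<close>; for \<open>s < 0\<close> the point \<open>b\<close>
    lies between \<open>b - d\<close> and \<open>e\<close>.\<close>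
  show False
  proof (cases "s > 0")
    case True
    define \<alpha> where "\<alpha> = s / (s + 1)"
    have \<alpha>: "\<alpha> * (s + 1) = s" "0 < \<alpha>" "\<alpha> < 1" using True by (auto simp: \<alpha>_def)
    have "(1 - \<alpha>) *\<^sub>R (e - d) + \<alpha> *\<^sub>R b = e - d + (\<alpha> * (s + 1)) *\<^sub>R d"
      by (simp add: s algebra_simps)
    then have eq: "(1 - \<alpha>) *\<^sub>R (e - d) + \<alpha> *\<^sub>R b = b - d" unfolding \<alpha>(1) by (simp add: s)
    have "e - d \<noteq> b" using edi fK(2) mb by auto
    then show False using mid[of "e - d" b \<alpha>] \<alpha> eq mb edi fK(1) iK by auto
  next
    case False
    show False
    proof (cases "s = 0")
      case True then show False using s ei fK(2) mb by simp
    next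
      case False
      then have sn: "s < 0" using \<open>\<not> s > 0\<close> by simp
      define \<alpha> where "\<alpha> = s / (s - 1)"
      have \<alpha>: "\<alpha> * (s - 1) = s" "0 < \<alpha>" "\<alpha> < 1" using sn by (auto simp: \<alpha>_def zero_less_divide_iff divide_less_eq)
      have "(1 - \<alpha>) *\<^sub>R e + \<alpha> *\<^sub>R (b - d) = e + (\<alpha> * (s - 1)) *\<^sub>R d"
        by (simp add: s algebra_simps)
      then have eq: "(1 - \<alpha>) *\<^sub>R e + \<alpha> *\<^sub>R (b - d) = b" unfolding \<alpha>(1) by (simp add: s)
      have "e \<noteq> b - d" using ei fK(2) mb by auto
      then show False using mid[of e "b - d" \<alpha>] \<alpha> eq mb ei fK(1) iK by auto
    qed
  qed
qed

lemma two_translates: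
  fixes K :: "plane set"
  assumes sc: "\<And>x y z. x \<in> K \<Longrightarrow> y \<in> K \<Longrightarrow> x \<noteq> y \<Longrightarrow> z \<in> open_segment x y \<Longrightarrow> z \<in> interior K"
    and cl: "closed K" and "d \<noteq> 0"
    and m: "\<And>p. p \<in> {a, b, c} \<Longrightarrow> p \<in> frontier K \<and> p - d \<in> frontier K" and ne: "a \<noteq> b" "b \<noteq> c" "a \<noteq> c"
  shows False
proof -
  have core: False if "\<And>p. p \<in> {a, b, c} \<Longrightarrow> p \<in> frontier K \<and> p - d \<in> frontier K" "a \<noteq> b" "b \<noteq> c" "a \<noteq> c"
    "cross2 d a \<le> cross2 d b" "cross2 d b \<le> cross2 d c" for a b c
  proof (rule two_translates_core[of K d a b c])
    show "z \<in> interior K" if "x \<in> K" "y \<in> K" "x \<noteq> y" "z \<in> open_segment x y" for x y z by (rule sc[OF that])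
  qed (fact cl assms(3) that)+
  consider "cross2 d a \<le> cross2 d b" "cross2 d b \<le> cross2 d c" | "cross2 d a \<le> cross2 d c" "cross2 d c \<le> cross2 d b" | "cross2 d b \<le> cross2 d a" "cross2 d a \<le> cross2 d c"
    | "cross2 d b \<le> cross2 d c" "cross2 d c \<le> cross2 d a" | "cross2 d c \<le> cross2 d a" "cross2 d a \<le> cross2 d b" | "cross2 d c \<le> cross2 d b" "cross2 d b \<le> cross2 d a"
    by linarith
  then show False
  proof cases
    case 1 then show ?thesis using core[of a b c] m ne by blast
  next
    case 2 then show ?thesis using core[of a c b] m ne by blast
  next
    case 3 then show ?thesis using core[of b a c] m ne by blast
  next
    case 4 then show ?thesis using core[of b c a] m ne by blast
  next
    case 5 then show ?thesis using core[of c a b] m ne by blast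
  next
    case 6 then show ?thesis using core[of c b a] m ne by blast
  qed
qed

section \<open>Shattering\<close>

definition curve_at :: "plane set \<Rightarrow> real \<Rightarrow> plane \<Rightarrow> plane set" where
  "curve_at \<Gamma> t b = (\<lambda>g. b + t *\<^sub>R g) ` \<Gamma>"

definition sparse_translates :: "plane set \<Rightarrow> real \<Rightarrow> bool" where
  "sparse_translates \<Gamma> t \<longleftrightarrow> (\<forall>b b' p q r. b \<noteq> b' \<longrightarrow> {p, q, r} \<subseteq> curve_at \<Gamma> t b \<longrightarrow> {p, q, r} \<subseteq> curve_at \<Gamma> t b' \<longrightarrow> p \<noteq> q \<longrightarrow> q \<noteq> r \<longrightarrow> p = r)"

lemma sparse_translatesD:
  assumes "sparse_translates \<Gamma> t" "{p, q, r} \<subseteq> curve_at \<Gamma> t b" "{p, q, r} \<subseteq> curve_at \<Gamma> t b'" "p \<noteq> q" "q \<noteq> r" "p \<noteq> r"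
  shows "b = b'"
  using assms unfolding sparse_translates_def by metis

lemma curve_at_iff: "p \<in> curve_at \<Gamma> t b \<longleftrightarrow> p - b \<in> curve_at \<Gamma> t 0"
  by (auto simp: curve_at_def image_iff algebra_simps)

lemma translates_family_curve_at: "translates_family \<Gamma> t A B = {curve_at \<Gamma> t b \<inter> A | b. b \<in> B}"
  by (simp add: translates_family_def curve_at_def)

lemma sparse_translatesI:
  fixes K :: "plane set"
  assumes sc: "\<And>x y z. x \<in> K \<Longrightarrow> y \<in> K \<Longrightarrow> x \<noteq> y \<Longrightarrow> z \<in> open_segment x y \<Longrightarrow> z \<in> interior K"
    and cl: "closed K" and t: "0 < t"
  shows "sparse_translates (frontier K) t"
  unfolding sparse_translates_def
proof (intro allI impI, rule ccontr)
  fix b b' p q r assume b: "b \<noteq> b'" and s: "{p, q, r} \<subseteq> curve_at (frontier K) t b" "{p, q, r} \<subseteq> curve_at (frontier K) t b'" and ne: "p \<noteq> q" "q \<noteq> r" "p \<noteq> r"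
  define f where "f = (\<lambda>x. (1 / t) *\<^sub>R (x - b))"
  have d0: "(1 / t) *\<^sub>R (b' - b) \<noteq> 0" using b t by simp
  have m: "f x \<in> frontier K \<and> f x - (1 / t) *\<^sub>R (b' - b) \<in> frontier K" if "x \<in> {p, q, r}" for x
  proof -
    have "x \<in> curve_at (frontier K) t b" "x \<in> curve_at (frontier K) t b'" using s that by auto
    then obtain g g' where g: "g \<in> frontier K" "x = b + t *\<^sub>R g" "g' \<in> frontier K" "x = b' + t *\<^sub>R g'" unfolding curve_at_def by blast
    have "f x = g" using g(2) t by (simp add: f_def)
    moreover have "f x - (1 / t) *\<^sub>R (b' - b) = (1 / t) *\<^sub>R (x - b')" by (simp add: f_def algebra_simps)
    then have "f x - (1 / t) *\<^sub>R (b' - b) = g'" using g(4) t by simp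
    ultimately show ?thesis using g by simp
  qed
  have "f p \<noteq> f q" "f q \<noteq> f r" "f p \<noteq> f r" using ne t by (auto simp: f_def)
  show False
  proof (rule two_translates[of K "(1 / t) *\<^sub>R (b' - b)" "f p" "f q" "f r"])
    show "z \<in> interior K" if "x \<in> K" "y \<in> K" "x \<noteq> y" "z \<in> open_segment x y" for x y z by (rule sc[OF that])
    show "y \<in> frontier K \<and> y - (1 / t) *\<^sub>R (b' - b) \<in> frontier K" if "y \<in> {f p, f q, f r}" for y using that m by blast
  qed (fact+)
qed

text \<open>A curve through all of \<open>C\<close> and one that meets \<open>C\<close> in exactly
  three points have different centres when \<open>C\<close> has more than three points, yet they
  share three points.\<close>

lemma shattered_card_le:
  assumes "sparse_translates \<Gamma> t" "finite C" "shattered (translates_family \<Gamma> t A B) C"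
  shows "card C \<le> 3"
proof (rule ccontr)
  assume "\<not> card C \<le> 3"
  then obtain D where D: "D \<subseteq> C" "card D = 3" by (metis obtain_subset_with_card_n nat_le_linear)
  then obtain p q r where pqr: "D = {p, q, r}" "p \<noteq> q" "q \<noteq> r" "p \<noteq> r" by (auto simp: card_3_iff)
  obtain b where b: "curve_at \<Gamma> t b \<inter> A \<inter> C = C"
    using assms(3) unfolding shattered_def translates_family_curve_at by blast
  obtain b' where b': "curve_at \<Gamma> t b' \<inter> A \<inter> C = D"
    using assms(3) D(1) unfolding shattered_def translates_family_curve_at by blast
  have "b \<noteq> b'" using b b' D \<open>\<not> card C \<le> 3\<close> by auto
  moreover have "{p, q, r} \<subseteq> curve_at \<Gamma> t b" "{p, q, r} \<subseteq> curve_at \<Gamma> t b'" using b b' D(1) pqr(1) by auto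
  ultimately show False using sparse_translatesD[OF assms(1) _ _ pqr(2-4)] by blast
qed

lemma VC_dim_eq_3:
  assumes "sparse_translates \<Gamma> t" "card C = 3" "shattered (translates_family \<Gamma> t A B) C"
  shows "VC_dim UNIV (translates_family \<Gamma> t A B) = 3"
  unfolding VC_dim_def
proof (rule antisym)
  show "Sup {enat n |n. n > 0 \<and> (\<exists>C\<subseteq>UNIV. finite C \<and> card C = n \<and> shattered (translates_family \<Gamma> t A B) C)} \<le> 3"
  proof (rule Sup_least)
    fix e assume "e \<in> {enat n |n. n > 0 \<and> (\<exists>C\<subseteq>UNIV. finite C \<and> card C = n \<and> shattered (translates_family \<Gamma> t A B) C)}"
    then obtain C where "e = enat (card C)" "finite C" "shattered (translates_family \<Gamma> t A B) C" by auto
    with shattered_card_le[OF assms(1)] show "e \<le> 3" by (metis enat_ord_simps(1) numeral_eq_enat)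
  qed
  have "finite C" using assms(2) by (metis card.infinite zero_neq_numeral)
  then show "3 \<le> Sup {enat n |n. n > 0 \<and> (\<exists>C\<subseteq>UNIV. finite C \<and> card C = n \<and> shattered (translates_family \<Gamma> t A B) C)}"
    by (intro Sup_upper) (use assms in \<open>auto simp: numeral_eq_enat intro!: exI[of _ 3] exI[of _ C]\<close>)
qed

text \<open>The centre \<open>x\<close> cuts out all three points, x + v_i + v_j the points i and j
  by symmetry of the curve, x + v_i + s_i the point i alone, and \<open>b0\<close> none. The
  exclusions for single points and for the empty set are hypotheses; those for pairs follow from
  \<open>sp\<close>.\<close>

lemma shattered_config:
  assumes sp: "sparse_translates \<Gamma> t" and sym: "uminus ` \<Gamma> = \<Gamma>"
    and v: "{v1, v2, v3} \<subseteq> curve_at \<Gamma> t 0" "v1 \<noteq> v2" "v2 \<noteq> v3" "v1 \<noteq> v3" "v1 + v2 \<noteq> 0" "v1 + v3 \<noteq> 0" "v2 + v3 \<noteq> 0"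
    and B: "{x, x + v1 + v2, x + v1 + v3, x + v2 + v3, x + v1 + s1, x + v2 + s2, x + v3 + s3, b0} \<subseteq> B"
    and A: "{x + v1, x + v2, x + v3} \<subseteq> A"
    and s: "{s1, s2, s3} \<subseteq> curve_at \<Gamma> t 0"
    and s1: "v2 - v1 - s1 \<notin> curve_at \<Gamma> t 0" "v3 - v1 - s1 \<notin> curve_at \<Gamma> t 0"
    and s2: "v1 - v2 - s2 \<notin> curve_at \<Gamma> t 0" "v3 - v2 - s2 \<notin> curve_at \<Gamma> t 0"
    and s3: "v1 - v3 - s3 \<notin> curve_at \<Gamma> t 0" "v2 - v3 - s3 \<notin> curve_at \<Gamma> t 0"
    and b0: "x + v1 - b0 \<notin> curve_at \<Gamma> t 0" "x + v2 - b0 \<notin> curve_at \<Gamma> t 0" "x + v3 - b0 \<notin> curve_at \<Gamma> t 0"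
  shows "shattered (translates_family \<Gamma> t A B) {x + v1, x + v2, x + v3}"
proof -
  let ?G = "curve_at \<Gamma> t 0" and ?F = "translates_family \<Gamma> t A B"
  let ?p1 = "x + v1" and ?p2 = "x + v2" and ?p3 = "x + v3"
  have neg: "- v \<in> ?G" if vG: "v \<in> ?G" for v
  proof -
    obtain g where g: "g \<in> \<Gamma>" "v = t *\<^sub>R g" using vG by (auto simp: curve_at_def)
    have "- g \<in> \<Gamma>" using sym g(1) by blast
    moreover have "- v = 0 + t *\<^sub>R (- g)" using g(2) by simp
    ultimately show ?thesis unfolding curve_at_def by blast
  qed
  have mem: "\<exists>S\<in>?F. S \<inter> {?p1, ?p2, ?p3} = D"
    if b: "b \<in> B" and w: "x + v1 = b + w1" "x + v2 = b + w2" "x + v3 = b + w3"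
      and D: "(?p1 \<in> D) = (w1 \<in> ?G)" "(?p2 \<in> D) = (w2 \<in> ?G)" "(?p3 \<in> D) = (w3 \<in> ?G)" "D \<subseteq> {?p1, ?p2, ?p3}" for b D w1 w2 w3
  proof (rule bexI)
    show "curve_at \<Gamma> t b \<inter> A \<in> ?F" using b unfolding translates_family_curve_at by blast
    have "?p1 \<in> curve_at \<Gamma> t b \<longleftrightarrow> w1 \<in> ?G" "?p2 \<in> curve_at \<Gamma> t b \<longleftrightarrow> w2 \<in> ?G" "?p3 \<in> curve_at \<Gamma> t b \<longleftrightarrow> w3 \<in> ?G"
      unfolding w by (subst curve_at_iff, simp)+
    then show "curve_at \<Gamma> t b \<inter> A \<inter> {?p1, ?p2, ?p3} = D" using D A by blast
  qed
  have three: "w = 0" if "{v1, v2, v3} \<subseteq> curve_at \<Gamma> t w" for w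
    using sparse_translatesD[OF sp that v(1) v(2-4)] .
  \<comment> \<open>If the third point were on the curve centred at \<open>u + u'\<close>, this
    curve and the one centred at 0 would share three points, forcing
    \<open>u + u' = 0\<close>.\<close>
  have c: "w - (u + u') \<notin> ?G" if "{u, u', w} = {v1, v2, v3}" "u + u' \<noteq> 0" for u u' w
  proof
    assume w: "w - (u + u') \<in> ?G"
    have "u \<in> {v1, v2, v3}" "u' \<in> {v1, v2, v3}" using that(1) by blast+
    then have "u \<in> ?G" "u' \<in> ?G" using v(1) by blast+
    then have "u - (u + u') \<in> ?G" "u' - (u + u') \<in> ?G" using neg[of u] neg[of u'] by simp_all
    with w have "{u, u', w} \<subseteq> curve_at \<Gamma> t (u + u')" using curve_at_iff by blast
    then show False using three that by auto
  qed
  note c12 = c[of v1 v2 v3] and c13 = c[of v1 v3 v2] and c23 = c[of v2 v3 v1]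
  have r: "?p1 \<noteq> ?p2" "?p2 \<noteq> ?p3" "?p1 \<noteq> ?p3" "?p2 \<noteq> ?p1" "?p3 \<noteq> ?p2" "?p3 \<noteq> ?p1" using v by auto
  have vm: "v1 \<in> ?G" "v2 \<in> ?G" "v3 \<in> ?G" "- v1 \<in> ?G" "- v2 \<in> ?G" "- v3 \<in> ?G" "- s1 \<in> ?G" "- s2 \<in> ?G" "- s3 \<in> ?G"
    using v(1) s neg by auto
  have c': "v3 - (v1 + v2) \<notin> ?G" "v2 - (v1 + v3) \<notin> ?G" "v1 - (v2 + v3) \<notin> ?G"
    using c12 c13 c23 v by (simp_all add: insert_commute)
  have "\<exists>S\<in>?F. S \<inter> {?p1, ?p2, ?p3} = D" if D: "D \<subseteq> {?p1, ?p2, ?p3}" for D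
  proof -
    consider "?p1 \<in> D" "?p2 \<in> D" "?p3 \<in> D" | "?p1 \<in> D" "?p2 \<in> D" "?p3 \<notin> D" | "?p1 \<in> D" "?p2 \<notin> D" "?p3 \<in> D"
      | "?p1 \<notin> D" "?p2 \<in> D" "?p3 \<in> D" | "?p1 \<in> D" "?p2 \<notin> D" "?p3 \<notin> D" | "?p1 \<notin> D" "?p2 \<in> D" "?p3 \<notin> D"
      | "?p1 \<notin> D" "?p2 \<notin> D" "?p3 \<in> D" | "?p1 \<notin> D" "?p2 \<notin> D" "?p3 \<notin> D" by blast
    then show ?thesis
    proof cases
      case 1 show ?thesis by (rule mem[of x v1 v2 v3]) (use 1 B D in \<open>simp_all add: vm\<close>)
    next
      case 2 show ?thesis by (rule mem[of "x + v1 + v2" "- v2" "- v1" "v3 - (v1 + v2)"]) (use 2 B D in \<open>simp_all add: vm c'\<close>)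
    next
      case 3 show ?thesis by (rule mem[of "x + v1 + v3" "- v3" "v2 - (v1 + v3)" "- v1"]) (use 3 B D in \<open>simp_all add: vm c'\<close>)
    next
      case 4 show ?thesis by (rule mem[of "x + v2 + v3" "v1 - (v2 + v3)" "- v3" "- v2"]) (use 4 B D in \<open>simp_all add: vm c'\<close>)
    next
      case 5 show ?thesis by (rule mem[of "x + v1 + s1" "- s1" "v2 - v1 - s1" "v3 - v1 - s1"]) (use 5 B D in \<open>simp_all add: vm s1\<close>)
    next
      case 6 show ?thesis by (rule mem[of "x + v2 + s2" "v1 - v2 - s2" "- s2" "v3 - v2 - s2"]) (use 6 B D in \<open>simp_all add: vm s2\<close>)
    next
      case 7 show ?thesis by (rule mem[of "x + v3 + s3" "v1 - v3 - s3" "v2 - v3 - s3" "- s3"]) (use 7 B D in \<open>simp_all add: vm s3\<close>)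
    next
      case 8 show ?thesis by (rule mem[of b0 "x + v1 - b0" "x + v2 - b0" "x + v3 - b0"]) (use 8 B D in \<open>simp_all add: b0\<close>)
    qed
  qed
  then show ?thesis unfolding shattered_def by blast
qed

text \<open>By curvature and continuity \<open>cross2 (\<gamma>'' s) (\<gamma>' s')\<close> is
  nonzero for independent small \<open>s\<close>, \<open>s'\<close>. The function
  \<open>cross2 (\<gamma>' u) (\<gamma>' s')\<close> of \<open>u\<close> vanishes at
  \<open>s'\<close>, and a second zero would by Rolle give a zero of its derivative.\<close>

lemma obtain_arc:
  assumes c: "closed_curve_param L \<gamma>" and nz: "\<And>t. signed_curvature \<gamma> t \<noteq> 0"
  obtains \<gamma>' l where "0 < l" "l < L" "\<And>s. (\<gamma> has_vector_derivative \<gamma>' s) (at s)"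
    "\<And>s s'. s \<in> {0..l} \<Longrightarrow> s' \<in> {0..l} \<Longrightarrow> s \<noteq> s' \<Longrightarrow> cross2 (\<gamma>' s) (\<gamma>' s') \<noteq> 0"
proof -
  have "smooth \<gamma>" and L: "0 < L" using c by (auto simp: closed_curve_param_def)
  from smooth_derivs[OF this(1)] obtain \<gamma>' \<gamma>'' where d: "\<And>s. (\<gamma> has_vector_derivative \<gamma>' s) (at s)" "\<And>s. (\<gamma>' has_vector_derivative \<gamma>'' s) (at s)"
    and co: "\<And>s. isCont \<gamma>'' s" and cross2: "\<And>s. cross2 (\<gamma>' s) (\<gamma>'' s) \<noteq> 0" using nz by metis
  have co': "isCont \<gamma>' s" for s by (rule has_vector_derivative_continuous[OF d(2)])
  let ?F = "\<lambda>z. cross2 (\<gamma>'' (fst z)) (\<gamma>' (snd z))"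
  have "isCont ?F (0, 0)"
  proof -
    have "isCont (\<lambda>z. \<gamma>'' (fst z)) (0 :: real, 0 :: real)" by (rule isCont_o2[OF _ co]) simp
    moreover have "isCont (\<lambda>z. \<gamma>' (snd z)) (0 :: real, 0 :: real)" by (rule isCont_o2[OF _ co']) simp
    ultimately show ?thesis unfolding cross2_def isCont_def by (intro tendsto_intros)
  qed
  moreover have "?F (0, 0) \<noteq> 0" using cross2[of 0] by (auto simp: cross2_def algebra_simps)
  ultimately obtain e where e: "0 < e" "\<And>z. dist (0, 0) z < e \<Longrightarrow> ?F z \<noteq> 0"
    using continuous_at_avoid[of "(0, 0)" ?F 0] by blast
  \<comment> \<open>\<open>e / 3\<close> keeps all pairs of parameters within distance
    \<open>2 * l < e\<close> of the origin; \<open>L / 2\<close> keeps the arc shorter than a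
    period, hence injective.\<close>
  define l where "l = min (e / 3) (L / 2)"
  have l: "0 < l" "l < L" "2 * l < e" using e(1) L by (auto simp: l_def min_def)
  have F: "cross2 (\<gamma>'' s) (\<gamma>' s') \<noteq> 0" if "s \<in> {0..l}" "s' \<in> {0..l}" for s s'
  proof -
    have "dist (0, 0) (s, s') \<le> \<bar>s\<bar> + \<bar>s'\<bar>" by (simp add: dist_Pair_Pair sqrt_sum_squares_le_sum_abs)
    also have "\<dots> < e" using that l by auto
    finally show ?thesis using e(2)[of "(s, s')"] by simp
  qed
  have crd: "((\<lambda>u. cross2 (\<gamma>' u) w) has_real_derivative cross2 (\<gamma>'' u) w) (at u)" for u w
  proof -
    have "((\<lambda>u. \<gamma>' u $ i) has_real_derivative \<gamma>'' u $ i) (at u)" for i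
      unfolding has_real_derivative_iff_has_vector_derivative
      by (rule bounded_linear.has_vector_derivative[OF bounded_linear_vec_nth d(2)])
    then show ?thesis unfolding cross2_def by (auto intro!: derivative_eq_intros)
  qed
  have ne: "cross2 (\<gamma>' s) (\<gamma>' s') \<noteq> 0" if ss: "s \<in> {0..l}" "s' \<in> {0..l}" "s \<noteq> s'" for s s'
  proof
    assume z: "cross2 (\<gamma>' s) (\<gamma>' s') = 0"
    let ?f = "\<lambda>u. cross2 (\<gamma>' u) (\<gamma>' s')"
    have "?f s' = 0" by (simp add: cross2_def)
    have dd: "(?f has_derivative (*) (cross2 (\<gamma>'' x) (\<gamma>' s'))) (at x)" for x using crd by (simp add: has_field_derivative_def)
    have co: "continuous_on S ?f" for S using crd by (meson DERIV_isCont continuous_at_imp_continuous_on)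
    have "\<exists>z. min s s' < z \<and> z < max s s' \<and> (*) (cross2 (\<gamma>'' z) (\<gamma>' s')) = (\<lambda>v. 0)"
      by (rule Rolle_deriv[OF _ _ co dd]) (use ss z \<open>?f s' = 0\<close> in \<open>auto simp: min_def max_def\<close>)
    then obtain z where z: "min s s' < z" "z < max s s'" "cross2 (\<gamma>'' z) (\<gamma>' s') * 1 = 0" by metis
    have "z \<in> {0..l}" using z(1,2) ss by (auto simp: min_def max_def split: if_splits)
    with F[OF this ss(2)] z(3) show False by simp
  qed
  show ?thesis by (rule that[OF l(1,2) d(1) ne])
qed

lemma AE_arc_measure_notin_finite:
  assumes c: "closed_curve_param L \<gamma>" and l: "0 < l" "l < L" and mg: "\<gamma> \<in> borel_measurable borel" and t: "0 < t" and F: "finite F"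
  shows "AE v in arc_measure \<gamma> l t. v \<notin> F"
proof -
  note [measurable_cong] = prob_unif_interval(2)[OF l(1)]
  note [measurable] = mg
  have FB [measurable]: "F \<in> sets borel" using F by (simp add: borel_closed finite_imp_closed)
  have "inj_on (\<lambda>\<theta>. t *\<^sub>R \<gamma> \<theta>) {0..l}"
    by (rule inj_onI, rule curve_inj[OF c]) (use l t in auto)
  then have "finite {\<theta> \<in> {0..l}. t *\<^sub>R \<gamma> \<theta> \<in> F}" using finite_inverse_image_gen[of F "\<lambda>\<theta>. t *\<^sub>R \<gamma> \<theta>" "{0..l}"] F by simp
  then have "{\<theta> \<in> {0..l}. t *\<^sub>R \<gamma> \<theta> \<in> F} \<in> null_sets lborel" by (rule finite_imp_null_set_lborel)
  then have "AE \<theta> in lborel. \<not> (\<theta> \<in> {0..l} \<and> t *\<^sub>R \<gamma> \<theta> \<in> F)" by (rule AE_I') auto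
  then have "AE \<theta> in unif_interval l. t *\<^sub>R \<gamma> \<theta> \<notin> F"
    unfolding unif_interval_def using l by (auto simp: AE_uniform_measure elim!: eventually_mono)
  then show ?thesis unfolding arc_measure_def by (subst AE_distr_iff) auto
qed

lemma AE_arc_measure_in: 
  assumes l: "0 < l" and mg: "\<gamma> \<in> borel_measurable borel" and G: "range \<gamma> = \<Gamma>" "curve_at \<Gamma> t 0 \<in> sets borel"
  shows "AE v in arc_measure \<gamma> l t. v \<in> curve_at \<Gamma> t 0"
proof -
  note [measurable_cong] = prob_unif_interval(2)[OF l(1)]
  note [measurable] = mg G(2)
  have "t *\<^sub>R \<gamma> \<theta> \<in> curve_at \<Gamma> t 0" for \<theta> using G(1) by (auto simp: curve_at_def)
  then show ?thesis unfolding arc_measure_def by (subst AE_distr_iff) auto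
qed

text \<open>A null \<open>B'\<close> gives zero at once. Otherwise, for every triple on the curve
  without coincidences or opposite shifts, the integrand vanishes at all \<open>x\<close>: nonzero
  weights would provide admissible s_i, and \<open>shattered_config\<close> a shattered set of three
  points. The excluded triples are null for the arc measure.\<close>

lemma config_count_zero:
  assumes c: "closed_curve_param L \<gamma>" and l: "0 < l" "l < L" and mg: "\<gamma> \<in> borel_measurable borel" and t: "0 < t"
    and G: "range \<gamma> = \<Gamma>" "compact \<Gamma>" "negligible \<Gamma>" "uminus ` \<Gamma> = \<Gamma>" and sp: "sparse_translates \<Gamma> t"
    and bad: "\<And>C. card C = 3 \<Longrightarrow> \<not> shattered (translates_family \<Gamma> t A B) C"
    and A': "A' \<in> sets borel" "A' \<subseteq> A" and B': "B' \<in> sets borel" "B' \<subseteq> B"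
  shows "config_count (indicat_real A') (indicat_real B') (arc_measure \<gamma> l t) = 0"
proof -
  let ?\<sigma> = "arc_measure \<gamma> l t" and ?a = "indicat_real A'" and ?c = "indicat_real B'" and ?G = "curve_at \<Gamma> t 0"
  note [measurable] = A'(1) B'(1)
  note p = bprob_arc_measure[OF l(1) mg, of t]
  let ?P = "config3 ?c (\<lambda>x. ?a x * avg ?\<sigma> ?c x) ?c"
  have compG: "compact (curve_at \<Gamma> t b)" for b unfolding curve_at_def
    by (intro compact_continuous_image continuous_intros G(2))
  then have Gb: "?G \<in> sets borel" by (simp add: borel_closed compact_imp_closed)
  have negG: "negligible (curve_at \<Gamma> t b)" for b
  proof -
    show ?thesis unfolding curve_at_def
      by (rule negligible_differentiable_image_negligible[OF order_refl G(3)]) simp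
  qed
  have symG: "- v \<in> ?G" if vG: "v \<in> ?G" for v
  proof -
    obtain g where g: "g \<in> \<Gamma>" "v = t *\<^sub>R g" using vG by (auto simp: curve_at_def)
    have "- g \<in> \<Gamma>" using G(4) g(1) by blast
    moreover have "- v = 0 + t *\<^sub>R (- g)" using g(2) by simp
    ultimately show ?thesis unfolding curve_at_def by blast
  qed
  \<comment> \<open>By symmetry these \<open>s\<close> are the common points of the curves centred
    at \<open>0\<close> and at \<open>w\<close>, of which there are at most two.\<close>
  have fin: "finite {s \<in> ?G. w - s \<in> ?G}" if "w \<noteq> 0" for w
  proof (rule ccontr)
    assume "infinite {s \<in> ?G. w - s \<in> ?G}"
    from infinite_arbitrarily_large[OF this, of 3] obtain S where S: "S \<subseteq> {s \<in> ?G. w - s \<in> ?G}" "card S = 3" by blast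
    from S(2) obtain p q r where pqr: "S = {p, q, r}" "p \<noteq> q" "q \<noteq> r" "p \<noteq> r" unfolding card_3_iff by blast
    have "s \<in> curve_at \<Gamma> t w" if "s \<in> S" for s
    proof -
      have "- (w - s) \<in> ?G" using S(1) that symG by blast
      then show ?thesis by (subst curve_at_iff) simp
    qed
    then have "{p, q, r} \<subseteq> curve_at \<Gamma> t w" "{p, q, r} \<subseteq> curve_at \<Gamma> t 0" using S(1) pqr(1) by auto
    then show False using sparse_translatesD[OF sp _ _ pqr(2-4)] that by blast
  qed
  have zero: "?P v1 v2 v3 = 0"
    if v: "v1 \<in> ?G" "v2 \<in> ?G" "v3 \<in> ?G" "v1 \<noteq> v2" "v2 \<noteq> v3" "v1 \<noteq> v3" "v1 + v2 \<noteq> 0" "v1 + v3 \<noteq> 0" "v2 + v3 \<noteq> 0" for v1 v2 v3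
  proof (cases "emeasure lborel B' = 0")
    case True
    then have "AE x in lborel. x \<notin> B'" by (intro AE_not_in) (auto simp: null_sets_def)
    then show ?thesis unfolding config3_def by (intro integral_eq_zero_AE) (auto elim!: eventually_mono)
  next
    case False
    have zz: "?c x * (?a (x + v1) * avg ?\<sigma> ?c (x + v1)) * (?a (x + v2) * avg ?\<sigma> ?c (x + v2)) * (?a (x + v3) * avg ?\<sigma> ?c (x + v3)) *
       (?c (x + v1 + v2) * ?c (x + v1 + v3) * ?c (x + v2 + v3)) = 0" for x
    proof (rule ccontr)
      assume nz: "\<not> ?thesis"
      have B: "{x, x + v1 + v2, x + v1 + v3, x + v2 + v3} \<subseteq> B'" and A: "{x + v1, x + v2, x + v3} \<subseteq> A'" using nz by (auto simp: indicator_def split: if_splits)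
      \<comment> \<open>The finitely many excluded \<open>s\<close> are null for the arc measure, so
        a nonzero average requires one outside them.\<close>
      have av: "\<exists>s\<in>?G. y + s \<in> B' \<and> w - s \<notin> ?G \<and> w' - s \<notin> ?G" if "avg ?\<sigma> ?c y \<noteq> 0" "w \<noteq> 0" "w' \<noteq> 0" for y w w'
      proof (rule ccontr)
        assume no: "\<not> ?thesis"
        have f: "finite ({s \<in> ?G. w - s \<in> ?G} \<union> {s \<in> ?G. w' - s \<in> ?G})" using fin that by auto
        have "AE s in ?\<sigma>. ?c (y + s) = 0"
          using AE_arc_measure_in[OF l(1) mg G(1) Gb] AE_arc_measure_notin_finite[OF c l mg t f]
          by eventually_elim (use no in \<open>auto simp: indicator_def\<close>)
        then have "avg ?\<sigma> ?c y = 0" unfolding avg_def by (rule integral_eq_zero_AE)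
        with that(1) show False by simp
      qed
      have ne: "avg ?\<sigma> ?c (x + v1) \<noteq> 0" "avg ?\<sigma> ?c (x + v2) \<noteq> 0" "avg ?\<sigma> ?c (x + v3) \<noteq> 0" using nz by auto
      obtain s1 where s1: "s1 \<in> ?G" "x + v1 + s1 \<in> B'" "v2 - v1 - s1 \<notin> ?G" "v3 - v1 - s1 \<notin> ?G" using av[OF ne(1), of "v2 - v1" "v3 - v1"] v by auto
      obtain s2 where s2: "s2 \<in> ?G" "x + v2 + s2 \<in> B'" "v1 - v2 - s2 \<notin> ?G" "v3 - v2 - s2 \<notin> ?G" using av[OF ne(2), of "v1 - v2" "v3 - v2"] v by auto
      obtain s3 where s3: "s3 \<in> ?G" "x + v3 + s3 \<in> B'" "v1 - v3 - s3 \<notin> ?G" "v2 - v3 - s3 \<notin> ?G" using av[OF ne(3), of "v1 - v3" "v2 - v3"] v by auto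
      \<comment> \<open>The centre for the empty set: three curves are null and cannot cover
        \<open>B'\<close>.\<close>
      have "negligible (curve_at \<Gamma> t (x + v1) \<union> curve_at \<Gamma> t (x + v2) \<union> curve_at \<Gamma> t (x + v3))" by (intro negligible_Un negG)
      moreover have "\<not> negligible B'" using False by (simp add: negligible_iff_null_sets null_sets_completion_iff null_sets_def)
      ultimately obtain b0 where b0: "b0 \<in> B'" "b0 \<notin> curve_at \<Gamma> t (x + v1) \<union> curve_at \<Gamma> t (x + v2) \<union> curve_at \<Gamma> t (x + v3)"
        using negligible_subset by (meson subsetI)
      have b0': "y - b0 \<notin> ?G" if "b0 \<notin> curve_at \<Gamma> t y" for y using that symG[of "y - b0"] curve_at_iff[of b0 \<Gamma> t y] by auto
      have "shattered (translates_family \<Gamma> t A B) {x + v1, x + v2, x + v3}"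
        by (rule shattered_config[OF sp G(4), of v1 v2 v3 x s1 s2 s3 b0]) (use v A B s1 s2 s3 b0 b0' A'(2) B'(2) in auto)
      moreover have "card {x + v1, x + v2, x + v3} = 3" using v by simp
      ultimately show False using bad by blast
    qed
    show ?thesis unfolding config3_def by (rule integral_eq_zero_AE, rule AE_I2, rule zz)
  qed
  have "AE v1 in ?\<sigma>. AE v2 in ?\<sigma>. AE v3 in ?\<sigma>. ?P v1 v2 v3 = 0"
    using AE_arc_measure_in[OF l(1) mg G(1) Gb]
  proof eventually_elim
    case (elim v1)
    note e1 = elim
    have "AE v2 in ?\<sigma>. v2 \<notin> {v1, - v1}" by (rule AE_arc_measure_notin_finite[OF c l mg t]) simp
    then show ?case using AE_arc_measure_in[OF l(1) mg G(1) Gb]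
    proof eventually_elim
      case (elim v2)
      note e2 = elim
      have "AE v3 in ?\<sigma>. v3 \<notin> {v1, - v1, v2, - v2}" by (rule AE_arc_measure_notin_finite[OF c l mg t]) simp
      then show ?case using AE_arc_measure_in[OF l(1) mg G(1) Gb]
        by eventually_elim (rule zero, use e1 e2 in \<open>auto simp: add_eq_0_iff\<close>)
    qed
  qed
  then show ?thesis unfolding config_count_def config_avg_def integral3_def
    by (intro integral_eq_zero_AE) (auto elim!: eventually_mono intro!: integral_eq_zero_AE)
qed

section \<open>The density and its Borel reduction\<close>

text \<open>The infimum over \<open>r\<close> inside the supremum over \<open>z\<close> gives one
  \<open>z\<close> that serves all \<open>r\<close> in the range, and the limit superior gives
  arbitrarily large \<open>R\<close> for fixed \<open>M\<close> and \<open>c\<close>. So the scale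
  may be selected after the window.\<close>

lemma delta_unpack:
  assumes "0 < delta_VC A B"
  obtains c M where "0 < c" "1 \<le> (M :: real)"
    "\<And>R0. \<exists>R z. R0 \<le> R \<and> (\<forall>r\<in>{M..R / 2 ^ 6}. ennreal c \<le> delta_avg A B z R r)"
proof -
  let ?f = "\<lambda>M R. SUP z. INF r\<in>{M..R / 2 ^ 6}. delta_avg A B z R r"
  obtain M where M: "1 \<le> M" "0 < Limsup at_top (?f M)"
    using assms unfolding delta_VC_def less_SUP_iff by auto
  \<comment> \<open>A value strictly in between is finite, and an eventual upper bound by it
    contradicts the limit superior.\<close>
  obtain e where e: "0 < e" "e < Limsup at_top (?f M)" using dense[OF M(2)] by blast
  then have "e \<noteq> \<infinity>" by auto
  define c where "c = enn2real e"
  have ce: "ennreal c = e" using \<open>e \<noteq> \<infinity>\<close> by (simp add: c_def less_top)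
  have c: "0 < c" using e(1) ce by (metis ennreal_0 ennreal_less_zero_iff)
  show ?thesis
  proof (rule that[OF c M(1)], rule ccontr)
    fix R0 assume no: "\<not> (\<exists>R z. R0 \<le> R \<and> (\<forall>r\<in>{M..R / 2 ^ 6}. ennreal c \<le> delta_avg A B z R r))"
    have "?f M R \<le> e" if "R0 \<le> R" for R
    proof (rule SUP_least)
      fix z
      obtain r where r: "r \<in> {M..R / 2 ^ 6}" "\<not> ennreal c \<le> delta_avg A B z R r" using no \<open>R0 \<le> R\<close> by blast
      have "(INF r\<in>{M..R / 2 ^ 6}. delta_avg A B z R r) \<le> delta_avg A B z R r" by (rule INF_lower[OF r(1)])
      also have "\<dots> \<le> e" using r(2) ce by simp
      finally show "(INF r\<in>{M..R / 2 ^ 6}. delta_avg A B z R r) \<le> e" .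
    qed
    then have "eventually (\<lambda>R. ?f M R \<le> e) at_top" by (auto simp: eventually_at_top_linorder)
    then have "Limsup at_top (?f M) \<le> e" by (rule Limsup_bounded)
    with e(2) show False by simp
  qed
qed

section \<open>From the integral over six squares to the averaged count\<close>

lemma square_iff: "x \<in> square z p q \<longleftrightarrow> (\<forall>i. p \<le> x $ i - z $ i \<and> x $ i - z $ i \<le> q)"
proof
  assume "\<forall>i. p \<le> x $ i - z $ i \<and> x $ i - z $ i \<le> q"
  then show "x \<in> square z p q" unfolding square_def by (auto intro!: exI[of _ "x - z"])
qed (auto simp: square_def)

lemma square_cbox: "square z p q = cbox (\<chi> i. z $ i + p) (\<chi> i. z $ i + q)"
  by (auto simp: square_iff mem_box_cart algebra_simps)

lemma square_sq: "square 0 (- r) r = sq r"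
  unfolding square_cbox sq_cbox by simp

lemma square_borel [measurable, simp]: "square z p q \<in> sets borel" by (simp add: square_cbox)

lemma nn_integral_bprob:
  fixes f :: "plane \<Rightarrow> real"
  assumes "bprob \<mu>" "f \<in> borel_measurable borel" "\<And>x. 0 \<le> f x" "\<And>x. f x \<le> C"
  shows "(\<integral>\<^sup>+x. ennreal (f x) \<partial>\<mu>) = ennreal (\<integral>x. f x \<partial>\<mu>)"
  by (rule nn_integral_eq_integral[OF bprob_integrable[OF assms(1,2)]]) (use assms(3,4) in \<open>auto simp: abs_le_iff intro: order_trans[of _ 0]\<close>)

lemma nn_integral_square:
  assumes "0 < r" and [measurable]: "f \<in> borel_measurable borel"
  shows "(\<integral>\<^sup>+v. f v * indicator (sq r) v \<partial>lborel) = ennreal (4 * r\<^sup>2) * (\<integral>\<^sup>+v. f v \<partial>usq r)"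
proof -
  have e: "emeasure lborel (sq r) = ennreal (4 * r\<^sup>2)" using measure_sq(2)[of r] assms(1) by simp
  have "(\<integral>\<^sup>+v. f v \<partial>usq r) = (\<integral>\<^sup>+v. f v * indicator (sq r) v \<partial>lborel) / ennreal (4 * r\<^sup>2)"
    unfolding usq_def by (subst nn_integral_uniform_measure) (auto simp: e)
  then show ?thesis using assms(1) by (simp add: ennreal_times_divide mult.commute ennreal_mult_divide_eq)
qed

lemma nn_integral_square_pair:
  fixes F :: "plane \<times> 'b :: euclidean_space \<Rightarrow> ennreal"
  assumes "0 < r" and F [measurable]: "F \<in> borel_measurable (borel \<Otimes>\<^sub>M borel)" and S [measurable]: "S \<in> sets borel"
  shows "(\<integral>\<^sup>+p. F p * indicator (sq r \<times> S) p \<partial>lborel) = ennreal (4 * r\<^sup>2) * (\<integral>\<^sup>+v. (\<integral>\<^sup>+q. F (v, q) * indicator S q \<partial>lborel) \<partial>usq r)"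
proof -
  have "(\<integral>\<^sup>+p. F p * indicator (sq r \<times> S) p \<partial>lborel) = (\<integral>\<^sup>+p. F p * indicator (sq r \<times> S) p \<partial>(lborel \<Otimes>\<^sub>M lborel))"
    by (simp only: lborel_prod)
  also have "\<dots> = (\<integral>\<^sup>+v. \<integral>\<^sup>+q. F (v, q) * indicator (sq r \<times> S) (v, q) \<partial>lborel \<partial>lborel)"
    by (rule lborel.nn_integral_fst[symmetric]) measurable
  also have "\<dots> = (\<integral>\<^sup>+v. (\<integral>\<^sup>+q. F (v, q) * indicator S q \<partial>lborel) * indicator (sq r) v \<partial>lborel)"
    by (intro nn_integral_cong) (auto simp: indicator_def)
  also have "\<dots> = ennreal (4 * r\<^sup>2) * (\<integral>\<^sup>+v. (\<integral>\<^sup>+q. F (v, q) * indicator S q \<partial>lborel) \<partial>usq r)"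
    by (rule nn_integral_square[OF assms(1)]) measurable
  finally show ?thesis .
qed

lemma measurable_slice:
  assumes "case_prod G \<in> borel_measurable (borel \<Otimes>\<^sub>M N)" shows "G x \<in> borel_measurable N"
proof -
  have "(\<lambda>y. case_prod G (x, y)) \<in> borel_measurable N"
    by (rule measurable_compose[OF _ assms]) (simp add: measurable_Pair1')
  then show ?thesis by simp
qed

lemma nn_integral_square6:
  fixes F :: "plane \<Rightarrow> plane \<Rightarrow> plane \<Rightarrow> plane \<Rightarrow> plane \<Rightarrow> plane \<Rightarrow> ennreal"
  assumes r: "0 < r" and F: "(\<lambda>(a, b, c, d, e, f). F a b c d e f) \<in> borel_measurable (borel \<Otimes>\<^sub>M borel \<Otimes>\<^sub>M borel \<Otimes>\<^sub>M borel \<Otimes>\<^sub>M borel \<Otimes>\<^sub>M borel)"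
  shows "(\<integral>\<^sup>+(a, b, c, d, e, f)\<in>sq r \<times> sq r \<times> sq r \<times> sq r \<times> sq r \<times> sq r. F a b c d e f \<partial>lborel)
    = ennreal ((2 * r) ^ 12) * (\<integral>\<^sup>+a. \<integral>\<^sup>+b. \<integral>\<^sup>+c. \<integral>\<^sup>+d. \<integral>\<^sup>+e. \<integral>\<^sup>+f. F a b c d e f \<partial>usq r \<partial>usq r \<partial>usq r \<partial>usq r \<partial>usq r \<partial>usq r)"
proof -
  let ?k = "ennreal (4 * r\<^sup>2)"
  note [measurable_cong] = bprobD(2)[OF bprob_usq[OF r]]
  interpret prob_space "usq r" by (rule bprobD(1)[OF bprob_usq[OF r]])
  have s: "sq r \<times> sq r \<in> sets (borel :: (plane \<times> plane) measure)" "sq r \<times> sq r \<times> sq r \<in> sets (borel :: (plane \<times> plane \<times> plane) measure)"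
    "sq r \<times> sq r \<times> sq r \<times> sq r \<in> sets (borel :: (plane \<times> plane \<times> plane \<times> plane) measure)"
    "sq r \<times> sq r \<times> sq r \<times> sq r \<times> sq r \<in> sets (borel :: (plane \<times> plane \<times> plane \<times> plane \<times> plane) measure)"
    by (auto intro!: borel_closed closed_Times simp: sq_cbox)
  note m6 [measurable] = F
  have m5: "(\<lambda>(b, c, d, e, f). F a b c d e f) \<in> borel_measurable (borel \<Otimes>\<^sub>M borel \<Otimes>\<^sub>M borel \<Otimes>\<^sub>M borel \<Otimes>\<^sub>M borel)" for a
    by (rule measurable_slice[OF F])
  have m4: "(\<lambda>(c, d, e, f). F a b c d e f) \<in> borel_measurable (borel \<Otimes>\<^sub>M borel \<Otimes>\<^sub>M borel \<Otimes>\<^sub>M borel)" for a b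
    by (rule measurable_slice[OF m5])
  have m3: "(\<lambda>(d, e, f). F a b c d e f) \<in> borel_measurable (borel \<Otimes>\<^sub>M borel \<Otimes>\<^sub>M borel)" for a b c
    by (rule measurable_slice[OF m4])
  have m2: "(\<lambda>(e, f). F a b c d e f) \<in> borel_measurable (borel \<Otimes>\<^sub>M borel)" for a b c d
    by (rule measurable_slice[OF m3])
  have m1: "(\<lambda>f. F a b c d e f) \<in> borel_measurable borel" for a b c d e
    by (rule measurable_slice[OF m2])
  have i1: "(\<integral>\<^sup>+f. F a b c d e f * indicator (sq r) f \<partial>lborel) = ?k * (\<integral>\<^sup>+f. F a b c d e f \<partial>usq r)" for a b c d e
    by (rule nn_integral_square[OF r m1])
  \<comment> \<open>The iterated integrals over the last variables, as functions of tuples; their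
    measurability allows the constants \<open>?k\<close> to be pulled out.\<close>
  define G6 where "G6 = (\<lambda>(a, b, c, d, e, f). F a b c d e f)"
  have [measurable]: "G6 \<in> borel_measurable (borel \<Otimes>\<^sub>M borel \<Otimes>\<^sub>M borel \<Otimes>\<^sub>M borel \<Otimes>\<^sub>M borel \<Otimes>\<^sub>M borel)" unfolding G6_def by (rule F)
  define G5 where "G5 = (\<lambda>x. \<integral>\<^sup>+z. G6 (fst x, fst (snd x), fst (snd (snd x)), fst (snd (snd (snd x))), snd (snd (snd (snd x))), z) \<partial>usq r)"
  have [measurable]: "G5 \<in> borel_measurable (borel \<Otimes>\<^sub>M borel \<Otimes>\<^sub>M borel \<Otimes>\<^sub>M borel \<Otimes>\<^sub>M borel)" unfolding G5_def by measurable
  define G4 where "G4 = (\<lambda>x. \<integral>\<^sup>+z. G5 (fst x, fst (snd x), fst (snd (snd x)), snd (snd (snd x)), z) \<partial>usq r)"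
  have [measurable]: "G4 \<in> borel_measurable (borel \<Otimes>\<^sub>M borel \<Otimes>\<^sub>M borel \<Otimes>\<^sub>M borel)" unfolding G4_def by measurable
  define G3 where "G3 = (\<lambda>x. \<integral>\<^sup>+z. G4 (fst x, fst (snd x), snd (snd x), z) \<partial>usq r)"
  have [measurable]: "G3 \<in> borel_measurable (borel \<Otimes>\<^sub>M borel \<Otimes>\<^sub>M borel)" unfolding G3_def by measurable
  define G2 where "G2 = (\<lambda>x. \<integral>\<^sup>+z. G3 (fst x, snd x, z) \<partial>usq r)"
  have [measurable]: "G2 \<in> borel_measurable (borel \<Otimes>\<^sub>M borel)" unfolding G2_def by measurable
  note G_defs = G2_def G3_def G4_def G5_def G6_def
  have h2: "(\<lambda>b. \<integral>\<^sup>+c. \<integral>\<^sup>+d. \<integral>\<^sup>+e. \<integral>\<^sup>+f. F a b c d e f \<partial>usq r \<partial>usq r \<partial>usq r \<partial>usq r) \<in> borel_measurable (usq r)" for a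
  proof -
    have "(\<lambda>b. G2 (a, b)) \<in> borel_measurable (usq r)" by measurable
    then show ?thesis by (simp add: G_defs)
  qed
  have h1: "(\<lambda>a. \<integral>\<^sup>+b. \<integral>\<^sup>+c. \<integral>\<^sup>+d. \<integral>\<^sup>+e. \<integral>\<^sup>+f. F a b c d e f \<partial>usq r \<partial>usq r \<partial>usq r \<partial>usq r \<partial>usq r) \<in> borel_measurable (usq r)"
  proof -
    have "(\<lambda>a. \<integral>\<^sup>+b. G2 (a, b) \<partial>usq r) \<in> borel_measurable (usq r)" by measurable
    then show ?thesis by (simp add: G_defs)
  qed
  have h3: "(\<lambda>c. \<integral>\<^sup>+d. \<integral>\<^sup>+e. \<integral>\<^sup>+f. F a b c d e f \<partial>usq r \<partial>usq r \<partial>usq r) \<in> borel_measurable (usq r)" for a b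
  proof -
    have "(\<lambda>c. G3 (a, b, c)) \<in> borel_measurable (usq r)" by measurable
    then show ?thesis by (simp add: G_defs)
  qed
  have h4: "(\<lambda>d. \<integral>\<^sup>+e. \<integral>\<^sup>+f. F a b c d e f \<partial>usq r \<partial>usq r) \<in> borel_measurable (usq r)" for a b c
  proof -
    have "(\<lambda>d. G4 (a, b, c, d)) \<in> borel_measurable (usq r)" by measurable
    then show ?thesis by (simp add: G_defs)
  qed
  have h5: "(\<lambda>e. \<integral>\<^sup>+f. F a b c d e f \<partial>usq r) \<in> borel_measurable (usq r)" for a b c d
  proof -
    have "(\<lambda>e. G5 (a, b, c, d, e)) \<in> borel_measurable (usq r)" by measurable
    then show ?thesis by (simp add: G_defs)
  qed
  have "(\<integral>\<^sup>+(a, b, c, d, e, f)\<in>sq r \<times> sq r \<times> sq r \<times> sq r \<times> sq r \<times> sq r. F a b c d e f \<partial>lborel)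
    = ?k * (\<integral>\<^sup>+a. (\<integral>\<^sup>+(b, c, d, e, f)\<in>sq r \<times> sq r \<times> sq r \<times> sq r \<times> sq r. F a b c d e f \<partial>lborel) \<partial>usq r)"
    using nn_integral_square_pair[OF r _ s(4), of "\<lambda>(a, b, c, d, e, f). F a b c d e f"] F by (simp add: borel_prod)
  also have "\<dots> = ?k * (\<integral>\<^sup>+a. ?k * (\<integral>\<^sup>+b. (\<integral>\<^sup>+(c, d, e, f)\<in>sq r \<times> sq r \<times> sq r \<times> sq r. F a b c d e f \<partial>lborel) \<partial>usq r) \<partial>usq r)"
    using nn_integral_square_pair[OF r _ s(3), of "\<lambda>(b, c, d, e, f). F a b c d e f" for a] m5 by (simp add: borel_prod)
  also have "\<dots> = ?k * (\<integral>\<^sup>+a. ?k * (\<integral>\<^sup>+b. ?k * (\<integral>\<^sup>+c. (\<integral>\<^sup>+(d, e, f)\<in>sq r \<times> sq r \<times> sq r. F a b c d e f \<partial>lborel) \<partial>usq r) \<partial>usq r) \<partial>usq r)"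
    using nn_integral_square_pair[OF r _ s(2), of "\<lambda>(c, d, e, f). F a b c d e f" for a b] m4 by (simp add: borel_prod)
  also have "\<dots> = ?k * (\<integral>\<^sup>+a. ?k * (\<integral>\<^sup>+b. ?k * (\<integral>\<^sup>+c. ?k * (\<integral>\<^sup>+d. (\<integral>\<^sup>+(e, f)\<in>sq r \<times> sq r. F a b c d e f \<partial>lborel) \<partial>usq r) \<partial>usq r) \<partial>usq r) \<partial>usq r)"
    using nn_integral_square_pair[OF r _ s(1), of "\<lambda>(d, e, f). F a b c d e f" for a b c] m3 by (simp add: borel_prod)
  also have "\<dots> = ?k * (\<integral>\<^sup>+a. ?k * (\<integral>\<^sup>+b. ?k * (\<integral>\<^sup>+c. ?k * (\<integral>\<^sup>+d. ?k * (\<integral>\<^sup>+e. ?k * (\<integral>\<^sup>+f. F a b c d e f \<partial>usq r) \<partial>usq r) \<partial>usq r) \<partial>usq r) \<partial>usq r) \<partial>usq r)"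
    using nn_integral_square_pair[OF r _ sq_borel, of "\<lambda>(e, f). F a b c d e f" for a b c d] m2 by (simp add: borel_prod i1)
  also have "\<dots> = ?k * (?k * (?k * (?k * (?k * (?k * (\<integral>\<^sup>+a. \<integral>\<^sup>+b. \<integral>\<^sup>+c. \<integral>\<^sup>+d. \<integral>\<^sup>+e. \<integral>\<^sup>+f. F a b c d e f \<partial>usq r \<partial>usq r \<partial>usq r \<partial>usq r \<partial>usq r \<partial>usq r))))))"
    by (simp only: mult.assoc[symmetric] nn_integral_cmult[OF h1] nn_integral_cmult[OF h2] nn_integral_cmult[OF h3] nn_integral_cmult[OF h4] nn_integral_cmult[OF h5])
  also have "\<dots> = ennreal ((2 * r) ^ 12) * (\<integral>\<^sup>+a. \<integral>\<^sup>+b. \<integral>\<^sup>+c. \<integral>\<^sup>+d. \<integral>\<^sup>+e. \<integral>\<^sup>+f. F a b c d e f \<partial>usq r \<partial>usq r \<partial>usq r \<partial>usq r \<partial>usq r \<partial>usq r)"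
  proof -
    have "?k * (?k * (?k * (?k * (?k * (?k * X))))) = ?k ^ 6 * X" for X by (simp add: eval_nat_numeral mult.assoc)
    moreover have "?k ^ 6 = ennreal ((2 * r) ^ 12)"
      using power_mult[of "2 * r" 2 6] r by (simp add: ennreal_power power_mult_distrib)
    ultimately show ?thesis by simp
  qed
  finally show ?thesis .
qed

text \<open>The superset serves for integrals of functions that need not be measurable on the product, the subset
  for configurations in the given set.\<close>
lemma lebesgue_borel_sandwich:
  assumes "A \<in> sets (lebesgue :: plane measure)"
  obtains A' A'' where "A' \<in> sets borel" "A'' \<in> sets borel" "A' \<subseteq> A" "A \<subseteq> A''" "AE x in lborel. x \<in> A'' \<longrightarrow> x \<in> A'"
proof -
  let ?P = "main_part lborel A"
  obtain N where N: "N \<in> null_sets lborel" "null_part lborel A \<subseteq> N" using null_part[OF assms] by blast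
  have P: "?P \<in> sets borel" using main_part_sets[OF assms] by simp
  have u: "?P \<union> null_part lborel A = A" by (rule main_part_null_part_Un[OF assms])
  show ?thesis
  proof (rule that[of ?P "?P \<union> N"])
    show "AE x in lborel. x \<in> ?P \<union> N \<longrightarrow> x \<in> ?P" using AE_not_in[OF N(1)] by eventually_elim auto
  qed (use P u N in auto)
qed

lemma AE_shift:
  assumes "AE x in (lborel :: plane measure). P x"
  shows "AE x in lborel. P (x + u)"
proof -
  have "AE x in distr lborel borel ((+) u). P x" by (subst lborel_distr_plus) (rule assms)
  then obtain N where N: "{x \<in> space (distr lborel borel ((+) u)). \<not> P x} \<subseteq> N" "emeasure (distr lborel borel ((+) u)) N = 0" "N \<in> sets (distr lborel borel ((+) u))"
    by (rule AE_E)
  have N': "N \<in> sets borel" using N(3) by simp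
  have "emeasure lborel ((+) u -` N \<inter> space lborel) = 0" using N(2) N' by (subst (asm) emeasure_distr) auto
  moreover have "(+) u -` N \<inter> space lborel \<in> sets lborel" by (rule measurable_sets[OF _ N']) measurable
  ultimately have "(+) u -` N \<inter> space lborel \<in> null_sets lborel" by (rule null_setsI)
  then show ?thesis by (rule AE_I') (use N(1) in \<open>auto simp: add.commute\<close>)
qed

lemma avg_usq_AE_cong:
  assumes "0 < r" "f \<in> borel_measurable borel" "g \<in> borel_measurable borel" "AE x in lborel. f x = (g x :: real)"
  shows "avg (usq r) f = avg (usq r) g"
proof
  fix y
  note [measurable] = assms(2,3)
  have "(LBINT u. indicator (sq r) u * f (y + u)) = (LBINT u. indicator (sq r) u * g (y + u))"
  proof (rule integral_cong_AE)
    show "AE u in lborel. indicator (sq r) u * f (y + u) = indicator (sq r) u * g (y + u)"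
      using AE_shift[OF assms(4), of y] by eventually_elim (simp add: add.commute)
  qed measurable
  then show "avg (usq r) f y = avg (usq r) g y" unfolding avg_def using assms(1) by (simp add: integral_usq)
qed

text \<open>Null sets stay null under shifts and are ignored by averages over squares, which have
  densities. Averages over an arc can see them, so sets are exchanged on the side of the square
  only.\<close>

lemma config_count_AE_cong:
  assumes r: "0 < r" and b: "a \<in> borel_measurable borel" "a' \<in> borel_measurable borel" "c \<in> borel_measurable borel" "c' \<in> borel_measurable borel"
    and ae: "AE x in lborel. a x = a' x" "AE x in lborel. c x = c' x"
  shows "config_count a c (usq r) = config_count a' c' (usq r)"
proof -
  note av = avg_usq_AE_cong[OF r b(3,4) ae(2)]
  note [measurable] = b avg_measurable[OF bprob_usq[OF r] b(4)]
  have P: "config3 c (\<lambda>x. a x * avg (usq r) c' x) c v1 v2 v3 = config3 c' (\<lambda>x. a' x * avg (usq r) c' x) c' v1 v2 v3" for v1 v2 v3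
    unfolding config3_def
  proof (rule integral_cong_AE)
    have "AE x in lborel. c (x + v1 + v2) = c' (x + v1 + v2)" "AE x in lborel. c (x + v1 + v3) = c' (x + v1 + v3)" "AE x in lborel. c (x + v2 + v3) = c' (x + v2 + v3)"
      using AE_shift[OF ae(2), of "v1 + v2"] AE_shift[OF ae(2), of "v1 + v3"] AE_shift[OF ae(2), of "v2 + v3"] by (simp_all add: add.assoc)
    then show "AE x in lborel. c x * (a (x + v1) * avg (usq r) c' (x + v1)) * (a (x + v2) * avg (usq r) c' (x + v2)) * (a (x + v3) * avg (usq r) c' (x + v3)) * (c (x + v1 + v2) * c (x + v1 + v3) * c (x + v2 + v3)) =
      c' x * (a' (x + v1) * avg (usq r) c' (x + v1)) * (a' (x + v2) * avg (usq r) c' (x + v2)) * (a' (x + v3) * avg (usq r) c' (x + v3)) * (c' (x + v1 + v2) * c' (x + v1 + v3) * c' (x + v2 + v3))"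
      using ae(2) AE_shift[OF ae(1), of v1] AE_shift[OF ae(1), of v2] AE_shift[OF ae(1), of v3]
      by eventually_elim simp
  qed measurable
  have "config3 c (\<lambda>x. a x * avg (usq r) c' x) c = config3 c' (\<lambda>x. a' x * avg (usq r) c' x) c'" by (intro ext P)
  then show ?thesis unfolding config_count_def config_avg_def av by simp
qed

lemma nn_swap_usq:
  fixes F :: "plane \<Rightarrow> plane \<Rightarrow> ennreal"
  assumes "0 < r" "case_prod F \<in> borel_measurable (borel \<Otimes>\<^sub>M borel)"
  shows "(\<integral>\<^sup>+x. \<integral>\<^sup>+v. F x v \<partial>usq r \<partial>lborel) = (\<integral>\<^sup>+v. \<integral>\<^sup>+x. F x v \<partial>lborel \<partial>usq r)"
proof -
  note [measurable_cong] = bprobD(2)[OF bprob_usq[OF assms(1)]]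
  note [measurable] = assms(2)
  interpret prob_space "usq r" by (rule bprobD(1)[OF bprob_usq[OF assms(1)]])
  interpret pair_sigma_finite "lborel :: plane measure" "usq r" ..
  show ?thesis by (rule Fubini'[symmetric]) measurable
qed

text \<open>For fixed \<open>x\<close>, \<open>v1\<close>, \<open>v2\<close>, \<open>v3\<close> the
  integrals over \<open>s1\<close>, \<open>s2\<close>, \<open>s3\<close> separate into averages of
  the indicator of \<open>B\<close>. The rest is Tonelli.\<close>

lemma FAB_integral_eq_config_count:
  assumes r: "0 < r" and A [measurable]: "A \<in> sets borel" "B \<in> sets borel" and V: "unit_fn V (indicat_real A)" "unit_fn V (indicat_real B)"
  shows "(\<integral>\<^sup>+x. (\<integral>\<^sup>+(v1, v2, v3, s1, s2, s3)\<in>sq r \<times> sq r \<times> sq r \<times> sq r \<times> sq r \<times> sq r. FAB A B x v1 v2 v3 s1 s2 s3 \<partial>lborel) \<partial>lborel)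
    = ennreal ((2 * r) ^ 12) * ennreal (config_count (indicat_real A) (indicat_real B) (usq r))"
proof -
  let ?a = "indicat_real A" and ?c = "indicat_real B"
  note p = bprob_usq[OF r]
  note [measurable_cong] = bprobD(2)[OF p]
  interpret prob_space "usq r" by (rule bprobD(1)[OF p])
  let ?f = "\<lambda>x. ?a x * avg (usq r) ?c x"
  have ca: "unit_fn V (avg (usq r) ?c)" by (rule unit_fn_avg[OF p V(2)])
  have cf: "unit_fn V ?f" by (rule unit_fn_mult[OF V(1) ca])
  note [measurable] = unit_fnD(1)[OF ca]
  define Q where "Q = (\<lambda>x v1 v2 v3. ?c x * ?a (x + v1) * ?a (x + v2) * ?a (x + v3) * (?c (x + v1 + v2) * ?c (x + v1 + v3) * ?c (x + v2 + v3)))"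
  define g where "g = (\<lambda>x v1 v2 v3. ?c x * ?f (x + v1) * ?f (x + v2) * ?f (x + v3) * (?c (x + v1 + v2) * ?c (x + v1 + v3) * ?c (x + v2 + v3)))"
  have Q: "0 \<le> Q x v1 v2 v3" "Q x v1 v2 v3 \<le> 1" for x v1 v2 v3 by (auto simp: Q_def indicator_def)
  have FQ: "FAB A B x v1 v2 v3 s1 s2 s3 = ennreal (Q x v1 v2 v3 * ?c (x + v1 + s1) * ?c (x + v2 + s2) * ?c (x + v3 + s3))" for x v1 v2 v3 s1 s2 s3
    by (auto simp: FAB_def Q_def indicator_def)
  have one: "(\<integral>\<^sup>+s. ennreal (k * ?c (y + s) * k') \<partial>usq r) = ennreal (k * avg (usq r) ?c y * k')" if "0 \<le> k" "0 \<le> k'" for k k' y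
  proof -
    have "(\<integral>\<^sup>+s. ennreal (k * ?c (y + s) * k') \<partial>usq r) = ennreal (\<integral>s. k * ?c (y + s) * k' \<partial>usq r)"
      by (rule nn_integral_bprob[OF p, where C="k * k'"]) (use that in \<open>auto simp: indicator_def\<close>)
    also have "(\<integral>s. k * ?c (y + s) * k' \<partial>usq r) = k * avg (usq r) ?c y * k'" by (simp add: avg_def)
    finally show ?thesis .
  qed
  have av0: "0 \<le> avg (usq r) ?c y" for y by (rule unit_fnD(2)[OF ca])
  have s: "(\<integral>\<^sup>+s1. \<integral>\<^sup>+s2. \<integral>\<^sup>+s3. FAB A B x v1 v2 v3 s1 s2 s3 \<partial>usq r \<partial>usq r \<partial>usq r) = ennreal (g x v1 v2 v3)" for x v1 v2 v3
  proof -
    have "(\<integral>\<^sup>+s1. \<integral>\<^sup>+s2. \<integral>\<^sup>+s3. FAB A B x v1 v2 v3 s1 s2 s3 \<partial>usq r \<partial>usq r \<partial>usq r)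
      = (\<integral>\<^sup>+s1. \<integral>\<^sup>+s2. ennreal (Q x v1 v2 v3 * ?c (x + v1 + s1) * ?c (x + v2 + s2) * avg (usq r) ?c (x + v3)) \<partial>usq r \<partial>usq r)"
      unfolding FQ using one[of "Q x v1 v2 v3 * ?c (x + v1 + s1) * ?c (x + v2 + s2)" 1 "x + v3" for s1 s2] Q by simp
    also have "\<dots> = (\<integral>\<^sup>+s1. ennreal (Q x v1 v2 v3 * ?c (x + v1 + s1) * avg (usq r) ?c (x + v2) * avg (usq r) ?c (x + v3)) \<partial>usq r)"
      using one[of "Q x v1 v2 v3 * ?c (x + v1 + s1)" "avg (usq r) ?c (x + v3)" "x + v2" for s1] Q av0 by simp
    also have "\<dots> = ennreal (Q x v1 v2 v3 * avg (usq r) ?c (x + v1) * (avg (usq r) ?c (x + v2) * avg (usq r) ?c (x + v3)))"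
      using one[of "Q x v1 v2 v3" "avg (usq r) ?c (x + v2) * avg (usq r) ?c (x + v3)" "x + v1"] Q av0 by (simp add: mult.assoc)
    also have "Q x v1 v2 v3 * avg (usq r) ?c (x + v1) * (avg (usq r) ?c (x + v2) * avg (usq r) ?c (x + v3)) = g x v1 v2 v3"
      by (simp add: Q_def g_def)
    finally show ?thesis .
  qed
  have mF: "(\<lambda>(v1, v2, v3, s1, s2, s3). FAB A B x v1 v2 v3 s1 s2 s3) \<in> borel_measurable (borel \<Otimes>\<^sub>M borel \<Otimes>\<^sub>M borel \<Otimes>\<^sub>M borel \<Otimes>\<^sub>M borel \<Otimes>\<^sub>M borel)" for x
    unfolding FAB_def by measurable
  have inner: "(\<integral>\<^sup>+(v1, v2, v3, s1, s2, s3)\<in>sq r \<times> sq r \<times> sq r \<times> sq r \<times> sq r \<times> sq r. FAB A B x v1 v2 v3 s1 s2 s3 \<partial>lborel)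
    = ennreal ((2 * r) ^ 12) * (\<integral>\<^sup>+v1. \<integral>\<^sup>+v2. \<integral>\<^sup>+v3. ennreal (g x v1 v2 v3) \<partial>usq r \<partial>usq r \<partial>usq r)" for x
    by (subst nn_integral_square6[OF r mF]) (simp only: s)
  define G where "G = (\<lambda>(x, v1, v2, v3). ennreal (g x v1 v2 v3))"
  have mG [measurable]: "G \<in> borel_measurable (borel \<Otimes>\<^sub>M borel \<Otimes>\<^sub>M borel \<Otimes>\<^sub>M borel)"
    unfolding G_def g_def by measurable
  have Gx: "(\<integral>\<^sup>+x. G (x, v1, v2, v3) \<partial>lborel) = ennreal (config3 ?c ?f ?c v1 v2 v3)" for v1 v2 v3
  proof -
    have cg: "unit_fn V (\<lambda>x. g x v1 v2 v3)" unfolding g_def add.assoc by (intro unit_fn_mult[where W=V] unit_fn_shift cf ca V)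
    have "(\<integral>\<^sup>+x. ennreal (g x v1 v2 v3) \<partial>lborel) = ennreal (LBINT x. g x v1 v2 v3)"
      by (rule nn_integral_eq_integral[OF unit_fnD(5)[OF cg]]) (use unit_fnD(2)[OF cg] in auto)
    then show ?thesis by (simp add: G_def config3_def g_def)
  qed
  have t: "kernel3 V (config3 ?c ?f ?c)" by (rule config3_kernel3(1)[OF V(2) cf V(2)])
  have P0: "0 \<le> config3 ?c ?f ?c v1 v2 v3" for v1 v2 v3 by (rule config3_kernel3(2)[OF V(2) cf V(2)])
  have PV: "config3 ?c ?f ?c v1 v2 v3 \<le> V" for v1 v2 v3 using kernel3D(2)[OF t, of v1 v2 v3] by simp
  have i1: "0 \<le> (\<integral>v3. config3 ?c ?f ?c v1 v2 v3 \<partial>usq r)" "(\<integral>v3. config3 ?c ?f ?c v1 v2 v3 \<partial>usq r) \<le> V" for v1 v2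
    by (rule bprob_integral_le[OF p kernel3_slice(1)[OF t] P0 PV])+
  have i2: "0 \<le> (\<integral>v2. \<integral>v3. config3 ?c ?f ?c v1 v2 v3 \<partial>usq r \<partial>usq r)" "(\<integral>v2. \<integral>v3. config3 ?c ?f ?c v1 v2 v3 \<partial>usq r \<partial>usq r) \<le> V" for v1
    by (rule bprob_integral_le[OF p kernel3_inner2(3)[OF p p t] i1])+
  have "(\<integral>\<^sup>+x. \<integral>\<^sup>+v1. \<integral>\<^sup>+v2. \<integral>\<^sup>+v3. G (x, v1, v2, v3) \<partial>usq r \<partial>usq r \<partial>usq r \<partial>lborel)
    = (\<integral>\<^sup>+v1. \<integral>\<^sup>+x. \<integral>\<^sup>+v2. \<integral>\<^sup>+v3. G (x, v1, v2, v3) \<partial>usq r \<partial>usq r \<partial>lborel \<partial>usq r)"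
    by (rule nn_swap_usq[OF r]) measurable
  also have "\<dots> = (\<integral>\<^sup>+v1. \<integral>\<^sup>+v2. \<integral>\<^sup>+x. \<integral>\<^sup>+v3. G (x, v1, v2, v3) \<partial>usq r \<partial>lborel \<partial>usq r \<partial>usq r)"
    by (intro nn_integral_cong nn_swap_usq[OF r]) measurable
  also have "\<dots> = (\<integral>\<^sup>+v1. \<integral>\<^sup>+v2. \<integral>\<^sup>+v3. \<integral>\<^sup>+x. G (x, v1, v2, v3) \<partial>lborel \<partial>usq r \<partial>usq r \<partial>usq r)"
    by (intro nn_integral_cong nn_swap_usq[OF r]) measurable
  also have "\<dots> = (\<integral>\<^sup>+v1. \<integral>\<^sup>+v2. \<integral>\<^sup>+v3. ennreal (config3 ?c ?f ?c v1 v2 v3) \<partial>usq r \<partial>usq r \<partial>usq r)"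
    by (simp only: Gx)
  also have "\<dots> = (\<integral>\<^sup>+v1. \<integral>\<^sup>+v2. ennreal (\<integral>v3. config3 ?c ?f ?c v1 v2 v3 \<partial>usq r) \<partial>usq r \<partial>usq r)"
    by (intro nn_integral_cong nn_integral_bprob[OF p kernel3_slice(1)[OF t] P0 PV])
  also have "\<dots> = (\<integral>\<^sup>+v1. ennreal (\<integral>v2. \<integral>v3. config3 ?c ?f ?c v1 v2 v3 \<partial>usq r \<partial>usq r) \<partial>usq r)"
    by (intro nn_integral_cong nn_integral_bprob[OF p kernel3_inner2(3)[OF p p t] i1])
  also have "\<dots> = ennreal (integral3 (usq r) (usq r) (usq r) (config3 ?c ?f ?c))"
    unfolding integral3_def by (rule nn_integral_bprob[OF p kernel3_inner2(1)[OF p p t] i2])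
  finally have main: "(\<integral>\<^sup>+x. \<integral>\<^sup>+v1. \<integral>\<^sup>+v2. \<integral>\<^sup>+v3. ennreal (g x v1 v2 v3) \<partial>usq r \<partial>usq r \<partial>usq r \<partial>lborel) = ennreal (config_count ?a ?c (usq r))"
    by (simp add: G_def config_count_def config_avg_def)
  have mm: "(\<lambda>x. \<integral>\<^sup>+v1. \<integral>\<^sup>+v2. \<integral>\<^sup>+v3. ennreal (g x v1 v2 v3) \<partial>usq r \<partial>usq r \<partial>usq r) \<in> borel_measurable lborel"
  proof -
    have "(\<lambda>x. \<integral>\<^sup>+v1. \<integral>\<^sup>+v2. \<integral>\<^sup>+v3. G (x, v1, v2, v3) \<partial>usq r \<partial>usq r \<partial>usq r) \<in> borel_measurable lborel" by measurable
    then show ?thesis by (simp add: G_def)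
  qed
  show ?thesis unfolding inner nn_integral_cmult[OF mm] main ..
qed

text \<open>A margin of \<open>R\<close> around the square of the base points \<open>x\<close>: each
  coordinate of a point of a configuration differs from that of \<open>x\<close> by at most
  \<open>2 * r \<le> R\<close>.\<close>

definition window :: "plane \<Rightarrow> real \<Rightarrow> plane set" where "window z R = square z (- R) (2 * R)"

lemma unit_fn_indicator:
  assumes "A \<in> sets borel" "A \<subseteq> square z p q" "p \<le> q" "(q - p)\<^sup>2 \<le> V"
  shows "unit_fn V (indicat_real A)"
proof -
  have f: "emeasure lborel (square z p q) < \<infinity>" unfolding square_cbox by (rule emeasure_lborel_cbox_finite)
  have "emeasure lborel A \<le> emeasure lborel (square z p q)" by (rule emeasure_mono[OF assms(2)]) simp
  with f have fA: "emeasure lborel A < \<infinity>" by (rule le_less_trans[rotated])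
  have "z + (\<chi> i. p) \<in> square z p q" using assms(3) by (auto simp: square_iff)
  then have "cbox (\<chi> i. z $ i + p) (\<chi> i. z $ i + q) \<noteq> ({} :: plane set)" unfolding square_cbox by blast
  from content_cbox_cart[OF this] have "measure lborel (square z p q) = (q - p)\<^sup>2"
    unfolding square_cbox by (simp add: power2_eq_square prod_constant)
  moreover have "measure lborel A \<le> measure lborel (square z p q)"
    by (rule measure_mono_fmeasurable[OF assms(2)]) (use assms(1) f in \<open>auto simp: fmeasurable_def\<close>)
  ultimately have "measure lborel A \<le> V" using assms(4) by linarith
  moreover have "integrable lborel (indicat_real A)" by (rule integrable_real_indicator[OF _ fA]) (use assms(1) in simp)
  ultimately show ?thesis using assms(1) unfolding unit_fn_def by (auto simp: indicator_def)
qed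

text \<open>Monotonicity of the nonnegative integral passes from \<open>A\<close>, \<open>B\<close>
  to Borel supersets; cutting these to the window loses nothing, as it contains all points
  concerned. \<open>FAB_integral_eq_config_count\<close> then applies to bounded Borel sets.\<close>

lemma delta_avg_le_config_count:
  assumes r: "0 < r" "r \<le> R / 2 ^ 6" and AB: "A \<subseteq> A''" "B \<subseteq> B''" and m: "A'' \<in> sets borel" "B'' \<in> sets borel"
    and c: "0 < c" "ennreal c \<le> delta_avg A B z R r"
  shows "c * R\<^sup>2 \<le> config_count (indicat_real (A'' \<inter> window z R)) (indicat_real (B'' \<inter> window z R)) (usq r)"
proof -
  let ?A = "A'' \<inter> window z R" and ?B = "B'' \<inter> window z R"
  have R: "0 < R" using r by simp
  let ?S = "sq r \<times> sq r \<times> sq r \<times> sq r \<times> sq r \<times> sq r"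
  let ?N = "\<integral>\<^sup>+x\<in>square z 0 R. (\<integral>\<^sup>+(v1, v2, v3, s1, s2, s3)\<in>?S. FAB A B x v1 v2 v3 s1 s2 s3 \<partial>lebesgue) \<partial>lebesgue"
  have "?N \<le> (\<integral>\<^sup>+x. (\<integral>\<^sup>+(v1, v2, v3, s1, s2, s3)\<in>?S. FAB ?A ?B x v1 v2 v3 s1 s2 s3 \<partial>lborel) \<partial>lborel)"
    unfolding nn_integral_completion
  proof (rule nn_integral_mono)
    fix x :: plane
    show "(\<integral>\<^sup>+p. (case p of (v1, v2, v3, s1, s2, s3) \<Rightarrow> FAB A B x v1 v2 v3 s1 s2 s3) * indicator ?S p \<partial>lborel) * indicator (square z 0 R) x
      \<le> (\<integral>\<^sup>+p. (case p of (v1, v2, v3, s1, s2, s3) \<Rightarrow> FAB ?A ?B x v1 v2 v3 s1 s2 s3) * indicator ?S p \<partial>lborel)"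
    proof (cases "x \<in> square z 0 R")
      case True
      have w: "x + u \<in> window z R" if "u \<in> sq (2 * r)" for u
      proof -
        have "0 \<le> x $ i - z $ i \<and> x $ i - z $ i \<le> R \<and> \<bar>u $ i\<bar> \<le> 2 * r" for i
          using True that by (auto simp: square_iff sq_def)
        moreover have "2 * r \<le> R" using r R by simp
        ultimately have "- R \<le> (x + u) $ i - z $ i \<and> (x + u) $ i - z $ i \<le> 2 * R" for i
          using abs_le_iff[of "u $ i" "2 * r"] by (smt (verit) vector_add_component)
        then show ?thesis unfolding window_def square_iff by blast
      qed
      have w1: "x + u \<in> window z R" if "u \<in> sq r" for u by (rule w[OF sq_mono[OF _ that]]) (use r in simp)
      have w2: "x + u + v \<in> window z R" if "u \<in> sq r" "v \<in> sq r" for u v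
        using w[of "u + v"] sq_add[OF that] by (simp add: add.assoc)
      have w0: "x \<in> window z R" using w[of 0] r by (simp add: sq_def)
      have le: "FAB A B x v1 v2 v3 s1 s2 s3 \<le> FAB ?A ?B x v1 v2 v3 s1 s2 s3"
        if "v1 \<in> sq r" "v2 \<in> sq r" "v3 \<in> sq r" "s1 \<in> sq r" "s2 \<in> sq r" "s3 \<in> sq r" for v1 v2 v3 s1 s2 s3
      proof -
        have i: "indicator A y \<le> (indicator ?A y :: ennreal)" "indicator B y \<le> (indicator ?B y :: ennreal)" if "y \<in> window z R" for y
          using that AB by (auto simp: indicator_def)
        show ?thesis unfolding FAB_def using that by (intro mult_mono i w0 w1 w2) auto
      qed
      have "(\<integral>\<^sup>+p. (case p of (v1, v2, v3, s1, s2, s3) \<Rightarrow> FAB A B x v1 v2 v3 s1 s2 s3) * indicator ?S p \<partial>lborel)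
        \<le> (\<integral>\<^sup>+p. (case p of (v1, v2, v3, s1, s2, s3) \<Rightarrow> FAB ?A ?B x v1 v2 v3 s1 s2 s3) * indicator ?S p \<partial>lborel)"
        by (rule nn_integral_mono) (auto simp: indicator_def[of ?S] intro: le)
      then show ?thesis using True by simp
    qed simp
  qed
  also have "\<dots> = ennreal ((2 * r) ^ 12) * ennreal (config_count (indicat_real ?A) (indicat_real ?B) (usq r))"
  proof (rule FAB_integral_eq_config_count[OF r(1)])
    show "?A \<in> sets borel" "?B \<in> sets borel" using m by (auto simp: window_def)
    then show "unit_fn ((3 * R)\<^sup>2) (indicat_real ?A)" "unit_fn ((3 * R)\<^sup>2) (indicat_real ?B)"
      using R by (auto intro!: unit_fn_indicator[of _ z "- R" "2 * R"] simp: window_def)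
  qed
  finally have N: "?N \<le> ennreal ((2 * r) ^ 12) * ennreal (config_count (indicat_real ?A) (indicat_real ?B) (usq r))" .
  have pos: "0 < (2 * r) ^ 12 * R\<^sup>2" using r R by simp
  have "delta_avg A B z R r = ?N / ennreal ((2 * r) ^ 12 * R\<^sup>2)" by (simp only: delta_avg_def square_sq)
  then have "ennreal c * ennreal ((2 * r) ^ 12 * R\<^sup>2) \<le> ?N / ennreal ((2 * r) ^ 12 * R\<^sup>2) * ennreal ((2 * r) ^ 12 * R\<^sup>2)"
    using c(2) by (intro mult_right_mono) auto
  also have "\<dots> = ?N" using pos r(1) R by (simp add: ennreal_divide_times divide_ennreal del: ennreal_mult_divide_eq power_mult_distrib)
  also note N
  finally have "ennreal (c * ((2 * r) ^ 12 * R\<^sup>2)) \<le> ennreal ((2 * r) ^ 12 * config_count (indicat_real ?A) (indicat_real ?B) (usq r))"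
    using r c by (simp add: ennreal_mult'[symmetric] ennreal_mult''[symmetric])
  moreover have "0 < c * ((2 * r) ^ 12 * R\<^sup>2)" using c pos by simp
  ultimately have "c * ((2 * r) ^ 12 * R\<^sup>2) \<le> (2 * r) ^ 12 * config_count (indicat_real ?A) (indicat_real ?B) (usq r)"
    by (simp add: ennreal_le_iff2)
  then have "(2 * r) ^ 12 * (c * R\<^sup>2) \<le> (2 * r) ^ 12 * config_count (indicat_real ?A) (indicat_real ?B) (usq r)" by (simp add: ac_simps)
  then show ?thesis using r by (simp only: mult_le_cancel_left_pos zero_less_power mult_pos_pos zero_less_numeral)
qed

theorem theorem1p6:
  fixes A B \<Gamma> :: "(real^2) set"
  assumes "A \<in> sets lebesgue" and "B \<in> sets lebesgue"
    and "delta_VC A B > 0"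
    and "smooth_closed_curve_nonvanishing_curvature \<Gamma>"
    and "uminus ` \<Gamma> = \<Gamma>"
    and "\<exists>K. compact K \<and> convex K \<and> interior K \<noteq> {} \<and> frontier K = \<Gamma>"
  shows "\<exists>t0::real. t0 > 0 \<and> (\<forall>t\<ge>t0. VC_dim UNIV (translates_family \<Gamma> t A B) = 3)"
proof (rule ccontr)
  assume no: "\<not> ?thesis"
  obtain L \<gamma> where \<gamma>: "closed_curve_param L \<gamma>" "range \<gamma> = \<Gamma>" "\<And>t. signed_curvature \<gamma> t \<noteq> 0"
    using assms(4) by (auto simp: smooth_closed_curve_nonvanishing_curvature_def)
  obtain K where K: "compact K" "convex K" "interior K \<noteq> {}" "frontier K = \<Gamma>" using assms(6) by blast
  obtain \<gamma>' l where l: "0 < l" "l < L" and d: "\<And>s. (\<gamma> has_vector_derivative \<gamma>' s) (at s)"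
    and ne: "\<And>s s'. s \<in> {0..l} \<Longrightarrow> s' \<in> {0..l} \<Longrightarrow> s \<noteq> s' \<Longrightarrow> cross2 (\<gamma>' s) (\<gamma>' s') \<noteq> 0"
    by (rule obtain_arc[OF \<gamma>(1,3)]) blast
  have "continuous_on UNIV \<gamma>"
    by (auto intro!: continuous_at_imp_continuous_on has_vector_derivative_continuous[OF d])
  then have mg: "\<gamma> \<in> borel_measurable borel" by (rule borel_measurable_continuous_onI)
  have comp: "compact \<Gamma>" using compact_frontier[OF K(1)] K(4) by simp
  have neg: "negligible \<Gamma>" using negligible_convex_frontier[OF K(2)] K(4) by simp
  have fr: "frontier K = range \<gamma>" using K(4) \<gamma>(2) by simp
  have sp: "sparse_translates \<Gamma> t" if "0 < t" for t
    unfolding K(4)[symmetric]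
  proof (rule sparse_translatesI[OF _ compact_imp_closed[OF K(1)] that])
    show "z \<in> interior K" if "x \<in> K" "y \<in> K" "x \<noteq> y" "z \<in> open_segment x y" for x y z
      by (rule strictly_convex_curve[OF \<gamma>(1,3) K(1-3) fr that])
  qed
  obtain C0 where C0: "1 \<le> C0" "\<And>\<theta>. \<gamma> \<theta> \<in> sq C0"
  proof -
    obtain D where D: "\<And>x. x \<in> \<Gamma> \<Longrightarrow> norm x \<le> D" using compact_imp_bounded[OF comp] by (auto simp: bounded_iff)
    have "\<gamma> \<theta> \<in> sq (max 1 D)" for \<theta>
    proof -
      have "norm (\<gamma> \<theta>) \<le> D" by (rule D) (use \<gamma>(2) in blast)
      then have "\<bar>\<gamma> \<theta> $ i\<bar> \<le> D" for i using component_le_norm_cart[of "\<gamma> \<theta>" i] by linarith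
      then show ?thesis unfolding sq_def by (auto simp: le_max_iff_disj)
    qed
    then show ?thesis using that[of "max 1 D"] by simp
  qed
  obtain c M where c: "0 < c" "1 \<le> (M :: real)"
    and big: "\<And>R0. \<exists>R z. R0 \<le> R \<and> (\<forall>r\<in>{M..R / 2 ^ 6}. ennreal c \<le> delta_avg A B z R r)"
    by (rule delta_unpack[OF assms(3)]) blast
  obtain A' A'' where A': "A' \<in> sets borel" "A'' \<in> sets borel" "A' \<subseteq> A" "A \<subseteq> A''" "AE x in lborel. x \<in> A'' \<longrightarrow> x \<in> A'"
    by (rule lebesgue_borel_sandwich[OF assms(1)])
  obtain B' B'' where B': "B' \<in> sets borel" "B'' \<in> sets borel" "B' \<subseteq> B" "B \<subseteq> B''" "AE x in lborel. x \<in> B'' \<longrightarrow> x \<in> B'"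
    by (rule lebesgue_borel_sandwich[OF assms(2)])
  \<comment> \<open>With \<open>V\<close> equal to \<open>400 * R\<^sup>2\<close>, the error
    \<open>c / 800 * V\<close> is half of the lower bound \<open>c * R\<^sup>2\<close>.\<close>
  have "0 < c / 800" using c(1) by simp
  from exists_good_scale[OF l(1) d ne C0(2,1) this] obtain \<Lambda> J where \<Lambda>: "2 \<le> \<Lambda>" and main:
    "\<And>t V a c' w. 0 < t 0 \<Longrightarrow> (\<And>k. \<Lambda> * t k \<le> t (Suc k)) \<Longrightarrow> 0 \<le> V \<Longrightarrow> unit_fn V a \<Longrightarrow> unit_fn V c' \<Longrightarrow> unit_fn V w \<Longrightarrow>
       (\<And>y v v'. a y * c' (y + v) * c' (y + v') * w (y + v + v') = a y * c' (y + v) * c' (y + v')) \<Longrightarrow>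
       \<exists>n<J. config_count a c' (usq (t (2*n))) \<le> config_count a c' (arc_measure \<gamma> l (t (2*n))) + c / 800 * V"
    by blast
  \<comment> \<open>The maximum with 1 is an admissible \<open>t0\<close>, so the negated claim
    yields an exceptional scale beyond it.\<close>
  have "\<forall>s. \<exists>t. max 1 s \<le> t \<and> VC_dim UNIV (translates_family \<Gamma> t A B) \<noteq> 3"
  proof
    fix s :: real
    have "0 < max 1 s" by simp
    with no show "\<exists>t. max 1 s \<le> t \<and> VC_dim UNIV (translates_family \<Gamma> t A B) \<noteq> 3" by blast
  qed
  then obtain f where f: "\<And>s. max 1 s \<le> f s" "\<And>s. VC_dim UNIV (translates_family \<Gamma> (f s) A B) \<noteq> 3" by metis
  \<comment> \<open>A lacunary sequence of exceptional scales; starting at \<open>f M\<close> makes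
    all of them at least \<open>M\<close>.\<close>
  define t where "t = rec_nat (f M) (\<lambda>_ s. f (\<Lambda> * s))"
  have t0: "t 0 = f M" and tS: "t (Suc k) = f (\<Lambda> * t k)" for k by (simp_all add: t_def)
  have tpos: "1 \<le> t k" for k using f(1)[of M] f(1)[of "\<Lambda> * t (k - 1)"] t0 tS[of "k - 1"] by (cases k) auto
  have tl: "\<Lambda> * t k \<le> t (Suc k)" for k using f(1)[of "\<Lambda> * t k"] tS[of k] by simp
  have tVC: "VC_dim UNIV (translates_family \<Gamma> (t k) A B) \<noteq> 3" for k by (cases k) (use f(2) t0 tS in auto)
  have "t k \<le> t (Suc k)" for k
  proof -
    have "1 * t k \<le> \<Lambda> * t k" using \<Lambda> tpos[of k] by (intro mult_right_mono) auto
    then show ?thesis using tl[of k] by linarith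
  qed
  then have tm: "t i \<le> t j" if "i \<le> j" for i j using that by (rule lift_Suc_mono_le)
  \<comment> \<open>\<open>R\<close> is chosen after the scales. The factor 64 makes all of them up
    to \<open>t (2 * J)\<close> admissible for the same \<open>z\<close>, whichever proves
    good.\<close>
  obtain R z where R: "64 * t (2 * J) \<le> R" "\<And>r. r \<in> {M..R / 2 ^ 6} \<Longrightarrow> ennreal c \<le> delta_avg A B z R r" using big by metis
  have R0: "0 < R" using R(1) tpos[of "2 * J"] by linarith
  let ?W = "window z R"
  have W: "?W \<in> sets borel" by (simp add: window_def)
  let ?a = "indicat_real (A' \<inter> ?W)" and ?c = "indicat_real (B' \<inter> ?W)" and ?w = "indicat_real (square z (- 10 * R) (10 * R))"
  \<comment> \<open>The area of the square of side \<open>20 * R\<close> in \<open>?w\<close>; the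
    two sets cut to the window have smaller area.\<close>
  let ?V = "400 * R\<^sup>2"
  have cuts: "unit_fn ?V ?a" "unit_fn ?V ?c" "unit_fn ?V ?w"
  proof -
    have "(2 * R - (- R))\<^sup>2 \<le> ?V" "(10 * R - (- 10 * R))\<^sup>2 \<le> ?V" using R0 by (simp_all add: power2_eq_square algebra_simps)
    then show "unit_fn ?V ?a" "unit_fn ?V ?c" "unit_fn ?V ?w"
      using unit_fn_indicator[of "A' \<inter> ?W" z "- R" "2 * R" ?V] unit_fn_indicator[of "B' \<inter> ?W" z "- R" "2 * R" ?V] unit_fn_indicator[of _ z "- 10 * R" "10 * R" ?V]
        A'(1) B'(1) R0 by (auto simp: window_def)
  qed
  have wabs: "?a y * ?c (y + v) * ?c (y + v') * ?w (y + v + v') = ?a y * ?c (y + v) * ?c (y + v')" for y v v'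
  proof -
    \<comment> \<open>The point is \<open>(y + v) + (y + v') - y\<close>, so its coordinates
      relative to \<open>z\<close> lie between \<open>- 4 * R\<close> and
      \<open>5 * R\<close>.\<close>
    have "y + v + v' \<in> square z (- 10 * R) (10 * R)" if "y \<in> ?W" "y + v \<in> ?W" "y + v' \<in> ?W"
      unfolding square_iff
    proof
      fix i
      have "- R \<le> y $ i - z $ i \<and> y $ i - z $ i \<le> 2 * R" "- R \<le> y $ i + v $ i - z $ i \<and> y $ i + v $ i - z $ i \<le> 2 * R"
        "- R \<le> y $ i + v' $ i - z $ i \<and> y $ i + v' $ i - z $ i \<le> 2 * R"
        using that unfolding window_def square_iff by auto
      then show "- 10 * R \<le> (y + v + v') $ i - z $ i \<and> (y + v + v') $ i - z $ i \<le> 10 * R"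
        using R0 by simp
    qed
    then show ?thesis by (auto simp: indicator_def)
  qed
  obtain n where n: "n < J" "config_count ?a ?c (usq (t (2*n))) \<le> config_count ?a ?c (arc_measure \<gamma> l (t (2*n))) + c / 800 * ?V"
    using main[of t ?V ?a ?c ?w, OF _ tl _ cuts wabs] tpos[of 0] by auto
  have tn: "0 < t (2 * n)" using tpos[of "2 * n"] by linarith
  have bad: "\<not> shattered (translates_family \<Gamma> (t (2*n)) A B) C" if "card C = 3" for C
    using VC_dim_eq_3[OF sp[OF tn] that] tVC[of "2*n"] by blast
  have zero: "config_count ?a ?c (arc_measure \<gamma> l (t (2*n))) = 0"
    by (rule config_count_zero[OF \<gamma>(1) l mg tn \<gamma>(2) comp neg assms(5) sp[OF tn] bad]) (use A' B' W in auto)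
  have "t (2 * n) \<le> R / 2 ^ 6" using tm[of "2 * n" "2 * J"] n(1) R(1) by simp
  moreover have "M \<le> t (2 * n)" using tm[of 0 "2 * n"] f(1)[of M] t0 by simp
  \<comment> \<open>The density bound comes through the Borel supersets, the vanishing of the arc
    count through the subsets; for the measure on the square the two counts agree.\<close>
  ultimately have "c * R\<^sup>2 \<le> config_count (indicat_real (A'' \<inter> ?W)) (indicat_real (B'' \<inter> ?W)) (usq (t (2*n)))"
    by (intro delta_avg_le_config_count[OF tn _ A'(4) B'(4) A'(2) B'(2) c(1)] R(2)) auto
  also have "\<dots> = config_count ?a ?c (usq (t (2*n)))"
  proof (rule config_count_AE_cong[OF tn])
    show "AE x in lborel. indicat_real (A'' \<inter> ?W) x = ?a x" using A'(5) by eventually_elim (use A'(3,4) in \<open>auto simp: indicator_def\<close>)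
    show "AE x in lborel. indicat_real (B'' \<inter> ?W) x = ?c x" using B'(5) by eventually_elim (use B'(3,4) in \<open>auto simp: indicator_def\<close>)
  qed (use A' B' W in auto)
  also have "\<dots> \<le> c * R\<^sup>2 / 2" using n(2) zero by simp
  finally show False using c(1) R0 by simp
qed

end
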